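(* Let $B$ be a smooth manifold. The following two structures are equivalent: (1) a dually flat (Hessian) manifold $(B,g,\nabla^+,\nabla^-)$ together with a strictly convex potential $\Psi$ such that $g=D^2\Psi$ in $\nabla^+$-flat coordinates; (2) a Legendre bundle $(H,\langle\!\langle\cdot,\cdot\rangle\!\rangle,\nabla^+,\nabla^-,\Psi)$ over $B$. The correspondence is given explicitly as follows. Given a dually flat manifold with potential $\Psi$, set $H=TB\oplus T^*B$ with its natural pairing $\langle\!\langle X\oplus\alpha,Y\oplus\beta\rangle\!\rangle=\alpha(Y)+\beta(X)$, let $\nabla^+$ be the given flat connection on $TB$, let $\nabla^-$ be the dual flat connection on $T^*B$, and retain $\Psi$ as potential; this defines a Legendre bundle. Conversely, given a Legendre bundle, define $g(X,Y)=\langle\!\langle X,\mathscr{L}_\Psi(Y)\rangle\!\rangle$, where $\mathscr{L}_\Psi$ is its Legendre morphism; using the identifications $H^+\cong TB$ and $H^-\cong T^*B$, the connections $\nabla^+$ and $\nabla^-$ induce affine connections on $TB$ and $T^*B$, and this equips $B$ with the structure of a dually flat manifold with potential $\Psi$. These constructions are mutually inverse (under the identifications $H^+\cong TB$, $H^-\cong T^*B$) and preserve all the structure.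
   Context: Dually flat manifold: a Riemannian manifold $(B,g)$ with a pair of torsion-free flat connections $\nabla^+,\nabla^-$ on $TB$ satisfying $Z\,g(X,Y)=g(\nabla^+_ZX,Y)+g(X,\nabla^-_ZY)$ for all vector fields $X,Y,Z$, and admitting local potential functions $\Psi,\Psi^*$ related by the Fenchel–Young identity $\Psi(\theta)+\Psi^*(\eta)=\langle\theta,\eta\rangle$ whenever $\eta=d\Psi(\theta)$, where $\theta$ are local $\nabla^+$-flat coordinates. In (1), $\Psi\in C^\infty(B)$. The connection $\nabla^-$ on $TB$ is regarded as a connection on $T^*B$ by means of the isomorphism $TB\to T^*B$, $Y\mapsto g(Y,\cdot)$; this is "the dual flat connection on $T^*B$", and in the reverse direction a connection on $T^*B$ is regarded as one on $TB$ by the same isomorphism. Legendre bundle over $B$: a quintuple $(H,\langle\!\langle\cdot,\cdot\rangle\!\rangle,\nabla^+,\nabla^-,\Psi)$ where: (1) $H=H^+\oplus H^-$ is a vector bundle over $B$ with isomorphisms $H^+\cong TB$, $H^-\cong T^*B$; (2) $\langle\!\langle\cdot,\cdot\rangle\!\rangle$ is a non-degenerate symmetric bilinear form on $H$ vanishing on $H^+\otimes H^+$ and on $H^-\otimes H^-$, with $\langle\!\langle X,\alpha\rangle\!\rangle=\alpha(X)$ for $X\in H^+$, $\alpha\in H^-$; (3) $\nabla^+$ and $\nabla^-$ are flat connections on $H^+$ and $H^-$ satisfying $Z\langle\!\langle X,\alpha\rangle\!\rangle=\langle\!\langle\nabla^+_ZX,\alpha\rangle\!\rangle+\langle\!\langle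 X,\nabla^-_Z\alpha\rangle\!\rangle$ for all sections $X$ of $H^+$, $\alpha$ of $H^-$ and all vector fields $Z$ on $B$; here $\nabla^+$, viewed on $TB$, is torsion-free, so that local $\nabla^+$-flat coordinates $(\theta^i)$ (with $\partial_i=\partial/\partial\theta^i$ parallel) exist; (4) $\Psi\in C^\infty(B)$ is strictly convex with respect to the flat structure of $\nabla^+$, with associated Legendre morphism $\mathscr{L}_\Psi:H^+\to H^-$ defined in $\nabla^+$-flat coordinates by $\mathscr{L}_\Psi(\partial_j)=\sum_i(\partial_i\partial_j\Psi)\,d\theta^i$ and extended linearly. "Strictly convex" means that the Hessian $D^2\Psi=(\partial_i\partial_j\Psi)$ in $\nabla^+$-flat coordinates is positive definite (it serves as a Riemannian metric). *)

theory Defs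
  imports "HOL-Analysis.Analysis" "HOL-Library.Function_Algebras"
begin

text \<open>Functions carry the pointwise vector space structure, so that tangent and cotangent
  spaces can be introduced as subspaces of function spaces.\<close>

instantiation "fun" :: (type, real_vector) real_vector
begin

definition scaleR_fun :: "real \<Rightarrow> ('a \<Rightarrow> 'b) \<Rightarrow> 'a \<Rightarrow> 'b" where
  "scaleR_fun r f = (\<lambda>x. r *\<^sub>R f x)"

instance
  by standard (simp_all add: scaleR_fun_def fun_eq_iff scaleR_add_right scaleR_add_left)

end

definition linear_on_subspace :: "'v::real_vector set \<Rightarrow> ('v \<Rightarrow> 'w::real_vector) \<Rightarrow> bool" where
  "linear_on_subspace S f \<longleftrightarrow>
     (\<forall>x\<in>S. \<forall>y\<in>S. \<forall>a b. f (a *\<^sub>R x + b *\<^sub>R y) = a *\<^sub>R f x + b *\<^sub>R f y)"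


section \<open>Calculus on open subsets of Euclidean space\<close>

text \<open>\<open>Ck_on\<close> and \<open>smooth_on\<close> are meant for open sets only.\<close>

primrec Ck_on :: "nat \<Rightarrow> 'a::euclidean_space set \<Rightarrow> ('a \<Rightarrow> 'b::real_normed_vector) \<Rightarrow> bool" where
  "Ck_on 0 U f \<longleftrightarrow> continuous_on U f"
| "Ck_on (Suc k) U f \<longleftrightarrow> (\<forall>x\<in>U. f differentiable (at x)) \<and>
     (\<forall>v. Ck_on k U (\<lambda>x. frechet_derivative f (at x) v))"

definition smooth_on :: "'a::euclidean_space set \<Rightarrow> ('a \<Rightarrow> 'b::real_normed_vector) \<Rightarrow> bool" where
  "smooth_on U f \<longleftrightarrow> (\<forall>k. Ck_on k U f)"

definition partial :: "'n \<Rightarrow> (real ^ 'n \<Rightarrow> real) \<Rightarrow> real ^ 'n \<Rightarrow> real" where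
  "partial i f x = frechet_derivative f (at x) (axis i 1)"

definition gradient :: "(real ^ 'n \<Rightarrow> real) \<Rightarrow> real ^ 'n \<Rightarrow> real ^ 'n" where
  "gradient f x = (\<chi> i. partial i f x)"


section \<open>Smooth manifolds\<close>

text \<open>A chart is a pair of its domain and its coordinate map; values of the coordinate map
  outside of the domain are irrelevant.\<close>

type_synonym ('b, 'n) chart = "'b set \<times> ('b \<Rightarrow> real ^ 'n)"

definition chart_inv :: "('b, 'n) chart \<Rightarrow> real ^ 'n \<Rightarrow> 'b" where
  "chart_inv c = inv_into (fst c) (snd c)"

definition is_chart :: "('b::topological_space, 'n::finite) chart \<Rightarrow> bool" where
  "is_chart c \<longleftrightarrow> open (fst c) \<and> open (snd c ` fst c) \<and>
     homeomorphism (fst c) (snd c ` fst c) (snd c) (chart_inv c)"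

definition compatible :: "('b, 'n::finite) chart \<Rightarrow> ('b, 'n) chart \<Rightarrow> bool" where
  "compatible c d \<longleftrightarrow>
     smooth_on (snd c ` (fst c \<inter> fst d)) (snd d \<circ> chart_inv c) \<and>
     smooth_on (snd d ` (fst c \<inter> fst d)) (snd c \<circ> chart_inv d)"

text \<open>A smooth structure is a maximal smooth atlas, so that its elements are precisely the
  local coordinate systems of the manifold.\<close>

definition smooth_manifold ::
    "('b::{t2_space, second_countable_topology}, 'n::finite) chart set \<Rightarrow> bool" where
  "smooth_manifold A \<longleftrightarrow>
     (\<forall>c\<in>A. is_chart c) \<and> (\<Union>c\<in>A. fst c) = UNIV \<and>
     (\<forall>c\<in>A. \<forall>d\<in>A. compatible c d) \<and>
     (\<forall>c. is_chart c \<and> (\<forall>d\<in>A. compatible c d) \<longrightarrow> c \<in> A)"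

definition charts_at :: "('b, 'n) chart set \<Rightarrow> 'b \<Rightarrow> ('b, 'n) chart set" where
  "charts_at A p = {c \<in> A. p \<in> fst c}"

definition smooth_map_on ::
    "('b, 'n::finite) chart set \<Rightarrow> 'b set \<Rightarrow> ('b \<Rightarrow> 'e::real_normed_vector) \<Rightarrow> bool" where
  "smooth_map_on A U f \<longleftrightarrow> (\<forall>c\<in>A. smooth_on (snd c ` (U \<inter> fst c)) (f \<circ> chart_inv c))"


section \<open>Tangent and cotangent vectors\<close>

text \<open>A tangent vector at \<open>p\<close> is the family of its coordinate vectors in all charts around
  \<open>p\<close>, related by the Jacobians of the coordinate changes (and extended by 0 to all other
  charts).\<close>

type_synonym ('b, 'n) tvec = "('b, 'n) chart \<Rightarrow> real ^ 'n"
type_synonym ('b, 'n) covec = "('b, 'n) tvec \<Rightarrow> real"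

definition tangent_space :: "('b, 'n::finite) chart set \<Rightarrow> 'b \<Rightarrow> ('b, 'n) tvec set" where
  "tangent_space A p = {v.
     (\<forall>c\<in>charts_at A p. \<forall>d\<in>charts_at A p.
        v d = frechet_derivative (snd d \<circ> chart_inv c) (at (snd c p)) (v c)) \<and>
     (\<forall>c. c \<notin> charts_at A p \<longrightarrow> v c = 0)}"

definition cotangent_space :: "('b, 'n::finite) chart set \<Rightarrow> 'b \<Rightarrow> ('b, 'n) covec set" where
  "cotangent_space A p = {\<alpha>. linear_on_subspace (tangent_space A p) \<alpha> \<and>
     (\<forall>v. v \<notin> tangent_space A p \<longrightarrow> \<alpha> v = 0)}"

definition coord_field ::
    "('b, 'n::finite) chart set \<Rightarrow> ('b, 'n) chart \<Rightarrow> 'n \<Rightarrow> 'b \<Rightarrow> ('b, 'n) tvec" where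
  "coord_field A c i p = (\<lambda>d. if d \<in> charts_at A p
     then frechet_derivative (snd d \<circ> chart_inv c) (at (snd c p)) (axis i 1) else 0)"

definition coord_form ::
    "('b, 'n::finite) chart set \<Rightarrow> ('b, 'n) chart \<Rightarrow> 'n \<Rightarrow> 'b \<Rightarrow> ('b, 'n) covec" where
  "coord_form A c i p = (\<lambda>v. if v \<in> tangent_space A p then v c $ i else 0)"

text \<open>The derivative of a function \<open>f\<close>, smooth near \<open>p\<close>, along a tangent vector; it does not
  depend on the chart used to compute it.\<close>

definition tderiv ::
    "('b, 'n::finite) chart set \<Rightarrow> 'b \<Rightarrow> ('b, 'n) tvec \<Rightarrow> ('b \<Rightarrow> real) \<Rightarrow> real" where
  "tderiv A p v f = (THE r. \<forall>c\<in>charts_at A p.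
     r = frechet_derivative (f \<circ> chart_inv c) (at (snd c p)) (v c))"

definition lie_bracket :: "('b, 'n::finite) chart set \<Rightarrow>
    ('b \<Rightarrow> ('b, 'n) tvec) \<Rightarrow> ('b \<Rightarrow> ('b, 'n) tvec) \<Rightarrow> 'b \<Rightarrow> ('b, 'n) tvec" where
  "lie_bracket A X Y p = (\<lambda>c. if c \<in> charts_at A p then
       frechet_derivative (\<lambda>x. Y (chart_inv c x) c) (at (snd c p)) (X p c) -
       frechet_derivative (\<lambda>x. X (chart_inv c x) c) (at (snd c p)) (Y p c)
     else 0)"


section \<open>Vector bundles\<close>

text \<open>The fibres are subspaces of an ambient real vector space (without topology). The smooth
  structure is given by local trivialisations \<open>(U, \<tau>)\<close> with model fibre \<open>'f\<close>, where \<open>\<tau> p\<close>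
  maps the fibre over \<open>p \<in> U\<close> isomorphically to \<open>'f\<close>.\<close>

record ('b, 'h, 'f) vbundle =
  fibre :: "'b \<Rightarrow> 'h set"
  trivs :: "('b set \<times> ('b \<Rightarrow> 'h \<Rightarrow> 'f)) set"

definition vector_bundle :: "('b::topological_space, 'n::finite) chart set \<Rightarrow>
    ('b, 'h::real_vector, 'f::euclidean_space) vbundle \<Rightarrow> bool" where
  "vector_bundle A E \<longleftrightarrow>
     (\<forall>p. subspace (fibre E p)) \<and>
     (\<Union>(U, \<tau>)\<in>trivs E. U) = UNIV \<and>
     (\<forall>(U, \<tau>)\<in>trivs E. open U \<and>
        (\<forall>p\<in>U. linear_on_subspace (fibre E p) (\<tau> p) \<and> bij_betw (\<tau> p) (fibre E p) UNIV)) \<and>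
     (\<forall>(U, \<tau>)\<in>trivs E. \<forall>(V, \<sigma>)\<in>trivs E. \<forall>w.
        smooth_map_on A (U \<inter> V) (\<lambda>p. \<sigma> p (inv_into (fibre E p) (\<tau> p) w)))"

definition smooth_section :: "('b::topological_space, 'n::finite) chart set \<Rightarrow>
    ('b, 'h, 'f::euclidean_space) vbundle \<Rightarrow> 'b set \<Rightarrow> ('b \<Rightarrow> 'h) \<Rightarrow> bool" where
  "smooth_section A E U s \<longleftrightarrow> open U \<and> (\<forall>p\<in>U. s p \<in> fibre E p) \<and>
     (\<forall>(V, \<tau>)\<in>trivs E. smooth_map_on A (U \<inter> V) (\<lambda>p. \<tau> p (s p)))"

definition tangent_bundle ::
    "('b, 'n::finite) chart set \<Rightarrow> ('b, ('b, 'n) tvec, real ^ 'n) vbundle" where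
  "tangent_bundle A = \<lparr>fibre = tangent_space A, trivs = (\<lambda>c. (fst c, \<lambda>p v. v c)) ` A\<rparr>"

definition cotangent_bundle ::
    "('b, 'n::finite) chart set \<Rightarrow> ('b, ('b, 'n) covec, real ^ 'n) vbundle" where
  "cotangent_bundle A = \<lparr>fibre = cotangent_space A,
     trivs = (\<lambda>c. (fst c, \<lambda>p \<alpha>. \<chi> i. \<alpha> (coord_field A c i p))) ` A\<rparr>"

abbreviation vector_field :: "('b::topological_space, 'n::finite) chart set \<Rightarrow> 'b set \<Rightarrow>
    ('b \<Rightarrow> ('b, 'n) tvec) \<Rightarrow> bool" where
  "vector_field A \<equiv> smooth_section A (tangent_bundle A)"

definition whitney_sum :: "('b, 'h, 'f) vbundle \<Rightarrow> ('b, 'k, 'g) vbundle \<Rightarrow>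
    ('b, 'h \<times> 'k, 'f \<times> 'g) vbundle" where
  "whitney_sum E F = \<lparr>fibre = (\<lambda>p. fibre E p \<times> fibre F p),
     trivs = {(U \<inter> V, \<lambda>p. map_prod (\<tau> p) (\<sigma> p)) | U \<tau> V \<sigma>.
       (U, \<tau>) \<in> trivs E \<and> (V, \<sigma>) \<in> trivs F}\<rparr>"

text \<open>Bundle maps and isomorphisms cover the identity of the base.\<close>

definition bundle_map :: "('b, 'n::finite) chart set \<Rightarrow>
    ('b, 'h::real_vector, 'f::euclidean_space) vbundle \<Rightarrow>
    ('b, 'k::real_vector, 'g::euclidean_space) vbundle \<Rightarrow> ('b \<Rightarrow> 'h \<Rightarrow> 'k) \<Rightarrow> bool" where
  "bundle_map A E F \<Phi> \<longleftrightarrow>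
     (\<forall>p. \<Phi> p ` fibre E p \<subseteq> fibre F p \<and> linear_on_subspace (fibre E p) (\<Phi> p)) \<and>
     (\<forall>(U, \<tau>)\<in>trivs E. \<forall>(V, \<sigma>)\<in>trivs F. \<forall>w.
        smooth_map_on A (U \<inter> V) (\<lambda>p. \<sigma> p (\<Phi> p (inv_into (fibre E p) (\<tau> p) w))))"

definition bundle_inv :: "('b, 'h, 'f) vbundle \<Rightarrow> ('b \<Rightarrow> 'h \<Rightarrow> 'k) \<Rightarrow> 'b \<Rightarrow> 'k \<Rightarrow> 'h" where
  "bundle_inv E \<Phi> p = inv_into (fibre E p) (\<Phi> p)"

definition bundle_iso :: "('b, 'n::finite) chart set \<Rightarrow>
    ('b, 'h::real_vector, 'f::euclidean_space) vbundle \<Rightarrow>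
    ('b, 'k::real_vector, 'g::euclidean_space) vbundle \<Rightarrow> ('b \<Rightarrow> 'h \<Rightarrow> 'k) \<Rightarrow> bool" where
  "bundle_iso A E F \<Phi> \<longleftrightarrow> bundle_map A E F \<Phi> \<and>
     (\<forall>p. bij_betw (\<Phi> p) (fibre E p) (fibre F p)) \<and> bundle_map A F E (bundle_inv E \<Phi>)"


section \<open>Connections\<close>

text \<open>A connection is given by its covariant derivatives: \<open>nabla p v s\<close> is the derivative at \<open>p\<close>
  of a section \<open>s\<close>, smooth near \<open>p\<close>, along a tangent vector \<open>v\<close> at \<open>p\<close>. Its values on other
  arguments are irrelevant.\<close>

type_synonym ('b, 'n, 'h) conn = "'b \<Rightarrow> ('b, 'n) tvec \<Rightarrow> ('b \<Rightarrow> 'h) \<Rightarrow> 'h"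

definition connection :: "('b::topological_space, 'n::finite) chart set \<Rightarrow>
    ('b, 'h::real_vector, 'f::euclidean_space) vbundle \<Rightarrow> ('b, 'n, 'h) conn \<Rightarrow> bool" where
  "connection A E nabla \<longleftrightarrow>
     (\<forall>U s p v. smooth_section A E U s \<and> p \<in> U \<and> v \<in> tangent_space A p \<longrightarrow>
        nabla p v s \<in> fibre E p) \<and>
     (\<forall>U s t p v. smooth_section A E U s \<and> smooth_section A E U t \<and> (\<forall>q\<in>U. s q = t q) \<and>
        p \<in> U \<and> v \<in> tangent_space A p \<longrightarrow> nabla p v s = nabla p v t) \<and>
     (\<forall>U s p. smooth_section A E U s \<and> p \<in> U \<longrightarrow>
        linear_on_subspace (tangent_space A p) (\<lambda>v. nabla p v s)) \<and>
     (\<forall>U s t p v. smooth_section A E U s \<and> smooth_section A E U t \<and>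
        p \<in> U \<and> v \<in> tangent_space A p \<longrightarrow>
        nabla p v (\<lambda>q. s q + t q) = nabla p v s + nabla p v t) \<and>
     (\<forall>U f s p v. smooth_map_on A U f \<and> smooth_section A E U s \<and>
        p \<in> U \<and> v \<in> tangent_space A p \<longrightarrow>
        nabla p v (\<lambda>q. f q *\<^sub>R s q) = tderiv A p v f *\<^sub>R s p + f p *\<^sub>R nabla p v s) \<and>
     (\<forall>U Z s. vector_field A U Z \<and> smooth_section A E U s \<longrightarrow>
        smooth_section A E U (\<lambda>p. nabla p (Z p) s))"

definition conn_eq :: "('b::topological_space, 'n::finite) chart set \<Rightarrow>
    ('b, 'h, 'f::euclidean_space) vbundle \<Rightarrow> ('b, 'n, 'h) conn \<Rightarrow> ('b, 'n, 'h) conn \<Rightarrow> bool" where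
  "conn_eq A E nabla nabla' \<longleftrightarrow>
     (\<forall>U s p v. smooth_section A E U s \<and> p \<in> U \<and> v \<in> tangent_space A p \<longrightarrow>
        nabla p v s = nabla' p v s)"

text \<open>Flat means that the curvature tensor vanishes.\<close>

definition flat :: "('b::topological_space, 'n::finite) chart set \<Rightarrow>
    ('b, 'h::real_vector, 'f::euclidean_space) vbundle \<Rightarrow> ('b, 'n, 'h) conn \<Rightarrow> bool" where
  "flat A E nabla \<longleftrightarrow>
     (\<forall>U X Y s. vector_field A U X \<and> vector_field A U Y \<and> smooth_section A E U s \<longrightarrow>
        (\<forall>p\<in>U. nabla p (X p) (\<lambda>q. nabla q (Y q) s) - nabla p (Y p) (\<lambda>q. nabla q (X q) s)
           - nabla p (lie_bracket A X Y p) s = 0))"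

definition torsion_free :: "('b::topological_space, 'n::finite) chart set \<Rightarrow>
    ('b, 'n, ('b, 'n) tvec) conn \<Rightarrow> bool" where
  "torsion_free A nabla \<longleftrightarrow>
     (\<forall>U X Y. vector_field A U X \<and> vector_field A U Y \<longrightarrow>
        (\<forall>p\<in>U. nabla p (X p) Y - nabla p (Y p) X = lie_bracket A X Y p))"

text \<open>A connection on \<open>E\<close>, regarded as a connection on the target of an isomorphism \<open>\<Phi>\<close>
  defined on \<open>E\<close>.\<close>

definition transport_conn :: "('b, 'h, 'f) vbundle \<Rightarrow> ('b \<Rightarrow> 'h \<Rightarrow> 'k) \<Rightarrow>
    ('b, 'n, 'h) conn \<Rightarrow> ('b, 'n, 'k) conn" where
  "transport_conn E \<Phi> nabla = (\<lambda>p v s. \<Phi> p (nabla p v (\<lambda>q. bundle_inv E \<Phi> q (s q))))"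


section \<open>Flat coordinates, convexity and Hessians\<close>

definition flat_coords :: "('b::topological_space, 'n::finite) chart set \<Rightarrow>
    ('b, 'n, ('b, 'n) tvec) conn \<Rightarrow> ('b, 'n) chart \<Rightarrow> bool" where
  "flat_coords A nabla c \<longleftrightarrow> c \<in> A \<and>
     (\<forall>p\<in>fst c. \<forall>v\<in>tangent_space A p. \<forall>i. nabla p v (coord_field A c i) = 0)"

definition hessian :: "('b, 'n::finite) chart \<Rightarrow> ('b \<Rightarrow> real) \<Rightarrow> 'b \<Rightarrow> 'n \<Rightarrow> 'n \<Rightarrow> real" where
  "hessian c f p i j = partial i (partial j (f \<circ> chart_inv c)) (snd c p)"

definition strictly_convex :: "('b::topological_space, 'n::finite) chart set \<Rightarrow>
    ('b, 'n, ('b, 'n) tvec) conn \<Rightarrow> ('b \<Rightarrow> real) \<Rightarrow> bool" where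
  "strictly_convex A nabla \<Psi> \<longleftrightarrow>
     (\<forall>c. flat_coords A nabla c \<longrightarrow> (\<forall>p\<in>fst c. \<forall>w::real ^ 'n. w \<noteq> 0 \<longrightarrow>
        (\<Sum>i\<in>UNIV. \<Sum>j\<in>UNIV. hessian c \<Psi> p i j * w $ i * w $ j) > 0))"

text \<open>The morphism from the tangent to the cotangent bundle which in all flat coordinates sends
  the \<open>j\<close>-th coordinate field to the sum over \<open>i\<close> of \<open>hessian c \<Psi> p i j\<close> times the \<open>i\<close>-th
  coordinate form, extended linearly.\<close>

definition hessian_map :: "('b::topological_space, 'n::finite) chart set \<Rightarrow>
    ('b, 'n, ('b, 'n) tvec) conn \<Rightarrow> ('b \<Rightarrow> real) \<Rightarrow> 'b \<Rightarrow> ('b, 'n) tvec \<Rightarrow> ('b, 'n) covec" where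
  "hessian_map A nabla \<Psi> p v = (THE \<alpha>. \<forall>c. flat_coords A nabla c \<and> p \<in> fst c \<longrightarrow>
     \<alpha> = (\<Sum>j\<in>UNIV. v c $ j *\<^sub>R (\<Sum>i\<in>UNIV. hessian c \<Psi> p i j *\<^sub>R coord_form A c i p)))"


section \<open>Dually flat manifolds\<close>

definition riemannian_metric :: "('b::topological_space, 'n::finite) chart set \<Rightarrow>
    ('b \<Rightarrow> ('b, 'n) tvec \<Rightarrow> ('b, 'n) tvec \<Rightarrow> real) \<Rightarrow> bool" where
  "riemannian_metric A g \<longleftrightarrow>
     (\<forall>p. \<forall>X\<in>tangent_space A p. linear_on_subspace (tangent_space A p) (\<lambda>Y. g p X Y)) \<and>
     (\<forall>p. \<forall>X\<in>tangent_space A p. \<forall>Y\<in>tangent_space A p. g p X Y = g p Y X) \<and>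
     (\<forall>p. \<forall>X\<in>tangent_space A p. X \<noteq> 0 \<longrightarrow> g p X X > 0) \<and>
     (\<forall>U X Y. vector_field A U X \<and> vector_field A U Y \<longrightarrow>
        smooth_map_on A U (\<lambda>p. g p (X p) (Y p)))"

definition metric_flat :: "('b, 'n::finite) chart set \<Rightarrow>
    ('b \<Rightarrow> ('b, 'n) tvec \<Rightarrow> ('b, 'n) tvec \<Rightarrow> real) \<Rightarrow> 'b \<Rightarrow> ('b, 'n) tvec \<Rightarrow> ('b, 'n) covec" where
  "metric_flat A g p Y = (\<lambda>X. if X \<in> tangent_space A p then g p Y X else 0)"

text \<open>Local potentials: \<open>\<psi>\<close> is a function of the flat coordinates \<open>\<theta> = snd c\<close> and \<open>\<psi>s\<close> a
  function of the dual variable \<open>\<eta> = gradient \<psi> \<theta>\<close>.\<close>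

definition local_potentials :: "('b::topological_space, 'n::finite) chart set \<Rightarrow>
    ('b \<Rightarrow> ('b, 'n) tvec \<Rightarrow> ('b, 'n) tvec \<Rightarrow> real) \<Rightarrow> ('b, 'n) chart \<Rightarrow>
    (real ^ 'n \<Rightarrow> real) \<Rightarrow> (real ^ 'n \<Rightarrow> real) \<Rightarrow> bool" where
  "local_potentials A g c \<psi> \<psi>s \<longleftrightarrow>
     smooth_on (snd c ` fst c) \<psi> \<and>
     (\<forall>p\<in>fst c. \<forall>i j. g p (coord_field A c i p) (coord_field A c j p) =
        partial i (partial j \<psi>) (snd c p)) \<and>
     (\<exists>W. open W \<and> gradient \<psi> ` snd c ` fst c \<subseteq> W \<and> smooth_on W \<psi>s) \<and>
     (\<forall>\<theta>\<in>snd c ` fst c. \<forall>\<eta>. \<eta> = gradient \<psi> \<theta> \<longrightarrow> \<psi> \<theta> + \<psi>s \<eta> = \<theta> \<bullet> \<eta>)"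

definition dually_flat :: "('b::topological_space, 'n::finite) chart set \<Rightarrow>
    ('b \<Rightarrow> ('b, 'n) tvec \<Rightarrow> ('b, 'n) tvec \<Rightarrow> real) \<Rightarrow>
    ('b, 'n, ('b, 'n) tvec) conn \<Rightarrow> ('b, 'n, ('b, 'n) tvec) conn \<Rightarrow> bool" where
  "dually_flat A g nabla_p nabla_m \<longleftrightarrow>
     riemannian_metric A g \<and>
     connection A (tangent_bundle A) nabla_p \<and> flat A (tangent_bundle A) nabla_p \<and> torsion_free A nabla_p \<and>
     connection A (tangent_bundle A) nabla_m \<and> flat A (tangent_bundle A) nabla_m \<and> torsion_free A nabla_m \<and>
     (\<forall>U X Y Z. vector_field A U X \<and> vector_field A U Y \<and> vector_field A U Z \<longrightarrow>
        (\<forall>p\<in>U. tderiv A p (Z p) (\<lambda>q. g q (X q) (Y q)) =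
           g p (nabla_p p (Z p) X) (Y p) + g p (X p) (nabla_m p (Z p) Y))) \<and>
     (\<forall>p. \<exists>c \<psi> \<psi>s. p \<in> fst c \<and> flat_coords A nabla_p c \<and> local_potentials A g c \<psi> \<psi>s)"

record ('b, 'n) dually_flat_data =
  metric :: "'b \<Rightarrow> ('b, 'n) tvec \<Rightarrow> ('b, 'n) tvec \<Rightarrow> real"
  df_conn_plus :: "('b, 'n, ('b, 'n) tvec) conn"
  df_conn_minus :: "('b, 'n, ('b, 'n) tvec) conn"
  df_potential :: "'b \<Rightarrow> real"

definition dually_flat_with_potential :: "('b::topological_space, 'n::finite) chart set \<Rightarrow>
    ('b, 'n) dually_flat_data \<Rightarrow> bool" where
  "dually_flat_with_potential A D \<longleftrightarrow>
     dually_flat A (metric D) (df_conn_plus D) (df_conn_minus D) \<and>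
     smooth_map_on A UNIV (df_potential D) \<and>
     strictly_convex A (df_conn_plus D) (df_potential D) \<and>
     (\<forall>c. flat_coords A (df_conn_plus D) c \<longrightarrow> (\<forall>p\<in>fst c. \<forall>i j.
        metric D p (coord_field A c i p) (coord_field A c j p) = hessian c (df_potential D) p i j))"

text \<open>Equality of the structures, disregarding irrelevant arguments.\<close>

definition dually_flat_eq :: "('b::topological_space, 'n::finite) chart set \<Rightarrow>
    ('b, 'n) dually_flat_data \<Rightarrow> ('b, 'n) dually_flat_data \<Rightarrow> bool" where
  "dually_flat_eq A D D' \<longleftrightarrow>
     (\<forall>p. \<forall>X\<in>tangent_space A p. \<forall>Y\<in>tangent_space A p. metric D p X Y = metric D' p X Y) \<and>
     conn_eq A (tangent_bundle A) (df_conn_plus D) (df_conn_plus D') \<and>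
     conn_eq A (tangent_bundle A) (df_conn_minus D) (df_conn_minus D') \<and>
     df_potential D = df_potential D'"


section \<open>Legendre bundles\<close>

text \<open>The bundle \<open>H\<close> is the Whitney sum of \<open>Hplus\<close> and \<open>Hminus\<close>; these are identified with the
  tangent and the cotangent bundle by \<open>ident_plus\<close> and \<open>ident_minus\<close>.\<close>

record ('b, 'n, 'h, 'k) legendre_data =
  Hplus :: "('b, 'h, real ^ 'n) vbundle"
  Hminus :: "('b, 'k, real ^ 'n) vbundle"
  ident_plus :: "'b \<Rightarrow> 'h \<Rightarrow> ('b, 'n) tvec"
  ident_minus :: "'b \<Rightarrow> 'k \<Rightarrow> ('b, 'n) covec"
  pairing :: "'b \<Rightarrow> 'h \<times> 'k \<Rightarrow> 'h \<times> 'k \<Rightarrow> real"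
  conn_plus :: "('b, 'n, 'h) conn"
  conn_minus :: "('b, 'n, 'k) conn"
  potential :: "'b \<Rightarrow> real"

definition total_bundle ::
    "('b, 'n, 'h, 'k) legendre_data \<Rightarrow> ('b, 'h \<times> 'k, (real ^ 'n) \<times> (real ^ 'n)) vbundle" where
  "total_bundle L = whitney_sum (Hplus L) (Hminus L)"

definition base_conn_plus ::
    "('b, 'n::finite, 'h, 'k) legendre_data \<Rightarrow> ('b, 'n, ('b, 'n) tvec) conn" where
  "base_conn_plus L = transport_conn (Hplus L) (ident_plus L) (conn_plus L)"

definition base_conn_minus ::
    "('b, 'n::finite, 'h, 'k) legendre_data \<Rightarrow> ('b, 'n, ('b, 'n) covec) conn" where
  "base_conn_minus L = transport_conn (Hminus L) (ident_minus L) (conn_minus L)"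

definition legendre_bundle :: "('b::topological_space, 'n::finite) chart set \<Rightarrow>
    ('b, 'n, 'h::real_vector, 'k::real_vector) legendre_data \<Rightarrow> bool" where
  "legendre_bundle A L \<longleftrightarrow>
     vector_bundle A (Hplus L) \<and> vector_bundle A (Hminus L) \<and> vector_bundle A (total_bundle L) \<and>
     bundle_iso A (Hplus L) (tangent_bundle A) (ident_plus L) \<and>
     bundle_iso A (Hminus L) (cotangent_bundle A) (ident_minus L) \<and>
     (\<forall>p. \<forall>x\<in>fibre (total_bundle L) p.
        linear_on_subspace (fibre (total_bundle L) p) (\<lambda>y. pairing L p x y)) \<and>
     (\<forall>p. \<forall>x\<in>fibre (total_bundle L) p. \<forall>y\<in>fibre (total_bundle L) p.
        pairing L p x y = pairing L p y x) \<and>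
     (\<forall>p. \<forall>x\<in>fibre (total_bundle L) p.
        (\<forall>y\<in>fibre (total_bundle L) p. pairing L p x y = 0) \<longrightarrow> x = 0) \<and>
     (\<forall>U s t. smooth_section A (total_bundle L) U s \<and> smooth_section A (total_bundle L) U t \<longrightarrow>
        smooth_map_on A U (\<lambda>p. pairing L p (s p) (t p))) \<and>
     (\<forall>p. \<forall>x\<in>fibre (Hplus L) p. \<forall>y\<in>fibre (Hplus L) p. pairing L p (x, 0) (y, 0) = 0) \<and>
     (\<forall>p. \<forall>\<alpha>\<in>fibre (Hminus L) p. \<forall>\<beta>\<in>fibre (Hminus L) p. pairing L p (0, \<alpha>) (0, \<beta>) = 0) \<and>
     (\<forall>p. \<forall>x\<in>fibre (Hplus L) p. \<forall>\<alpha>\<in>fibre (Hminus L) p.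
        pairing L p (x, 0) (0, \<alpha>) = ident_minus L p \<alpha> (ident_plus L p x)) \<and>
     connection A (Hplus L) (conn_plus L) \<and> flat A (Hplus L) (conn_plus L) \<and>
     connection A (Hminus L) (conn_minus L) \<and> flat A (Hminus L) (conn_minus L) \<and>
     (\<forall>U X \<alpha> Z. smooth_section A (Hplus L) U X \<and> smooth_section A (Hminus L) U \<alpha> \<and>
        vector_field A U Z \<longrightarrow>
        (\<forall>p\<in>U. tderiv A p (Z p) (\<lambda>q. pairing L q (X q, 0) (0, \<alpha> q)) =
           pairing L p (conn_plus L p (Z p) X, 0) (0, \<alpha> p) +
           pairing L p (X p, 0) (0, conn_minus L p (Z p) \<alpha>))) \<and>
     torsion_free A (base_conn_plus L) \<and>
     smooth_map_on A UNIV (potential L) \<and>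
     strictly_convex A (base_conn_plus L) (potential L)"

definition legendre_morphism :: "('b::topological_space, 'n::finite) chart set \<Rightarrow>
    ('b, 'n, 'h, 'k) legendre_data \<Rightarrow> 'b \<Rightarrow> 'h \<Rightarrow> 'k" where
  "legendre_morphism A L p x = bundle_inv (Hminus L) (ident_minus L) p
     (hessian_map A (base_conn_plus L) (potential L) p (ident_plus L p x))"

text \<open>Isomorphisms of Legendre bundles over the identity of the base, compatible with the
  identifications with the tangent and the cotangent bundle.\<close>

definition legendre_iso :: "('b::topological_space, 'n::finite) chart set \<Rightarrow>
    ('b, 'n, 'h::real_vector, 'k::real_vector) legendre_data \<Rightarrow>
    ('b, 'n, 'h2::real_vector, 'k2::real_vector) legendre_data \<Rightarrow>
    ('b \<Rightarrow> 'h \<Rightarrow> 'h2) \<Rightarrow> ('b \<Rightarrow> 'k \<Rightarrow> 'k2) \<Rightarrow> bool" where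
  "legendre_iso A L L' \<Phi> \<Theta> \<longleftrightarrow>
     bundle_iso A (Hplus L) (Hplus L') \<Phi> \<and> bundle_iso A (Hminus L) (Hminus L') \<Theta> \<and>
     (\<forall>p. \<forall>x\<in>fibre (Hplus L) p. ident_plus L' p (\<Phi> p x) = ident_plus L p x) \<and>
     (\<forall>p. \<forall>\<alpha>\<in>fibre (Hminus L) p. ident_minus L' p (\<Theta> p \<alpha>) = ident_minus L p \<alpha>) \<and>
     (\<forall>p. \<forall>x\<in>fibre (total_bundle L) p. \<forall>y\<in>fibre (total_bundle L) p.
        pairing L' p (map_prod (\<Phi> p) (\<Theta> p) x) (map_prod (\<Phi> p) (\<Theta> p) y) = pairing L p x y) \<and>
     conn_eq A (Hplus L') (transport_conn (Hplus L) \<Phi> (conn_plus L)) (conn_plus L') \<and>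
     conn_eq A (Hminus L') (transport_conn (Hminus L) \<Theta> (conn_minus L)) (conn_minus L') \<and>
     potential L' = potential L \<and>
     (\<forall>p. \<forall>x\<in>fibre (Hplus L) p.
        \<Theta> p (legendre_morphism A L p x) = legendre_morphism A L' p (\<Phi> p x))"


section \<open>The two constructions\<close>

definition legendre_of :: "('b, 'n::finite) chart set \<Rightarrow>
    ('b, 'n) dually_flat_data \<Rightarrow> ('b, 'n, ('b, 'n) tvec, ('b, 'n) covec) legendre_data" where
  "legendre_of A D = \<lparr>
     Hplus = tangent_bundle A,
     Hminus = cotangent_bundle A,
     ident_plus = (\<lambda>p X. X),
     ident_minus = (\<lambda>p \<alpha>. \<alpha>),
     pairing = (\<lambda>p (X, \<alpha>) (Y, \<beta>). \<alpha> Y + \<beta> X),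
     conn_plus = df_conn_plus D,
     conn_minus = transport_conn (tangent_bundle A) (metric_flat A (metric D)) (df_conn_minus D),
     potential = df_potential D\<rparr>"

definition legendre_metric :: "('b::topological_space, 'n::finite) chart set \<Rightarrow>
    ('b, 'n, 'h::zero, 'k::zero) legendre_data \<Rightarrow>
    'b \<Rightarrow> ('b, 'n) tvec \<Rightarrow> ('b, 'n) tvec \<Rightarrow> real" where
  "legendre_metric A L p X Y =
     pairing L p (bundle_inv (Hplus L) (ident_plus L) p X, 0)
       (0, legendre_morphism A L p (bundle_inv (Hplus L) (ident_plus L) p Y))"

text \<open>The connection induced on the cotangent bundle is regarded as a connection on the tangent
  bundle by means of the metric.\<close>

definition dually_flat_of :: "('b::topological_space, 'n::finite) chart set \<Rightarrow>
    ('b, 'n, 'h::zero, 'k::zero) legendre_data \<Rightarrow> ('b, 'n) dually_flat_data" where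
  "dually_flat_of A L = \<lparr>
     metric = legendre_metric A L,
     df_conn_plus = base_conn_plus L,
     df_conn_minus = transport_conn (cotangent_bundle A)
       (bundle_inv (tangent_bundle A) (metric_flat A (legendre_metric A L))) (base_conn_minus L),
     df_potential = potential L\<rparr>"

end

theory Submission
  imports Defs
begin

text \<open>Both constructions amount to moving connections along bundle isomorphisms: the identifications
  with \<open>TB\<close> and \<open>T*B\<close>, and \<open>Y \<mapsto> g(Y, \<cdot>)\<close>, which has a smooth inverse by Cramer's rule. On a
  Legendre bundle the expression \<open>X(Y\<Psi>) - (\<nabla>\<^sup>+\<^sub>X Y)\<Psi>\<close> is the Hessian in every flat chart, which
  makes the Legendre morphism well defined and identifies the metric with \<open>D\<^sup>2\<Psi>\<close>.

  Two points need analysis. Flat coordinates exist: the parallel covector fields solve an integrable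
  linear system (Frobenius), they are closed since the torsion vanishes, and their primitives form a
  chart by the inverse function theorem. The dual connection is torsion-free: lowered by the Hessian
  metric, its Christoffel symbols in flat coordinates are the third derivatives of \<open>\<Psi>\<close>.\<close>

section \<open>Calculus of smooth functions\<close>

text \<open>\<open>strictly_convex\<close> and \<open>hessian_map\<close> quantify over all flat
  charts: if some point had no flat chart around it, convexity would say nothing there and the
  Legendre morphism would be an unspecified value. A Legendre bundle provides only curvature and
  torsion conditions, so integration theory cannot be avoided. A second obstacle is the encoding of
  bundles. Fibres carry no topology and connections are meaningful only on smooth local sections, so
  smoothness is visible through trivialisations alone, and two connections can at best agree in the
  sense of \<open>conn_eq\<close>. Each passage along an isomorphism has to show that the inverse is
  smooth and that values off the fibres do not matter.

  The homotopy formula for radial integration of one-forms is used three times: it gives the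
  symmetry of second derivatives, it drives the error estimate for the parallel covector fields, and
  it integrates these fields to coordinates.\<close>

lemma Ck_on_SucI:
  assumes "\<And>x. x \<in> U \<Longrightarrow> (f has_derivative f' x) (at x)" and "\<And>v. Ck_on k U (\<lambda>x. f' x v)"
    and "open U"
  shows "Ck_on (Suc k) U f"
proof -
  have eq: "frechet_derivative f (at x) = f' x" if "x \<in> U" for x
    using frechet_derivative_at[OF assms(1)[OF that]] by simp
  \<comment> \<open>The definition speaks of \<open>frechet_derivative\<close>, a chosen value,
    whereas calculus rules deliver explicit derivatives. Exchanging the two needs congruence for
    arbitrary \<open>g\<close> and \<open>h\<close>, since in the induction derivatives take the
    place of the functions.\<close>
  have cong: "Ck_on k U g \<longleftrightarrow> Ck_on k U h" if "\<And>x. x \<in> U \<Longrightarrow> g x = h x" for g h :: "'a \<Rightarrow> 'b"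
    using that
  proof (induction k arbitrary: g h)
    case 0
    then show ?case by (auto cong: continuous_on_cong)
  next
    case (Suc k)
    have imp: "Ck_on (Suc k) U h" if gh: "\<And>x. x \<in> U \<Longrightarrow> g x = h x" and g: "Ck_on (Suc k) U g"
      for g h :: "'a \<Rightarrow> 'b"
    proof -
      have d: "(h has_derivative frechet_derivative g (at x)) (at x)" if "x \<in> U" for x
        using has_derivative_transform_within_open[OF _ assms(3) that gh] g that
        by (auto simp: frechet_derivative_works)
      have "Ck_on k U (\<lambda>x. frechet_derivative h (at x) v)" for v
        using Suc.IH[of "\<lambda>x. frechet_derivative h (at x) v" "\<lambda>x. frechet_derivative g (at x) v"]
          frechet_derivative_at[OF d] g by simp
      then show ?thesis using d by (auto simp: differentiable_def)
    qed
    show ?case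
      by (rule iffI; erule imp[rotated]) (simp_all add: Suc.prems)
  qed
  have "Ck_on k U (\<lambda>x. frechet_derivative f (at x) v)" for v
    using cong[of "\<lambda>x. frechet_derivative f (at x) v" "\<lambda>x. f' x v"] eq assms(2) by simp
  then show ?thesis using assms(1) by (auto simp: differentiable_def)
qed

lemma Ck_on_cong:
  assumes "open U" and "\<And>x. x \<in> U \<Longrightarrow> f x = g x"
  shows "Ck_on k U f \<longleftrightarrow> Ck_on k U g"
proof (cases k)
  case 0
  then show ?thesis using assms by (auto cong: continuous_on_cong)
next
  case (Suc m)
  have imp: "Ck_on (Suc m) U h" if gh: "\<And>x. x \<in> U \<Longrightarrow> g x = h x" and g: "Ck_on (Suc m) U g"
    for g h :: "'a \<Rightarrow> 'b"
    by (rule Ck_on_SucI[where f'="\<lambda>x. frechet_derivative g (at x)"])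
      (use g assms gh in \<open>auto simp: frechet_derivative_works
        intro: has_derivative_transform_within_open[OF _ assms(1)]\<close>)
  show ?thesis unfolding Suc
    by (rule iffI; erule imp[rotated]) (simp_all add: assms)
qed

lemma Ck_on_SucD:
  assumes "Ck_on (Suc k) U f"
  shows "x \<in> U \<Longrightarrow> (f has_derivative frechet_derivative f (at x)) (at x)"
    and "Ck_on k U (\<lambda>x. frechet_derivative f (at x) v)"
  using assms by (auto simp: frechet_derivative_works)

lemma Ck_on_subset: "Ck_on k U f \<Longrightarrow> V \<subseteq> U \<Longrightarrow> Ck_on k V f"
  by (induction k arbitrary: f) (auto intro: continuous_on_subset)

text \<open>Derivatives at a point do not mention the ambient set, so the derivatives on different
  neighbourhoods are literally the same functions and the induction needs no gluing.\<close>

lemma Ck_on_local: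
  assumes "\<And>x. x \<in> U \<Longrightarrow> \<exists>V. open V \<and> x \<in> V \<and> Ck_on k V f"
  shows "Ck_on k U f"
  using assms
proof (induction k arbitrary: f)
  case 0
  then show ?case
    by (metis Ck_on.simps(1) continuous_at_imp_continuous_on continuous_on_eq_continuous_at)
next
  case (Suc k)
  have "Ck_on k U (\<lambda>x. frechet_derivative f (at x) v)" for v
    by (rule Suc.IH) (use Suc.prems in \<open>auto; blast\<close>)
  moreover have "f differentiable (at x)" if "x \<in> U" for x
    using Suc.prems[OF that] by auto
  ultimately show ?case by auto
qed

lemma Ck_on_Suc_imp: "Ck_on (Suc k) U f \<Longrightarrow> Ck_on k U f"
proof (induction k arbitrary: f)
  case 0
  then show ?case
    by (auto intro!: continuous_at_imp_continuous_on differentiable_imp_continuous_within)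
next
  case (Suc k)
  then show ?case by (metis Ck_on.simps(2))
qed

section \<open>Closure of finite differentiability under algebraic operations\<close>

lemma Ck_on_const [simp]: "Ck_on k U (\<lambda>x. c)"
  by (induction k arbitrary: c) auto

lemma Ck_on_bounded_linear:
  assumes "bounded_linear h" "open U" "Ck_on k U f"
  shows "Ck_on k U (\<lambda>x. h (f x))"
  using assms(3)
proof (induction k arbitrary: f)
  case 0
  then show ?case using assms by (auto intro: bounded_linear.continuous_on)
next
  case (Suc k)
  show ?case
    by (rule Ck_on_SucI[where f'="\<lambda>x v. h (frechet_derivative f (at x) v)"])
      (use Suc assms Ck_on_SucD[OF Suc.prems] in
        \<open>auto intro!: bounded_linear.has_derivative[OF assms(1)]\<close>)
qed

lemma Ck_on_ident [simp]: "open U \<Longrightarrow> Ck_on k U (\<lambda>x. x)"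
  by (cases k) (auto intro!: Ck_on_SucI[where f'="\<lambda>x v. v"] simp del: Ck_on.simps(2))

lemma Ck_on_add:
  assumes "open U" "Ck_on k U f" "Ck_on k U g"
  shows "Ck_on k U (\<lambda>x. f x + g x)"
  using assms(2-)
proof (induction k arbitrary: f g)
  case 0
  then show ?case by (auto intro: continuous_intros)
next
  case (Suc k)
  show ?case
    by (rule Ck_on_SucI[where f'="\<lambda>x v. frechet_derivative f (at x) v + frechet_derivative g (at x) v"])
      (use Suc assms Ck_on_SucD[OF Suc.prems(1)] Ck_on_SucD[OF Suc.prems(2)] in
        \<open>auto intro!: has_derivative_add\<close>)
qed

lemma Ck_on_sum:
  assumes "open U" "\<And>i. i \<in> I \<Longrightarrow> Ck_on k U (f i)"
  shows "Ck_on k U (\<lambda>x. \<Sum>i\<in>I. f i x)"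
  using assms(2) by (induction I rule: infinite_finite_induct) (auto intro!: Ck_on_add assms(1))

lemma Ck_on_bilinear:
  assumes bl: "bounded_bilinear prd" and "open U" "Ck_on k U f" "Ck_on k U g"
  shows "Ck_on k U (\<lambda>x. prd (f x) (g x))"
  using assms(3-)
proof (induction k arbitrary: f g)
  case 0
  then show ?case using bl by (auto intro: bounded_bilinear.continuous_on)
next
  case (Suc k)
  \<comment> \<open>The product rule leaves one factor undifferentiated, so the induction hypothesis
    is applied to a function paired with a derivative; the undifferentiated factor enters at the
    lower order \<open>k\<close>.\<close>
  have fg: "Ck_on k U f" "Ck_on k U g"
    using Suc.prems Ck_on_Suc_imp by blast+
  show ?case
  proof (rule Ck_on_SucI)
    show "((\<lambda>x. prd (f x) (g x)) has_derivative (\<lambda>v. prd (f x) (frechet_derivative g (at x) v) +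
        prd (frechet_derivative f (at x) v) (g x))) (at x)" if "x \<in> U" for x
      by (intro bounded_bilinear.FDERIV[OF bl] Ck_on_SucD(1)[OF Suc.prems(1) that]
          Ck_on_SucD(1)[OF Suc.prems(2) that])
    show "Ck_on k U (\<lambda>x. prd (f x) (frechet_derivative g (at x) v) +
        prd (frechet_derivative f (at x) v) (g x))" for v
      by (intro Ck_on_add Suc.IH fg Ck_on_SucD(2)[OF Suc.prems(1)] Ck_on_SucD(2)[OF Suc.prems(2)] assms(2))
  qed (fact assms(2))
qed

lemmas Ck_on_mult = Ck_on_bilinear[OF bounded_bilinear_mult]
lemmas Ck_on_scaleR = Ck_on_bilinear[OF bounded_bilinear_scaleR]
lemmas Ck_on_inner = Ck_on_bilinear[OF bounded_bilinear_inner]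
lemmas Ck_on_uminus = Ck_on_bounded_linear[OF bounded_linear_minus[OF bounded_linear_ident]]

lemma Ck_on_diff:
  assumes "open U" "Ck_on k U f" "Ck_on k U g"
  shows "Ck_on k U (\<lambda>x. f x - g x)"
  using Ck_on_add[OF assms(1,2) Ck_on_uminus[OF assms(1,3)]] by simp

lemma Ck_on_prod:
  fixes f :: "'i \<Rightarrow> 'a::euclidean_space \<Rightarrow> real"
  assumes "open U" "\<And>i. i \<in> I \<Longrightarrow> Ck_on k U (f i)"
  shows "Ck_on k U (\<lambda>x. \<Prod>i\<in>I. f i x)"
  using assms(2) by (induction I rule: infinite_finite_induct) (auto intro!: Ck_on_mult assms(1))

lemma Ck_on_inverse:
  fixes f :: "'a::euclidean_space \<Rightarrow> real"
  assumes "open U" "Ck_on k U f" "\<And>x. x \<in> U \<Longrightarrow> f x \<noteq> 0"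
  shows "Ck_on k U (\<lambda>x. inverse (f x))"
  using assms(2)
proof (induction k)
  case 0
  then show ?case using assms by (auto intro: continuous_intros)
next
  case (Suc k)
  \<comment> \<open>The derivative of the inverse contains the inverse again, as two of its factors;
    at order \<open>k\<close> these are covered by the induction hypothesis.\<close>
  have i: "Ck_on k U (\<lambda>x. inverse (f x))"
    using Suc Ck_on_Suc_imp by blast
  show ?case
  proof (rule Ck_on_SucI)
    show "((\<lambda>x. inverse (f x)) has_derivative
        (\<lambda>v. - (inverse (f x) * frechet_derivative f (at x) v * inverse (f x)))) (at x)" if "x \<in> U" for x
      by (intro Deriv.has_derivative_inverse Ck_on_SucD(1)[OF Suc.prems(1) that] assms(3) that)
    show "Ck_on k U (\<lambda>x. - (inverse (f x) * frechet_derivative f (at x) v * inverse (f x)))" for v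
      by (intro Ck_on_uminus Ck_on_mult i Ck_on_SucD(2)[OF Suc.prems(1)] assms(1))
  qed (fact assms(1))
qed

lemma Ck_on_divide:
  fixes f :: "'a::euclidean_space \<Rightarrow> real"
  assumes "open U" "Ck_on k U f" "Ck_on k U g" "\<And>x. x \<in> U \<Longrightarrow> g x \<noteq> 0"
  shows "Ck_on k U (\<lambda>x. f x / g x)"
  using Ck_on_mult[OF assms(1,2) Ck_on_inverse[OF assms(1,3,4)]] by (simp add: divide_inverse)

lemma Ck_on_euclidean_iff:
  fixes f :: "'a::euclidean_space \<Rightarrow> 'b::euclidean_space"
  assumes "open U"
  shows "Ck_on k U f \<longleftrightarrow> (\<forall>b\<in>Basis. Ck_on k U (\<lambda>x. f x \<bullet> b))"
proof
  assume "\<forall>b\<in>Basis. Ck_on k U (\<lambda>x. f x \<bullet> b)"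
  then have "Ck_on k U (\<lambda>x. \<Sum>b\<in>Basis. (f x \<bullet> b) *\<^sub>R b)"
    by (intro Ck_on_sum Ck_on_scaleR assms) auto
  then show "Ck_on k U f" by (simp add: euclidean_representation)
qed (auto intro!: Ck_on_inner assms)

lemma Ck_on_vec_iff:
  fixes f :: "'a::euclidean_space \<Rightarrow> real^'n"
  assumes "open U"
  shows "Ck_on k U f \<longleftrightarrow> (\<forall>i. Ck_on k U (\<lambda>x. f x $ i))"
  by (subst Ck_on_euclidean_iff[OF assms]) (auto simp: Basis_vec_def inner_axis)

text \<open>Used whenever a linear argument varies with the base point: regularity, continuity and
  bounds are known for fixed arguments, and the finite expansion reduces everything to
  those.\<close>

lemma linear_Basis_expand:
  fixes h :: "'a::euclidean_space \<Rightarrow> 'b::real_vector"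
  assumes "linear h"
  shows "h v = (\<Sum>b\<in>Basis. (v \<bullet> b) *\<^sub>R h b)"
proof -
  have "h v = h (\<Sum>b\<in>Basis. (v \<bullet> b) *\<^sub>R b)" by (simp add: euclidean_representation)
  also have "\<dots> = (\<Sum>b\<in>Basis. (v \<bullet> b) *\<^sub>R h b)"
    using assms by (simp add: linear_sum linear_cmul)
  finally show ?thesis .
qed

lemma Ck_on_compose:
  fixes f :: "'a::euclidean_space \<Rightarrow> 'b::euclidean_space" and g :: "'b \<Rightarrow> 'c::real_normed_vector"
  assumes "open U" "open W" "f ` U \<subseteq> W" "Ck_on k U f" "Ck_on k W g"
  shows "Ck_on k U (\<lambda>x. g (f x))"
  using assms(4-)
proof (induction k arbitrary: g)
  case 0
  then show ?case using assms by (auto intro: continuous_on_compose2)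
next
  case (Suc k)
  have d: "((\<lambda>x. g (f x)) has_derivative
      (\<lambda>v. frechet_derivative g (at (f x)) (frechet_derivative f (at x) v))) (at x)" if "x \<in> U" for x
    using Ck_on_SucD(1)[OF Suc.prems(1) that] Ck_on_SucD(1)[OF Suc.prems(2), of "f x"] that assms(3)
    using diff_chain_at[of f _ x g] by (auto simp: o_def)
  \<comment> \<open>In the chain rule the direction fed to the derivative of \<open>g\<close>
    depends on \<open>x\<close>, while \<open>Ck_on\<close> controls derivatives in fixed
    directions. Expanding that direction over \<open>Basis\<close> leaves products of functions that
    are all of order \<open>k\<close>.\<close>
  have "Ck_on k U (\<lambda>x. \<Sum>b\<in>Basis. (frechet_derivative f (at x) v \<bullet> b) *\<^sub>R frechet_derivative g (at (f x)) b)" for v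
    using Suc.prems Ck_on_Suc_imp
    by (auto intro!: Ck_on_sum Ck_on_scaleR Ck_on_inner Suc.IH assms)
  moreover have "(\<Sum>b\<in>Basis. (frechet_derivative f (at x) v \<bullet> b) *\<^sub>R frechet_derivative g (at (f x)) b) =
      frechet_derivative g (at (f x)) (frechet_derivative f (at x) v)" if "x \<in> U" for x v
    using Ck_on_SucD(1)[OF Suc.prems(2), of "f x"] that assms(3)
    by (subst linear_Basis_expand[where h="frechet_derivative g (at (f x))"])
      (auto intro!: has_derivative_linear)
  ultimately have "Ck_on k U (\<lambda>x. frechet_derivative g (at (f x)) (frechet_derivative f (at x) v))" for v
    using Ck_on_cong[OF assms(1)] by (metis (no_types, lifting))
  then show ?case using Ck_on_SucI[OF d] assms by blast
qed

section \<open>Regularity of solutions of linear systems\<close>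

lemma Ck_on_det:
  fixes M :: "'a::euclidean_space \<Rightarrow> real^'n^'n"
  assumes "open U" "\<And>i j. Ck_on k U (\<lambda>x. M x $ i $ j)"
  shows "Ck_on k U (\<lambda>x. det (M x))"
  unfolding det_def by (intro Ck_on_sum Ck_on_mult Ck_on_prod assms Ck_on_const)

text \<open>Cramer's rule writes \<open>y\<close> as a quotient of determinants, which are
  polynomials in the entries of \<open>M\<close> and \<open>b\<close>. The regularity of
  \<open>y\<close> thus comes from the system alone, which makes the lemma applicable to inverses
  given by choice operators.\<close>

lemma Ck_on_solution:
  fixes M :: "'a::euclidean_space \<Rightarrow> real^'n^'n"
  assumes U: "open U" and M: "\<And>i j. Ck_on k U (\<lambda>x. M x $ i $ j)" and b: "\<And>i. Ck_on k U (\<lambda>x. b x $ i)"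
    and y: "\<And>x. x \<in> U \<Longrightarrow> M x *v y x = b x" and det: "\<And>x. x \<in> U \<Longrightarrow> det (M x) \<noteq> 0"
  shows "Ck_on k U y"
proof -
  have "Ck_on k U (\<lambda>x. if j = l then b x $ i else M x $ i $ j)" for i j l
    by (cases "j = l") (auto intro: M b)
  then have "Ck_on k U (\<lambda>x. (\<chi> l. det (\<chi> i j. if j = l then b x $ i else M x $ i $ j) / det (M x)))"
    by (subst Ck_on_vec_iff[OF U]) (auto intro!: Ck_on_divide Ck_on_det U M det)
  then show ?thesis
    using Ck_on_cong[OF U, of y "\<lambda>x. (\<chi> l. det (\<chi> i j. if j = l then b x $ i else M x $ i $ j) / det (M x))"]
      cramer[OF det] y by blast
qed

section \<open>Infinitely differentiable maps\<close>

lemma smooth_onI: "(\<And>k. Ck_on k U f) \<Longrightarrow> smooth_on U f"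
  by (simp add: smooth_on_def)

lemma smooth_onD: "smooth_on U f \<Longrightarrow> Ck_on k U f"
  by (simp add: smooth_on_def)

lemma smooth_on_has_derivative:
  assumes "smooth_on U f" "x \<in> U"
  shows "(f has_derivative frechet_derivative f (at x)) (at x)"
  using Ck_on_SucD(1)[OF smooth_onD[OF assms(1), of "Suc 0"] assms(2)] .

lemma smooth_on_frechet_derivative:
  "smooth_on U f \<Longrightarrow> smooth_on U (\<lambda>x. frechet_derivative f (at x) v)"
  using Ck_on_SucD(2) smooth_onD smooth_onI by blast

lemma smooth_on_imp_continuous_on: "smooth_on U f \<Longrightarrow> continuous_on U f"
  using smooth_onD[of U f 0] by simp

lemma smooth_on_cong: "open U \<Longrightarrow> (\<And>x. x \<in> U \<Longrightarrow> f x = g x) \<Longrightarrow> smooth_on U f \<longleftrightarrow> smooth_on U g"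
  unfolding smooth_on_def using Ck_on_cong by blast

lemma smooth_on_subset: "smooth_on U f \<Longrightarrow> V \<subseteq> U \<Longrightarrow> smooth_on V f"
  unfolding smooth_on_def using Ck_on_subset by blast

lemma smooth_on_local:
  "(\<And>x. x \<in> U \<Longrightarrow> \<exists>V. open V \<and> x \<in> V \<and> smooth_on V f) \<Longrightarrow> smooth_on U f"
  unfolding smooth_on_def by (intro allI Ck_on_local) blast

lemma smooth_on_const [simp]: "smooth_on U (\<lambda>x. c)"
  by (simp add: smooth_on_def)

lemma smooth_on_ident [simp]: "open U \<Longrightarrow> smooth_on U (\<lambda>x. x)"
  by (simp add: smooth_on_def)

lemma smooth_on_bounded_linear:
  "bounded_linear h \<Longrightarrow> open U \<Longrightarrow> smooth_on U f \<Longrightarrow> smooth_on U (\<lambda>x. h (f x))"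
  unfolding smooth_on_def by (blast intro: Ck_on_bounded_linear)

lemma smooth_on_add: "open U \<Longrightarrow> smooth_on U f \<Longrightarrow> smooth_on U g \<Longrightarrow> smooth_on U (\<lambda>x. f x + g x)"
  unfolding smooth_on_def by (blast intro: Ck_on_add)

lemma smooth_on_diff: "open U \<Longrightarrow> smooth_on U f \<Longrightarrow> smooth_on U g \<Longrightarrow> smooth_on U (\<lambda>x. f x - g x)"
  unfolding smooth_on_def by (blast intro: Ck_on_diff)

lemma smooth_on_sum:
  "open U \<Longrightarrow> (\<And>i. i \<in> I \<Longrightarrow> smooth_on U (f i)) \<Longrightarrow> smooth_on U (\<lambda>x. \<Sum>i\<in>I. f i x)"
  unfolding smooth_on_def by (blast intro: Ck_on_sum)

lemma smooth_on_bilinear: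
  "bounded_bilinear prd \<Longrightarrow> open U \<Longrightarrow> smooth_on U f \<Longrightarrow> smooth_on U g \<Longrightarrow>
    smooth_on U (\<lambda>x. prd (f x) (g x))"
  unfolding smooth_on_def by (blast intro: Ck_on_bilinear)

lemmas smooth_on_mult = smooth_on_bilinear[OF bounded_bilinear_mult]
lemmas smooth_on_inner = smooth_on_bilinear[OF bounded_bilinear_inner]

lemma smooth_on_vec_iff:
  fixes f :: "'a::euclidean_space \<Rightarrow> real^'n"
  assumes "open U"
  shows "smooth_on U f \<longleftrightarrow> (\<forall>i. smooth_on U (\<lambda>x. f x $ i))"
  unfolding smooth_on_def using Ck_on_vec_iff[OF assms] by blast

lemma smooth_on_compose:
  fixes f :: "'a::euclidean_space \<Rightarrow> 'b::euclidean_space" and g :: "'b \<Rightarrow> 'c::real_normed_vector"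
  assumes "open U" "open W" "f ` U \<subseteq> W" "smooth_on U f" "smooth_on W g"
  shows "smooth_on U (\<lambda>x. g (f x))"
  using assms unfolding smooth_on_def by (blast intro: Ck_on_compose)

lemma smooth_on_solution:
  fixes M :: "'a::euclidean_space \<Rightarrow> real^'n^'n"
  assumes U: "open U" and M: "\<And>i j. smooth_on U (\<lambda>x. M x $ i $ j)" and b: "\<And>i. smooth_on U (\<lambda>x. b x $ i)"
    and y: "\<And>x. x \<in> U \<Longrightarrow> M x *v y x = b x" and det: "\<And>x. x \<in> U \<Longrightarrow> det (M x) \<noteq> 0"
  shows "smooth_on U y"
  using assms unfolding smooth_on_def by (blast intro: Ck_on_solution)

lemma det_matrix_nz_iff_bij:
  fixes h :: "real^'n \<Rightarrow> real^'n"
  assumes "linear h"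
  shows "det (matrix h) \<noteq> 0 \<longleftrightarrow> bij h"
  using assms det_nz_iff_inj[OF assms] linear_injective_imp_surjective by (auto simp: bij_def)

text \<open>Bootstrapping: the derivative of the inverse \<open>g\<close> at \<open>y\<close>,
  applied to a vector, solves a linear system whose matrix is the derivative of \<open>f\<close> at
  \<open>g y\<close>. If \<open>g\<close> is of order \<open>k\<close>, so are the entries of the
  matrix, hence so is the derivative of \<open>g\<close>, and \<open>g\<close> is of order
  \<open>k + 1\<close>.\<close>

lemma smooth_inverse_function:
  fixes f :: "real^'n \<Rightarrow> real^'n"
  assumes U: "open U" and f: "smooth_on U f" and x0: "x0 \<in> U"
    and inj: "inj (frechet_derivative f (at x0))"
  obtains V g where "open V" "V \<subseteq> U" "x0 \<in> V" "open (f ` V)" "homeomorphism V (f ` V) f g"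
    "smooth_on (f ` V) g"
proof -
  let ?D = "\<lambda>x. frechet_derivative f (at x)"
  have d: "(f has_derivative ?D x) (at x)" if "x \<in> U" for x
    using smooth_on_has_derivative[OF f that] .
  have bl: "bounded_linear (?D x)" if "x \<in> U" for x
    using d[OF that] has_derivative_bounded_linear by blast
  \<comment> \<open>The inverse function theorem wants the derivative as a continuous map into the
    space of bounded linear operators; in finite dimension continuity in each fixed direction is
    enough.\<close>
  define f' where "f' x = Blinfun (?D x)" for x
  have f': "blinfun_apply (f' x) = ?D x" if "x \<in> U" for x
    using bl[OF that] by (simp add: f'_def bounded_linear_Blinfun_apply)
  have cont: "continuous_on U f'"
  proof (rule continuous_on_blinfun_componentwise)
    fix i :: "real^'n" assume "i \<in> Basis"
    have "continuous_on U (\<lambda>x. ?D x i)"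
      using smooth_on_imp_continuous_on[OF smooth_on_frechet_derivative[OF f]] .
    then show "continuous_on U (\<lambda>x. f' x i)"
      using f' by (auto cong: continuous_on_cong)
  qed
  have "bij (?D x0)"
    using bl[OF x0] inj linear_injective_imp_surjective bounded_linear.linear by (auto simp: bij_def)
  obtain h where h: "linear h" "h \<circ> ?D x0 = id"
    using linear_injective_left_inverse inj bl[OF x0] bounded_linear.linear by blast
  have "Blinfun h o\<^sub>L f' x0 = id_blinfun"
    using h f'[OF x0] by (intro blinfun_eqI) (auto simp: linear_conv_bounded_linear
        bounded_linear_Blinfun_apply fun_eq_iff)
  from inverse_function_theorem[of U f f', OF U _ cont x0 this] d f'
  obtain V W g g' where V: "open V" "V \<subseteq> U" "x0 \<in> V" "open W" "homeomorphism V W f g"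
    and g: "\<And>y. y \<in> W \<Longrightarrow> (g has_derivative (g' y)) (at y)"
    and g': "\<And>y. y \<in> W \<Longrightarrow> g' y = inv (blinfun_apply (f'(g y)))"
    and bij: "\<And>y. y \<in> W \<Longrightarrow> bij (blinfun_apply (f'(g y)))"
    by (metis (no_types, lifting))
  have W: "W = f ` V" using V by (simp add: homeomorphism_def)
  have gW: "g ` W \<subseteq> U" using V by (auto simp: homeomorphism_def)
  have "Ck_on k W g" for k
  proof (induction k)
    case 0
    then show ?case using V by (auto simp: homeomorphism_def)
  next
    case (Suc k)
    have "Ck_on k W (\<lambda>y. g' y w)" for w
    proof (rule Ck_on_solution[where M="\<lambda>y. matrix (?D (g y))" and b="\<lambda>y. w"])
      have "Ck_on k U (\<lambda>x. ?D x (axis j 1) $ i)" for i j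
        using smooth_onD[OF smooth_on_frechet_derivative[OF f], of k] by (subst (asm) Ck_on_vec_iff[OF U]) blast
      from Ck_on_compose[OF V(4) U gW Suc.IH this]
      show "Ck_on k W (\<lambda>y. matrix (?D (g y)) $ i $ j)" for i j by (simp add: matrix_def)
      fix y assume y: "y \<in> W"
      then have gy: "g y \<in> U" using gW by blast
      then have lin: "linear (?D (g y))" using bl bounded_linear.linear by blast
      show "matrix (?D (g y)) *v g' y w = w"
        using bij[OF y] g'[OF y] f'[OF gy] lin by (simp add: matrix_works bij_is_surj surj_f_inv_f)
      show "det (matrix (?D (g y))) \<noteq> 0"
        using det_matrix_nz_iff_bij[OF lin] bij[OF y] f'[OF gy] by simp
    qed (auto simp: V)
    then show ?case using Ck_on_SucI[OF g] V by blast
  qed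
  then show thesis using that[of V g] V W by (auto intro: smooth_onI)
qed


section \<open>Radial integration of one-forms\<close>

lemma radial_mem:
  fixes x0 :: "'a::real_vector"
  assumes "convex S" "x0 \<in> S" "x \<in> S" "t \<in> {0..1}"
  shows "x0 + t *\<^sub>R (x - x0) \<in> S"
proof -
  have "x0 + t *\<^sub>R (x - x0) = (1 - t) *\<^sub>R x0 + t *\<^sub>R x" by (simp add: algebra_simps)
  then show ?thesis using assms by (simp add: convexD_alt)
qed

lemma continuous_on_radial:
  fixes g :: "'a::real_normed_vector \<Rightarrow> 'e::topological_space"
  assumes "convex S" "x0 \<in> S" "continuous_on S g"
  shows "continuous_on (S \<times> {0..1}) (\<lambda>z. g (x0 + snd z *\<^sub>R (fst z - x0)))"
  by (rule continuous_on_compose2[OF assms(3)]) (auto intro!: continuous_intros radial_mem assms)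

lemma continuous_on_radial_slice:
  fixes g :: "'a::real_normed_vector \<Rightarrow> 'e::topological_space"
  assumes "convex S" "x0 \<in> S" "x \<in> S" "continuous_on S g"
  shows "continuous_on {0..1} (\<lambda>t. g (x0 + t *\<^sub>R (x - x0)))"
  by (rule continuous_on_compose2[OF assms(4)]) (auto intro!: continuous_intros radial_mem assms)

text \<open>Differentiation under the integral sign. The factor \<open>t\<close> is the derivative
  of the ray point \<open>x0 + t *\<^sub>R (x - x0)\<close> with respect to \<open>x\<close>.
  Derivatives are packed as bounded linear operators because the Leibniz rule is stated for
  these.\<close>

lemma radial_integral_has_derivative:
  fixes f :: "'a::euclidean_space \<Rightarrow> 'e::euclidean_space"
  assumes S: "open S" "convex S" "x0 \<in> S" and x: "x \<in> S"
    and f: "\<And>y. y \<in> S \<Longrightarrow> (f has_derivative f' y) (at y)" and f': "\<And>v. continuous_on S (\<lambda>y. f' y v)"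
  shows "((\<lambda>x. integral {0..1} (\<lambda>t. f (x0 + t *\<^sub>R (x - x0)))) has_derivative
    (\<lambda>v. integral {0..1} (\<lambda>t. t *\<^sub>R f' (x0 + t *\<^sub>R (x - x0)) v))) (at x)"
proof -
  define B where "B y = Blinfun (f' y)" for y
  have B: "blinfun_apply (B y) = f' y" if "y \<in> S" for y
    using has_derivative_bounded_linear[OF f[OF that]] by (simp add: B_def bounded_linear_Blinfun_apply)
  have Bc: "continuous_on S B"
    by (rule continuous_on_blinfun_componentwise) (use B f' in \<open>auto cong: continuous_on_cong\<close>)
  have fc: "continuous_on S f"
    by (meson f S(1) continuous_at_imp_continuous_on has_derivative_continuous)
  let ?r = "\<lambda>x t. x0 + t *\<^sub>R (x - x0)"
  have D: "((\<lambda>x. f (?r x t)) has_derivative blinfun_apply (t *\<^sub>R B (?r y t))) (at y within S)"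
    if "y \<in> S" "t \<in> cbox 0 (1::real)" for y t
  proof -
    have m: "?r y t \<in> S" using radial_mem[of S x0 y t] S that by simp
    have "((\<lambda>x. ?r x t) has_derivative (\<lambda>v. t *\<^sub>R v)) (at y within S)"
      by (auto intro!: derivative_eq_intros simp: algebra_simps)
    from has_derivative_compose[OF this f[OF m]] show ?thesis
      using linear_cmul[OF has_derivative_linear[OF f[OF m]]] B[OF m]
      by (simp add: scaleR_blinfun.rep_eq)
  qed
  have I: "(\<lambda>t. t *\<^sub>R B (?r x t)) integrable_on cbox 0 (1::real)"
    unfolding cbox_interval
    by (intro integrable_continuous_real continuous_intros continuous_on_radial_slice[OF S(2,3) x Bc])
  have "((\<lambda>x. integral (cbox 0 1) (\<lambda>t. f (?r x t))) has_derivative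
      blinfun_apply (integral (cbox 0 1) (\<lambda>t. t *\<^sub>R B (?r x t)))) (at x within S)"
  proof (rule leibniz_rule[OF D _ _ x S(2)])
    show "(\<lambda>t. f (?r y t)) integrable_on cbox 0 1" if "y \<in> S" for y
      unfolding cbox_interval
      by (intro integrable_continuous_real continuous_on_radial_slice[OF S(2,3) that fc])
    show "continuous_on (S \<times> cbox 0 1) (\<lambda>(y, t). t *\<^sub>R B (?r y t))"
      unfolding cbox_interval split_beta
      by (intro continuous_intros continuous_on_radial[OF S(2,3) Bc])
  qed
  moreover have "blinfun_apply (integral (cbox 0 1) (\<lambda>t. t *\<^sub>R B (?r x t))) =
      (\<lambda>v. integral {0..1} (\<lambda>t. t *\<^sub>R f' (?r x t) v))"
  proof
    fix v
    show "blinfun_apply (integral (cbox 0 1) (\<lambda>t. t *\<^sub>R B (?r x t))) v =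
        integral {0..1} (\<lambda>t. t *\<^sub>R f' (?r x t) v)"
      unfolding cbox_interval blinfun_apply_integral[OF I[unfolded cbox_interval]]
      by (intro integral_cong) (use B radial_mem[OF S(2,3) x] in \<open>simp add: blinfun.scaleR_left\<close>)
  qed
  ultimately show ?thesis
    by (simp add: at_within_open[OF x S(1)])
qed

text \<open>The homotopy formula of the Poincare lemma for the one-form \<open>\<omega>\<close>, with \<open>\<omega>' y v w\<close> the
  derivative of \<open>\<omega> y w\<close> in the direction \<open>v\<close>; the difference under the integral is the exterior
  derivative.\<close>

lemma radial_primitive_has_derivative:
  fixes \<omega> :: "'a::euclidean_space \<Rightarrow> 'a \<Rightarrow> 'e::euclidean_space"
  assumes S: "open S" "convex S" "x0 \<in> S" and x: "x \<in> S"
    and lin: "\<And>y. y \<in> S \<Longrightarrow> linear (\<omega> y)"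
    and der: "\<And>y w. y \<in> S \<Longrightarrow> ((\<lambda>y. \<omega> y w) has_derivative (\<lambda>v. \<omega>' y v w)) (at y)"
    and cont: "\<And>v w. continuous_on S (\<lambda>y. \<omega>' y v w)"
  shows "((\<lambda>x. integral {0..1} (\<lambda>t. \<omega> (x0 + t *\<^sub>R (x - x0)) (x - x0))) has_derivative
    (\<lambda>v. \<omega> x v + integral {0..1} (\<lambda>t. t *\<^sub>R
      (\<omega>' (x0 + t *\<^sub>R (x - x0)) v (x - x0) - \<omega>' (x0 + t *\<^sub>R (x - x0)) (x - x0) v)))) (at x)"
proof -
  let ?r = "\<lambda>x t. x0 + t *\<^sub>R (x - x0)"
  have m: "?r y t \<in> S" if "y \<in> S" "t \<in> {0..1}" for y t
    using radial_mem[OF S(2,3)] that by blast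
  have \<omega>c: "continuous_on S (\<lambda>y. \<omega> y w)" for w
    by (intro continuous_at_imp_continuous_on ballI has_derivative_continuous[OF der])
  have lin1: "linear (\<lambda>v. \<omega>' y v w)" if "y \<in> S" for y w
    using has_derivative_linear[OF der[OF that]] .
  \<comment> \<open>Linearity is assumed of \<open>\<omega>\<close>. Differentiating the linearity
    identities in \<open>y\<close> and comparing by uniqueness of derivatives transfers it to the
    second vector argument of \<open>\<omega>'\<close>.\<close>
  have lin2: "linear (\<omega>' y v)" if y: "y \<in> S" for y v
  proof
    fix a b :: 'a and c :: real
    have "((\<lambda>y. \<omega> y (a + b)) has_derivative (\<lambda>v. \<omega>' y v a + \<omega>' y v b)) (at y)"
      by (rule has_derivative_transform_within_open[OF has_derivative_add[OF der[OF y, of a] der[OF y, of b]] S(1) y])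
        (simp add: linear_add[OF lin])
    from has_derivative_unique[OF this der[OF y]] show "\<omega>' y v (a + b) = \<omega>' y v a + \<omega>' y v b"
      by metis
    have "((\<lambda>y. \<omega> y (c *\<^sub>R a)) has_derivative (\<lambda>v. c *\<^sub>R \<omega>' y v a)) (at y)"
      by (rule has_derivative_transform_within_open[OF has_derivative_scaleR_right[OF der[OF y, of a]] S(1) y])
        (simp add: linear_cmul[OF lin])
    from has_derivative_unique[OF this der[OF y]] show "\<omega>' y v (c *\<^sub>R a) = c *\<^sub>R \<omega>' y v a"
      by metis
  qed
  have int1: "(\<lambda>t. \<omega> (?r y t) w) integrable_on {0..1}" if "y \<in> S" for y w
    by (intro integrable_continuous_real continuous_on_radial_slice[OF S(2,3) that \<omega>c])
  have int2: "(\<lambda>t. t *\<^sub>R \<omega>' (?r y t) v w) integrable_on {0..1}" if "y \<in> S" for y v w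
    by (intro integrable_continuous_real continuous_intros continuous_on_radial_slice[OF S(2,3) that cont])
  define J where "J b x = integral {0..1} (\<lambda>t. \<omega> (?r x t) b)" for b x
  \<comment> \<open>The variable \<open>x\<close> occurs both in the base point and in the vector
    argument. Expanding the latter over \<open>Basis\<close> gives scalar factors times the
    parameter integrals \<open>J b\<close>, to which the product rule and differentiation under the
    integral apply.\<close>
  have "((\<lambda>x. \<Sum>b\<in>Basis. ((x - x0) \<bullet> b) *\<^sub>R J b x) has_derivative
     (\<lambda>v. \<Sum>b\<in>Basis. ((x - x0) \<bullet> b) *\<^sub>R integral {0..1} (\<lambda>t. t *\<^sub>R \<omega>' (?r x t) v b) + (v \<bullet> b) *\<^sub>R J b x)) (at x)"
    unfolding J_def
    by (intro has_derivative_sum has_derivative_scaleR radial_integral_has_derivative S x der cont)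
      (auto intro!: derivative_eq_intros S x cont)
  then have 1: "((\<lambda>x. integral {0..1} (\<lambda>t. \<omega> (?r x t) (x - x0))) has_derivative
     (\<lambda>v. \<Sum>b\<in>Basis. ((x - x0) \<bullet> b) *\<^sub>R integral {0..1} (\<lambda>t. t *\<^sub>R \<omega>' (?r x t) v b) + (v \<bullet> b) *\<^sub>R J b x)) (at x)"
  proof (rule has_derivative_transform_within_open[OF _ S(1) x])
    fix y assume y: "y \<in> S"
    have "integral {0..1} (\<lambda>t. \<omega> (?r y t) (y - x0)) =
      integral {0..1} (\<lambda>t. \<Sum>b\<in>Basis. ((y - x0) \<bullet> b) *\<^sub>R \<omega> (?r y t) b)"
      by (intro integral_cong linear_Basis_expand lin m y)
    also have "\<dots> = (\<Sum>b\<in>Basis. ((y - x0) \<bullet> b) *\<^sub>R J b y)"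
      unfolding J_def by (subst integral_sum) (auto intro!: integrable_cmul int1 y)
    finally show "(\<Sum>b\<in>Basis. ((y - x0) \<bullet> b) *\<^sub>R J b y) = integral {0..1} (\<lambda>t. \<omega> (?r y t) (y - x0))" by simp
  qed
  have "(\<Sum>b\<in>Basis. ((x - x0) \<bullet> b) *\<^sub>R integral {0..1} (\<lambda>t. t *\<^sub>R \<omega>' (?r x t) v b) + (v \<bullet> b) *\<^sub>R J b x) =
    \<omega> x v + integral {0..1} (\<lambda>t. t *\<^sub>R (\<omega>' (?r x t) v (x - x0) - \<omega>' (?r x t) (x - x0) v))" for v
  proof -
    have e1: "(\<Sum>b\<in>Basis. ((x - x0) \<bullet> b) *\<^sub>R integral {0..1} (\<lambda>t. t *\<^sub>R \<omega>' (?r x t) v b)) =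
      integral {0..1} (\<lambda>t. t *\<^sub>R \<omega>' (?r x t) v (x - x0))"
    proof -
      have "integral {0..1} (\<lambda>t. t *\<^sub>R \<omega>' (?r x t) v (x - x0)) =
        integral {0..1} (\<lambda>t. \<Sum>b\<in>Basis. ((x - x0) \<bullet> b) *\<^sub>R (t *\<^sub>R \<omega>' (?r x t) v b))"
        by (intro integral_cong, subst linear_Basis_expand[OF lin2]) (auto simp: m x scaleR_sum_right mult.commute)
      then show ?thesis by (subst (asm) integral_sum) (auto simp del: scaleR_scaleR intro!: integrable_cmul int2 x)
    qed
    have e2: "(\<Sum>b\<in>Basis. (v \<bullet> b) *\<^sub>R J b x) = integral {0..1} (\<lambda>t. \<omega> (?r x t) v)"
    proof -
      have "integral {0..1} (\<lambda>t. \<omega> (?r x t) v) =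
        integral {0..1} (\<lambda>t. \<Sum>b\<in>Basis. (v \<bullet> b) *\<^sub>R \<omega> (?r x t) b)"
        by (intro integral_cong linear_Basis_expand lin m x)
      then show ?thesis unfolding J_def by (subst (asm) integral_sum) (auto intro!: integrable_cmul int1 x)
    qed
    \<comment> \<open>Integrating the derivative of \<open>t *\<^sub>R \<omega> (?r x t) v\<close>
      over the unit interval leaves the boundary value \<open>\<omega> x v\<close>. This trades the
      integral of \<open>\<omega>\<close> for its value at \<open>x\<close> and produces the second
      half of the antisymmetric remainder.\<close>
    have "((\<lambda>t. \<omega> (?r x t) v + t *\<^sub>R \<omega>' (?r x t) (x - x0) v) has_integral
        (1::real) *\<^sub>R \<omega> (?r x 1) v - (0::real) *\<^sub>R \<omega> (?r x 0) v) {0..1}"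
    proof (rule fundamental_theorem_of_calculus)
      fix t :: real assume t: "t \<in> {0..1}"
      have "((\<lambda>t. ?r x t) has_derivative (\<lambda>s. s *\<^sub>R (x - x0))) (at t within {0..1})"
        by (auto intro!: derivative_eq_intros)
      from has_derivative_compose[OF this der[OF m[OF x t]]]
      have "((\<lambda>t. \<omega> (?r x t) v) has_derivative (\<lambda>s. s *\<^sub>R \<omega>' (?r x t) (x - x0) v)) (at t within {0..1})"
        using linear_cmul[OF lin1[OF m[OF x t]]] by simp
      from has_derivative_scaleR[OF has_derivative_ident this]
      show "((\<lambda>t. t *\<^sub>R \<omega> (?r x t) v) has_vector_derivative
          \<omega> (?r x t) v + t *\<^sub>R \<omega>' (?r x t) (x - x0) v) (at t within {0..1})"
        by (simp add: has_vector_derivative_def algebra_simps)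
    qed simp
    then have "\<omega> x v = integral {0..1} (\<lambda>t. \<omega> (?r x t) v + t *\<^sub>R \<omega>' (?r x t) (x - x0) v)"
      by (simp add: integral_unique)
    also have "\<dots> = integral {0..1} (\<lambda>t. \<omega> (?r x t) v) + integral {0..1} (\<lambda>t. t *\<^sub>R \<omega>' (?r x t) (x - x0) v)"
      by (intro integral_add int1 int2 x)
    finally have e3: "\<omega> x v = integral {0..1} (\<lambda>t. \<omega> (?r x t) v) + integral {0..1} (\<lambda>t. t *\<^sub>R \<omega>' (?r x t) (x - x0) v)" .
    have "integral {0..1} (\<lambda>t. t *\<^sub>R (\<omega>' (?r x t) v (x - x0) - \<omega>' (?r x t) (x - x0) v)) =
      integral {0..1} (\<lambda>t. t *\<^sub>R \<omega>' (?r x t) v (x - x0)) - integral {0..1} (\<lambda>t. t *\<^sub>R \<omega>' (?r x t) (x - x0) v)"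
      by (subst scaleR_diff_right) (rule integral_diff[OF int2[OF x] int2[OF x]])
    then show ?thesis using e1 e2 e3 by (simp add: sum.distrib)
  qed
  then show ?thesis using 1 by simp
qed

text \<open>For the differential of \<open>f\<close> the radial integral is
  \<open>f x - f x0\<close>, whose derivative is that differential again. By the homotopy formula
  the remainder, a weighted integral of the antisymmetric part of the second derivative along the
  ray, vanishes for every endpoint. On a short ray in direction \<open>w\<close> a positive
  antisymmetric part would make it nonzero.\<close>

lemma smooth_on_derivative_commute:
  fixes f :: "'a::euclidean_space \<Rightarrow> real"
  assumes U: "open U" and f: "smooth_on U f" and x0: "x0 \<in> U"
  shows "frechet_derivative (\<lambda>x. frechet_derivative f (at x) v) (at x0) w =
    frechet_derivative (\<lambda>x. frechet_derivative f (at x) w) (at x0) v"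
proof -
  define \<omega> where "\<omega> y = frechet_derivative f (at y)" for y
  define \<omega>' where "\<omega>' y v w = frechet_derivative (\<lambda>y. \<omega> y w) (at y) v" for y v w
  obtain r where r: "r > 0" "ball x0 r \<subseteq> U" using U x0 open_contains_ball by blast
  let ?S = "ball x0 r" and ?r = "\<lambda>x t. x0 + t *\<^sub>R (x - x0)"
  have S: "open ?S" "convex ?S" "x0 \<in> ?S" using r by auto
  have f: "smooth_on ?S f" using smooth_on_subset[OF f r(2)] .
  have D: "(f has_derivative \<omega> y) (at y)" if "y \<in> ?S" for y
    unfolding \<omega>_def using smooth_on_has_derivative[OF f that] .
  have sm: "smooth_on ?S (\<lambda>y. \<omega> y w)" for w
    unfolding \<omega>_def using smooth_on_frechet_derivative[OF f] .
  have D2: "((\<lambda>y. \<omega> y w) has_derivative (\<lambda>v. \<omega>' y v w)) (at y)" if "y \<in> ?S" for y w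
    unfolding \<omega>'_def using smooth_on_has_derivative[OF sm that] by simp
  have \<omega>'c: "continuous_on ?S (\<lambda>y. \<omega>' y v w)" for v w
    unfolding \<omega>'_def using smooth_on_imp_continuous_on[OF smooth_on_frechet_derivative[OF sm]] .
  have lin: "linear (\<omega> y)" if "y \<in> ?S" for y using has_derivative_linear[OF D[OF that]] .
  have prim: "integral {0..1} (\<lambda>t. \<omega> (?r x t) (x - x0)) = f x - f x0" if x: "x \<in> ?S" for x
  proof -
    have "((\<lambda>t. \<omega> (?r x t) (x - x0)) has_integral f (?r x 1) - f (?r x 0)) {0..1}"
    proof (rule fundamental_theorem_of_calculus)
      fix t :: real assume t: "t \<in> {0..1}"
      have m: "?r x t \<in> ?S" using radial_mem[OF S(2,3) x t] .
      have "((\<lambda>t. ?r x t) has_derivative (\<lambda>s. s *\<^sub>R (x - x0))) (at t within {0..1})"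
        by (auto intro!: derivative_eq_intros)
      from has_derivative_compose[OF this D[OF m]]
      show "((\<lambda>t. f (?r x t)) has_vector_derivative \<omega> (?r x t) (x - x0)) (at t within {0..1})"
        using linear_cmul[OF lin[OF m]] by (simp add: has_vector_derivative_def)
    qed simp
    then show ?thesis by (simp add: integral_unique)
  qed
  have zero: "integral {0..1} (\<lambda>t. t *\<^sub>R (\<omega>' (?r x t) v (x - x0) - \<omega>' (?r x t) (x - x0) v)) = 0"
    if x: "x \<in> ?S" for x v
  proof -
    have "((\<lambda>x. integral {0..1} (\<lambda>t. \<omega> (?r x t) (x - x0))) has_derivative \<omega> x) (at x)"
      by (rule has_derivative_transform_within_open[OF _ S(1) x, of "\<lambda>x. f x - f x0"])
        (use D[OF x] prim in \<open>auto intro!: derivative_eq_intros\<close>)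
    from fun_cong[OF has_derivative_unique[OF this radial_primitive_has_derivative[OF S x lin D2 \<omega>'c]], of v]
    show ?thesis by (simp only: add_cancel_right_right)
  qed
  have lin1: "linear (\<lambda>v. \<omega>' y v w)" if "y \<in> ?S" for y w
    using has_derivative_linear[OF D2[OF that]] .
  have lin2: "\<omega>' y v (c *\<^sub>R w) = c *\<^sub>R \<omega>' y v w" if y: "y \<in> ?S" for y v c w
  proof -
    have "((\<lambda>y. \<omega> y (c *\<^sub>R w)) has_derivative (\<lambda>v. c *\<^sub>R \<omega>' y v w)) (at y)"
      by (rule has_derivative_transform_within_open[OF has_derivative_scaleR_right[OF D2[OF y, of w]] S(1) y])
        (simp add: linear_cmul[OF lin])
    from has_derivative_unique[OF this D2[OF y]] show ?thesis by metis
  qed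
  \<comment> \<open>One inequality for all \<open>v\<close> and \<open>w\<close> suffices, by
    exchanging the two.\<close>
  have le: "\<omega>' x0 v w \<le> \<omega>' x0 w v" for v w
  proof (rule ccontr)
    define d where "d y = \<omega>' y v w - \<omega>' y w v" for y
    assume "\<not> \<omega>' x0 v w \<le> \<omega>' x0 w v"
    then have d0: "d x0 > 0" by (simp add: d_def)
    have dc: "continuous_on ?S d" unfolding d_def by (intro continuous_intros \<omega>'c)
    then have "isCont d x0" using S continuous_on_eq_continuous_at by blast
    then have "\<forall>\<^sub>F y in at x0. d y > d x0 / 2"
      using d0 order_tendstoD(1)[of d "d x0" "at x0" "d x0 / 2"] by (simp add: isCont_def)
    then obtain \<delta> where \<delta>: "\<delta> > 0" "\<And>y. dist y x0 < \<delta> \<Longrightarrow> d y > d x0 / 2"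
      unfolding eventually_at using d0 by (metis UNIV_I half_gt_zero field_sum_of_halves less_add_same_cancel1)
    \<comment> \<open>The summand 1 keeps the denominator of \<open>s\<close> positive when
      \<open>w\<close> is 0. The factor 2 there places the endpoint strictly inside the ball of
      radius \<open>r\<close> and also inside the one of radius \<open>\<delta>\<close>, where
      \<open>d\<close> exceeds half its value at \<open>x0\<close>.\<close>
    define N where "N = norm w + 1"
    have N: "N > 0" "norm w \<le> N" by (simp_all add: N_def add_nonneg_pos)
    define s where "s = min r \<delta> / (2 * N)"
    have s: "s > 0" using r \<delta> N by (simp add: s_def)
    have sw: "s * norm w < min r \<delta>"
    proof -
      have "s * norm w \<le> s * N" using s N by simp
      also have "\<dots> = min r \<delta> / 2" using N by (simp add: s_def)
      also have "\<dots> < min r \<delta>" using r \<delta> by linarith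
      finally show ?thesis .
    qed
    define x where "x = x0 + s *\<^sub>R w"
    have x: "x \<in> ?S" using sw s by (simp add: x_def dist_norm)
    have m: "?r x t \<in> ?S" if "t \<in> {0..1}" for t using radial_mem[OF S(2,3) x that] .
    have "integral {0..1} (\<lambda>t. t *\<^sub>R (\<omega>' (?r x t) v (x - x0) - \<omega>' (?r x t) (x - x0) v)) =
      integral {0..1} (\<lambda>t. s * (t * d (?r x t)))"
    proof (rule integral_cong)
      fix t :: real assume "t \<in> {0..1}"
      from m[OF this] show "t *\<^sub>R (\<omega>' (?r x t) v (x - x0) - \<omega>' (?r x t) (x - x0) v) = s * (t * d (?r x t))"
        using lin2[of "?r x t" v s w] linear_cmul[OF lin1[of "?r x t" v], of s w]
        by (simp add: x_def d_def algebra_simps)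
    qed
    then have 0: "integral {0..1} (\<lambda>t. t * d (?r x t)) = 0" using zero[OF x, of v] s by simp
    have "integral {0..1} (\<lambda>t. t * (d x0 / 2)) \<le> integral {0..1} (\<lambda>t. t * d (?r x t))"
    proof (rule integral_le)
      show "(\<lambda>t. t * (d x0 / 2)) integrable_on {0..1}"
        by (intro integrable_continuous_real continuous_intros)
      show "(\<lambda>t. t * d (?r x t)) integrable_on {0..1}"
        by (intro integrable_continuous_real continuous_intros continuous_on_radial_slice[OF S(2,3) x dc])
      fix t :: real assume t: "t \<in> {0..1}"
      have "dist (?r x t) x0 \<le> s * norm w"
        using t s by (simp add: x_def dist_norm mult_left_le_one_le)
      then show "t * (d x0 / 2) \<le> t * d (?r x t)"
        using \<delta>(2)[of "?r x t"] sw t by (intro mult_left_mono) auto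
    qed
    moreover have "integral {0..1} (\<lambda>t. t * (d x0 / 2)) = d x0 / 4"
      using ident_has_integral[of 0 1] by (simp add: integral_unique)
    ultimately show False using 0 d0 by simp
  qed
  show ?thesis using le[of v w] le[of w v] by (simp add: \<omega>'_def \<omega>_def)
qed


section \<open>Linear Frobenius theorem\<close>

text \<open>The system \<open>du(v) = G x v u\<close> is solved by Picard iteration along rays. By the homotopy formula
  and integrability, the defects \<open>R y v = dF(v) - G y v F\<close> of the iterates satisfy a recursion
  which makes them tend to 0 on a small ball, so that the limit solves the system in all directions
  and not only along rays.\<close>

lemma linear_frobenius:
  fixes G :: "'a::euclidean_space \<Rightarrow> 'a \<Rightarrow> 'e::euclidean_space \<Rightarrow> 'e"
  assumes U: "open U" and x0U: "x0 \<in> U"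
    and linv: "\<And>x e. x \<in> U \<Longrightarrow> linear (\<lambda>v. G x v e)" and line: "\<And>x v. x \<in> U \<Longrightarrow> linear (G x v)"
    and smooth: "\<And>v e. smooth_on U (\<lambda>x. G x v e)"
    and integrable: "\<And>x v w e. x \<in> U \<Longrightarrow>
      frechet_derivative (\<lambda>x. G x v e) (at x) w + G x v (G x w e) =
      frechet_derivative (\<lambda>x. G x w e) (at x) v + G x w (G x v e)"
  obtains r where "r > 0" "ball x0 r \<subseteq> U"
    "\<And>u0. \<exists>u. u x0 = u0 \<and> (\<forall>x\<in>ball x0 r. (u has_derivative (\<lambda>v. G x v (u x))) (at x))"
proof -
  define DG where "DG y v w e = frechet_derivative (\<lambda>x. G x w e) (at y) v" for y v w e
  have Gc: "continuous_on U (\<lambda>x. G x v e)" for v e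
    using smooth_on_imp_continuous_on[OF smooth] .
  have DGc: "continuous_on U (\<lambda>y. DG y v w e)" for v w e
    unfolding DG_def using smooth_on_imp_continuous_on[OF smooth_on_frechet_derivative[OF smooth]] .
  have DG: "((\<lambda>y. G y w e) has_derivative (\<lambda>v. DG y v w e)) (at y)" if "y \<in> U" for y w e
    unfolding DG_def using smooth_on_has_derivative[OF smooth that] by simp
  \<comment> \<open>Smoothness of \<open>G\<close> is given for fixed \<open>v\<close> and
    \<open>e\<close>. Bilinearity reduces joint continuity and the bound \<open>K\<close> to the
    finitely many functions \<open>G x b c\<close> with basis vectors \<open>b\<close> and
    \<open>c\<close>.\<close>
  have Gexp: "G x v e = (\<Sum>b\<in>Basis. \<Sum>c\<in>Basis. ((v \<bullet> b) * (e \<bullet> c)) *\<^sub>R G x b c)" if "x \<in> U" for x v e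
  proof -
    have "G x v e = (\<Sum>b\<in>Basis. (v \<bullet> b) *\<^sub>R G x b e)" by (rule linear_Basis_expand[OF linv[OF that]])
    also have "\<dots> = (\<Sum>b\<in>Basis. (v \<bullet> b) *\<^sub>R (\<Sum>c\<in>Basis. (e \<bullet> c) *\<^sub>R G x b c))"
      by (intro sum.cong refl arg_cong[where f="scaleR _"] linear_Basis_expand line that)
    finally show ?thesis by (simp add: scaleR_sum_right)
  qed
  have Gcont: "continuous_on T (\<lambda>z. G (y z) (a z) (e z))"
    if "continuous_on T y" "y ` T \<subseteq> U" "continuous_on T a" "continuous_on T e"
    for T :: "'z::topological_space set" and y a e
  proof -
    have "continuous_on T (\<lambda>z. \<Sum>b\<in>Basis. \<Sum>c\<in>Basis. ((a z \<bullet> b) * (e z \<bullet> c)) *\<^sub>R G (y z) b c)"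
      by (intro continuous_intros that continuous_on_compose2[OF Gc that(1,2)])
    then show ?thesis by (rule continuous_on_cong[THEN iffD1, rotated 2]) (use that Gexp in auto)
  qed
  obtain r0 where r0: "r0 > 0" "cball x0 r0 \<subseteq> U" using U x0U open_contains_cball by blast
  have "\<exists>K\<ge>0. \<forall>x\<in>cball x0 r0. norm (G x b c) \<le> K" for b c
  proof -
    have "compact ((\<lambda>x. G x b c) ` cball x0 r0)"
      using compact_continuous_image[OF continuous_on_subset[OF Gc r0(2)]] by simp
    from compact_imp_bounded[OF this] show ?thesis unfolding bounded_iff by (metis image_eqI norm_ge_zero order_trans)
  qed
  then obtain KK where KK: "\<And>b c. KK b c \<ge> 0" "\<And>b c x. x \<in> cball x0 r0 \<Longrightarrow> norm (G x b c) \<le> KK b c"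
    by metis
  \<comment> \<open>The summand 1 makes \<open>K\<close> positive, so that
    \<open>1 / (4 * K)\<close> can serve as a radius.\<close>
  define K where "K = (\<Sum>b\<in>Basis. \<Sum>c\<in>Basis. KK b c) + 1"
  have K: "K > 0" unfolding K_def by (intro add_nonneg_pos sum_nonneg KK) simp
  have GK: "norm (G x v e) \<le> K * norm v * norm e" if x: "x \<in> cball x0 r0" for x v e
  proof -
    have xU: "x \<in> U" using x r0 by blast
    have "norm (G x v e) \<le> (\<Sum>b\<in>Basis. \<Sum>c\<in>Basis. norm (((v \<bullet> b) * (e \<bullet> c)) *\<^sub>R G x b c))"
      by (subst Gexp[OF xU]) (intro order_trans[OF norm_sum] sum_mono norm_sum)
    also have "\<dots> \<le> (\<Sum>b\<in>Basis. \<Sum>c\<in>Basis. (norm v * norm e) * KK b c)"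
    proof (intro sum_mono)
      fix b :: 'a and c :: 'e assume bc: "b \<in> Basis" "c \<in> Basis"
      have "\<bar>v \<bullet> b\<bar> * \<bar>e \<bullet> c\<bar> \<le> norm v * norm e"
        using Basis_le_norm[OF bc(1), of v] Basis_le_norm[OF bc(2), of e] by (intro mult_mono) auto
      then show "norm (((v \<bullet> b) * (e \<bullet> c)) *\<^sub>R G x b c) \<le> (norm v * norm e) * KK b c"
        using KK(2)[OF x] by (auto simp: abs_mult intro!: mult_mono)
    qed
    also have "\<dots> = (norm v * norm e) * (K - 1)" by (simp add: K_def sum_distrib_left)
    also have "\<dots> \<le> (norm v * norm e) * K" by (intro mult_left_mono) auto
    finally show ?thesis by (simp add: mult_ac)
  qed
  \<comment> \<open>With \<open>K * r \<le> 1 / 4\<close> one radial integration shrinks differences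
    by a factor of at least 4. The remainder \<open>Q\<close> consists of two such terms and
    therefore still halves the defect.\<close>
  define r where "r = min r0 (1 / (4 * K))"
  have r: "r > 0" "K * r \<le> 1 / 4" using r0 K by (auto simp: r_def min_def field_simps)
  let ?S = "ball x0 r" and ?r = "\<lambda>x t. x0 + t *\<^sub>R (x - x0)"
  have Sc: "?S \<subseteq> cball x0 r0" by (auto simp: r_def)
  then have SU: "?S \<subseteq> U" using r0 by blast
  have S: "open ?S" "convex ?S" "x0 \<in> ?S" using r by auto
  have m: "?r x t \<in> ?S" if "x \<in> ?S" "t \<in> {0..1}" for x t using radial_mem[OF S(2,3) that] .
  have GS: "norm (G x v e) \<le> K * norm v * norm e" if "x \<in> ?S" for x v e
    using GK that Sc by blast
  have radius: "norm (x - x0) \<le> r" if "x \<in> ?S" for x using that by (simp add: dist_norm norm_minus_commute)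
  have Kr: "norm (G y (x - x0) e) \<le> norm e / 4" "norm (G y v e) \<le> K * norm v * norm e"
    if "x \<in> ?S" "y \<in> ?S" for x y e v
  proof -
    have "norm (G y (x - x0) e) \<le> K * norm (x - x0) * norm e" using GS that by blast
    also have "\<dots> \<le> K * r * norm e" using K radius[OF that(1)] by (intro mult_right_mono mult_left_mono) auto
    also have "\<dots> \<le> (1/4) * norm e" using r by (intro mult_right_mono) auto
    finally show "norm (G y (x - x0) e) \<le> norm e / 4" by simp
  qed (use GS that in blast)

  \<comment> \<open>The derivative is carried along explicitly: the defect of an iterate involves
    its derivative, and \<open>P'\<close> computes the derivative of the next iterate from that of
    the present one.\<close>
  define C1 where "C1 F F' \<longleftrightarrow> (\<forall>y\<in>?S. (F has_derivative F' y) (at y)) \<and> (\<forall>v. continuous_on ?S (\<lambda>y. F' y v))"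
    for F :: "'a \<Rightarrow> 'e" and F'
  \<comment> \<open>\<open>P\<close> is the Picard operator along rays from \<open>x0\<close>,
    \<open>R\<close> the defect of \<open>F\<close> as a solution, and \<open>Q\<close> the
    integrand left over by the homotopy formula. \<open>P'\<close> is the resulting derivative of
    \<open>P u0 F\<close>: the right-hand side of the equation at \<open>F\<close> plus an integral
    of defects.\<close>
  define P where "P u0 F x = u0 + integral {0..1} (\<lambda>t. G (?r x t) (x - x0) (F (?r x t)))" for u0 F x
  define R where "R F F' y v = F' y v - G y v (F y)" for F F' y v
  define Q where "Q F F' x v t = t *\<^sub>R (G (?r x t) (x - x0) (R F F' (?r x t) v) - G (?r x t) v (R F F' (?r x t) (x - x0)))"
    for F F' x v t
  define P' where "P' F F' x v = G x v (F x) + integral {0..1} (Q F F' x v)" for F F' x v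
  have C1D: "\<And>y. y \<in> ?S \<Longrightarrow> (F has_derivative F' y) (at y)" "\<And>v. continuous_on ?S (\<lambda>y. F' y v)"
    "continuous_on ?S F" "\<And>y. y \<in> ?S \<Longrightarrow> linear (F' y)" if "C1 F F'" for F F'
    using that unfolding C1_def
    by (auto intro!: continuous_at_imp_continuous_on intro: has_derivative_continuous has_derivative_linear)
  have radc: "continuous_on (?S \<times> {0..1}) (\<lambda>z. ?r (fst z) (snd z))"
    and radi: "(\<lambda>z. ?r (fst z) (snd z)) ` (?S \<times> {0..1}) \<subseteq> ?S"
    using m by (auto intro!: continuous_intros)
  have Rc: "continuous_on T (\<lambda>z. R F F' (y z) (a z))"
    if C: "C1 F F'" and "continuous_on T y" "y ` T \<subseteq> ?S" "continuous_on T a"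
    for T :: "'z::topological_space set" and y a F F'
  proof -
    have "continuous_on T (\<lambda>z. (\<Sum>b\<in>Basis. (a z \<bullet> b) *\<^sub>R F' (y z) b) - G (y z) (a z) (F (y z)))"
      using that SU by (intro continuous_intros Gcont continuous_on_compose2[OF C1D(2)[OF C] that(2,3)]
          continuous_on_compose2[OF C1D(3)[OF C] that(2,3)]) auto
    moreover have "(\<Sum>b\<in>Basis. (a z \<bullet> b) *\<^sub>R F' (y z) b) = F' (y z) (a z)" if "z \<in> T" for z
      using linear_Basis_expand[OF C1D(4)[OF C, of "y z"], of "a z"] that \<open>y ` T \<subseteq> ?S\<close> by auto
    ultimately show ?thesis unfolding R_def by (simp cong: continuous_on_cong)
  qed
  have Qc: "continuous_on (?S \<times> {0..1}) (\<lambda>z. Q F F' (fst z) v (snd z))" if C: "C1 F F'" for F F' v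
    unfolding Q_def using radi SU
    by (intro continuous_intros Gcont Rc[OF C] radc) auto
  have Fc: "continuous_on {0..1} (\<lambda>t. G (?r x t) (x - x0) (F (?r x t)))" if "x \<in> ?S" "continuous_on ?S F" for x F
    using m[OF that(1)] SU by (intro Gcont continuous_on_radial_slice[OF S(2,3) that] continuous_intros) auto
  have step: "C1 (P u0 F) (P' F F')" if C: "C1 F F'" for u0 F F'
  proof -
    define \<omega>' where "\<omega>' y v w = G y w (F' y v) + (\<Sum>c\<in>Basis. (F y \<bullet> c) *\<^sub>R DG y v w c)" for y v w
    have der: "((\<lambda>y. G y w (F y)) has_derivative (\<lambda>v. \<omega>' y v w)) (at y)" if y: "y \<in> ?S" for y w
    proof -
      have yU: "y \<in> U" using y SU by blast
      have "((\<lambda>y. \<Sum>c\<in>Basis. (F y \<bullet> c) *\<^sub>R G y w c) has_derivative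
          (\<lambda>v. \<Sum>c\<in>Basis. (F y \<bullet> c) *\<^sub>R DG y v w c + (F' y v \<bullet> c) *\<^sub>R G y w c)) (at y)"
        by (intro has_derivative_sum has_derivative_scaleR DG[OF yU] has_derivative_inner_left C1D(1)[OF C y])
      moreover have "(\<lambda>v. \<Sum>c\<in>Basis. (F y \<bullet> c) *\<^sub>R DG y v w c + (F' y v \<bullet> c) *\<^sub>R G y w c) = (\<lambda>v. \<omega>' y v w)"
      proof
        fix v show "(\<Sum>c\<in>Basis. (F y \<bullet> c) *\<^sub>R DG y v w c + (F' y v \<bullet> c) *\<^sub>R G y w c) = \<omega>' y v w"
          unfolding \<omega>'_def using linear_Basis_expand[OF line[OF yU], of w "F' y v"] by (simp add: sum.distrib)
      qed
      ultimately have "((\<lambda>y. \<Sum>c\<in>Basis. (F y \<bullet> c) *\<^sub>R G y w c) has_derivative (\<lambda>v. \<omega>' y v w)) (at y)"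
        by simp
      then show ?thesis
        by (rule has_derivative_transform_within_open[OF _ S(1) y])
          (use linear_Basis_expand[OF line] SU in auto)
    qed
    have cont: "continuous_on ?S (\<lambda>y. \<omega>' y v w)" for v w
      unfolding \<omega>'_def using SU
      by (intro continuous_intros Gcont C1D(2,3)[OF C] continuous_on_subset[OF DGc]) auto
    have lin: "linear (\<lambda>v. G y v (F y))" if "y \<in> ?S" for y using linv that SU by blast
    \<comment> \<open>By integrability the derivatives of \<open>G\<close> combine to the commutator
      of \<open>G y v\<close> and \<open>G y w\<close>, and this commutator is exactly what replaces
      the derivatives of \<open>F\<close> by its defects. No derivative of \<open>G\<close>
      survives, so the estimates below work with the bound on \<open>G\<close> itself.\<close>
    have d\<omega>: "\<omega>' y v w - \<omega>' y w v = G y w (R F F' y v) - G y v (R F F' y w)" if y: "y \<in> ?S" for y v w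
    proof -
      have yU: "y \<in> U" using y SU by blast
      have "(\<Sum>c\<in>Basis. (F y \<bullet> c) *\<^sub>R DG y v w c) - (\<Sum>c\<in>Basis. (F y \<bullet> c) *\<^sub>R DG y w v c) =
          (\<Sum>c\<in>Basis. (F y \<bullet> c) *\<^sub>R (G y v (G y w c) - G y w (G y v c)))"
        unfolding sum_subtractf[symmetric] scaleR_diff_right[symmetric]
        using integrable[OF yU] by (intro sum.cong refl arg_cong[where f="scaleR _"])
          (simp add: DG_def algebra_simps)
      also have "\<dots> = G y v (G y w (F y)) - G y w (G y v (F y))"
      proof -
        have "linear (\<lambda>e. G y v (G y w e) - G y w (G y v e))"
          by (rule linearI)
            (simp_all add: linear_add[OF line[OF yU]] linear_cmul[OF line[OF yU]] algebra_simps)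
        from linear_Basis_expand[OF this, of "F y"] show ?thesis by simp
      qed
      finally have 1: "(\<Sum>c\<in>Basis. (F y \<bullet> c) *\<^sub>R DG y v w c) - (\<Sum>c\<in>Basis. (F y \<bullet> c) *\<^sub>R DG y w v c) =
        G y v (G y w (F y)) - G y w (G y v (F y))" .
      have 2: "\<omega>' y v w - \<omega>' y w v = G y w (F' y v) - G y v (F' y w) +
          ((\<Sum>c\<in>Basis. (F y \<bullet> c) *\<^sub>R DG y v w c) - (\<Sum>c\<in>Basis. (F y \<bullet> c) *\<^sub>R DG y w v c))"
        by (simp add: \<omega>'_def)
      show ?thesis unfolding 2 1 R_def
        by (simp add: linear_diff[OF line[OF yU]])
    qed
    have "(P u0 F has_derivative P' F F' x) (at x)" if x: "x \<in> ?S" for x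
    proof -
      have "integral {0..1} (\<lambda>t. t *\<^sub>R (\<omega>' (?r x t) v (x - x0) - \<omega>' (?r x t) (x - x0) v)) =
          integral {0..1} (Q F F' x v)" for v
        by (intro integral_cong) (simp add: Q_def d\<omega>[OF m[OF x]])
      then have "P' F F' x = (\<lambda>v. G x v (F x) + integral {0..1} (\<lambda>t. t *\<^sub>R (\<omega>' (?r x t) v (x - x0) - \<omega>' (?r x t) (x - x0) v)))"
        by (simp add: P'_def fun_eq_iff)
      then show ?thesis unfolding P_def
        using has_derivative_add[OF has_derivative_const radial_primitive_has_derivative[OF S x lin der cont]]
        by simp
    qed
    moreover have "continuous_on ?S (\<lambda>x. P' F F' x v)" for v
    proof -
      have "continuous_on ?S (\<lambda>x. integral (cbox 0 1) (Q F F' x v))"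
        by (rule integral_continuous_on_param) (use Qc[OF C] in \<open>simp add: split_beta\<close>)
      then show ?thesis unfolding P'_def using C1D(3)[OF C] SU by (intro continuous_intros Gcont) auto
    qed
    ultimately show ?thesis by (simp add: C1_def)
  qed

  have sol: "\<exists>u. u x0 = u0 \<and> (\<forall>x\<in>?S. (u has_derivative (\<lambda>v. G x v (u x))) (at x))" for u0
  proof -
    define FF where "FF = rec_nat (\<lambda>x. u0, \<lambda>x v. 0) (\<lambda>n (F, F'). (P u0 F, P' F F'))"
    define F where "F n = fst (FF n)" for n
    define F' where "F' n = snd (FF n)" for n
    have F0: "F 0 x = u0" "F' 0 x v = 0" for x v by (simp_all add: F_def F'_def FF_def)
    have FS: "F (Suc n) = P u0 (F n)" "F' (Suc n) = P' (F n) (F' n)" for n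
      by (simp_all add: F_def F'_def FF_def split_beta)
    have C: "C1 (F n) (F' n)" for n
    proof (induction n)
      case 0
      have "F 0 = (\<lambda>x. u0)" "F' 0 = (\<lambda>x v. 0)" using F0 by (simp_all add: fun_eq_iff)
      then show ?case by (simp add: C1_def)
    qed (simp add: FS step)
    define M where "M = norm u0"
    have M: "M \<ge> 0" by (simp add: M_def)
    have diffb: "norm (F (Suc n) x - F n x) \<le> M * (1/2) ^ n" if "x \<in> ?S" for x n
      using that
    proof (induction n arbitrary: x)
      case 0
      have "norm (integral {0..1} (\<lambda>t. G (?r x t) (x - x0) (F 0 (?r x t)))) \<le> M * (1 - 0)"
      proof (rule integral_bound)
        show "norm (G (?r x t) (x - x0) (F 0 (?r x t))) \<le> M" if "t \<in> {0..1}" for t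
          using order_trans[OF Kr(1)[OF 0 m[OF 0 that], of u0], of M] by (simp add: F0 M_def)
      qed (use Fc[OF 0 C1D(3)[OF C]] in auto)
      then show ?case by (simp add: FS P_def F0)
    next
      case (Suc n)
      have "F (Suc (Suc n)) x - F (Suc n) x =
        integral {0..1} (\<lambda>t. G (?r x t) (x - x0) (F (Suc n) (?r x t))) - integral {0..1} (\<lambda>t. G (?r x t) (x - x0) (F n (?r x t)))"
        by (subst (1 2) FS) (simp add: P_def)
      also have "\<dots> = integral {0..1} (\<lambda>t. G (?r x t) (x - x0) (F (Suc n) (?r x t)) - G (?r x t) (x - x0) (F n (?r x t)))"
        by (intro integral_diff[symmetric] integrable_continuous_real Fc Suc.prems C1D(3)[OF C])
      also have "norm \<dots> \<le> M * (1/2) ^ Suc n * (1 - 0)"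
      proof (rule integral_bound)
        show "continuous_on {0..1} (\<lambda>t. G (?r x t) (x - x0) (F (Suc n) (?r x t)) - G (?r x t) (x - x0) (F n (?r x t)))"
          by (intro continuous_intros Fc Suc.prems C1D(3)[OF C])
        fix t :: real assume t: "t \<in> {0..1}"
        note y = m[OF Suc.prems t]
        have "G (?r x t) (x - x0) (F (Suc n) (?r x t)) - G (?r x t) (x - x0) (F n (?r x t)) =
          G (?r x t) (x - x0) (F (Suc n) (?r x t) - F n (?r x t))"
          using y SU by (simp add: linear_diff[OF line] subset_iff)
        also have "norm \<dots> \<le> norm (F (Suc n) (?r x t) - F n (?r x t)) / 4" using Kr(1)[OF Suc.prems y] .
        also have "\<dots> \<le> (M * (1/2) ^ n) / 4" using Suc.IH[OF y] by simp
        also have "\<dots> \<le> M * (1/2) ^ Suc n" using M by simp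
        finally show "norm (G (?r x t) (x - x0) (F (Suc n) (?r x t)) - G (?r x t) (x - x0) (F n (?r x t))) \<le> M * (1/2) ^ Suc n" .
      qed simp
      finally show ?case by simp
    qed
    have diffb2: "norm (F (n + k) x - F n x) \<le> 2 * M * (1/2) ^ n * (1 - (1/2) ^ k)" if x: "x \<in> ?S" for x n k
    proof (induction k)
      case (Suc k)
      have "norm (F (n + Suc k) x - F n x) \<le> norm (F (Suc (n + k)) x - F (n + k) x) + norm (F (n + k) x - F n x)"
        by (metis add_Suc_right norm_triangle_sub norm_diff_triangle_ineq diff_add_cancel norm_triangle_ineq
            add_diff_eq)
      also have "\<dots> \<le> M * (1/2) ^ (n + k) + 2 * M * (1/2) ^ n * (1 - (1/2) ^ k)"
        using diffb[OF x, of "n + k"] Suc.IH by linarith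
      also have "\<dots> = 2 * M * (1/2) ^ n * (1 - (1/2) ^ Suc k)" by (simp add: power_add field_simps)
      finally show ?case .
    qed simp
    have diffb3: "norm (F (n + k) x - F n x) \<le> 2 * M * (1/2) ^ n" if x: "x \<in> ?S" for x n k
      by (rule order_trans[OF diffb2[OF x]]) (use M in \<open>simp add: mult_left_le\<close>)
    have lim0: "(\<lambda>n. (a + b * real n) * (1/2) ^ n) \<longlonglongrightarrow> 0" for a b :: real
    proof -
      have "(\<lambda>n. a * (1/2) ^ n + b * (real n * (1/2) ^ n)) \<longlonglongrightarrow> a * 0 + b * 0"
        by (intro tendsto_intros powser_times_n_limit_0) (auto simp: LIMSEQ_realpow_zero)
      then show ?thesis by (simp add: algebra_simps)
    qed
    have "Cauchy (\<lambda>n. F n x)" if x: "x \<in> ?S" for x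
    proof (rule metric_CauchyI)
      fix e :: real assume "e > 0"
      with lim0[of "4 * M" 0] have "\<forall>\<^sub>F n in sequentially. 4 * M * (1/2) ^ n < e"
        using order_tendstoD(2)[of _ 0 sequentially e] by simp
      then obtain N where N: "4 * M * (1/2) ^ N < e" unfolding eventually_sequentially by blast
      have b: "dist (F k x) (F N x) \<le> 2 * M * (1/2) ^ N" if "k \<ge> N" for k
        using diffb3[OF x, of N "k - N"] that by (simp add: dist_norm)
      have "dist (F i x) (F j x) < e" if "i \<ge> N" "j \<ge> N" for i j
        using dist_triangle2[of "F i x" "F j x" "F N x"] b[OF that(1)] b[OF that(2)] N by linarith
      then show "\<exists>N. \<forall>i\<ge>N. \<forall>j\<ge>N. dist (F i x) (F j x) < e" by blast
    qed
    then have conv: "(\<lambda>n. F n x) \<longlonglongrightarrow> lim (\<lambda>n. F n x)" if "x \<in> ?S" for x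
      using that Cauchy_convergent_iff convergent_LIMSEQ_iff by blast
    define u where "u x = lim (\<lambda>n. F n x)" for x
    have ub: "norm (u x - F n x) \<le> 2 * M * (1/2) ^ n" if x: "x \<in> ?S" for x n
    proof (rule Lim_bounded)
      have "(\<lambda>k. F (k + n) x) \<longlonglongrightarrow> u x" using LIMSEQ_ignore_initial_segment[OF conv[OF x]] u_def by simp
      then show "(\<lambda>k. norm (F (k + n) x - F n x)) \<longlonglongrightarrow> norm (u x - F n x)" by (intro tendsto_intros)
      show "\<forall>k\<ge>0. norm (F (k + n) x - F n x) \<le> 2 * M * (1/2) ^ n" using diffb3[OF x, of n] by (simp add: add.commute)
    qed
    \<comment> \<open>The recursion halves the bound and adds \<open>K * M * (1/2) ^ n\<close>,
      which stems from the distance of successive iterates. As the added term decays at the same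
      rate, the solution acquires a factor linear in \<open>n\<close>; it is harmless in the
      limit.\<close>
    have Rb: "norm (R (F n) (F' n) x v) \<le> (K * M + 2 * K * M * n) * (1/2) ^ n * norm v" if "x \<in> ?S" for x v n
      using that
    proof (induction n arbitrary: x v)
      case 0
      then show ?case using GS[OF 0, of v u0] by (simp add: R_def F0 M_def mult_ac)
    next
      case (Suc n)
      let ?\<rho> = "(K * M + 2 * K * M * n) * (1/2) ^ n"
      have \<rho>: "?\<rho> \<ge> 0" using K M by (auto intro!: mult_nonneg_nonneg add_nonneg_nonneg)
      have xU: "x \<in> U" using Suc.prems SU by blast
      have eq: "R (F (Suc n)) (F' (Suc n)) x v = G x v (F n x - F (Suc n) x) + integral {0..1} (Q (F n) (F' n) x v)"
        unfolding linear_diff[OF line[OF xU]] by (simp add: R_def FS P'_def)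
      have "norm (integral {0..1} (Q (F n) (F' n) x v)) \<le> (?\<rho> * norm v / 2) * (1 - 0)"
      proof (rule integral_bound)
        show "continuous_on {0..1} (Q (F n) (F' n) x v)"
          by (rule continuous_on_compose2[OF Qc[OF C], of _ "\<lambda>t. (x, t)", simplified])
            (use Suc.prems in \<open>auto intro!: continuous_intros\<close>)
        fix t :: real assume t: "t \<in> {0..1}"
        note y = m[OF Suc.prems t]
        let ?R = "R (F n) (F' n) (?r x t)"
        have 1: "norm (G (?r x t) (x - x0) (?R v)) \<le> ?\<rho> * norm v / 4"
          using Kr(1)[OF Suc.prems y, of "?R v"] Suc.IH[OF y, of v] by linarith
        have "norm (G (?r x t) v (?R (x - x0))) \<le> K * norm v * norm (?R (x - x0))"
          using GS[OF y] .
        also have "\<dots> \<le> K * norm v * (?\<rho> * r)"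
          using K order_trans[OF Suc.IH[OF y] mult_left_mono[OF radius[OF Suc.prems] \<rho>]] by (intro mult_left_mono) auto
        also have "\<dots> = (K * r) * (?\<rho> * norm v)" by (simp add: mult_ac)
        also have "\<dots> \<le> (1/4) * (?\<rho> * norm v)" using r \<rho> by (intro mult_right_mono) auto
        finally have 2: "norm (G (?r x t) v (?R (x - x0))) \<le> ?\<rho> * norm v / 4" by simp
        have "norm (Q (F n) (F' n) x v t) \<le> norm (G (?r x t) (x - x0) (?R v) - G (?r x t) v (?R (x - x0)))"
          using t unfolding Q_def by (simp add: mult_left_le_one_le)
        also have "\<dots> \<le> ?\<rho> * norm v / 2"
          using norm_triangle_ineq4[of "G (?r x t) (x - x0) (?R v)" "G (?r x t) v (?R (x - x0))"] 1 2 by linarith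
        finally show "norm (Q (F n) (F' n) x v t) \<le> ?\<rho> * norm v / 2" .
      qed simp
      then have i1: "norm (integral {0..1} (Q (F n) (F' n) x v)) \<le> ?\<rho> * norm v / 2" by simp
      have i2: "norm (G x v (F n x - F (Suc n) x)) \<le> K * norm v * (M * (1/2) ^ n)"
        using K diffb[OF Suc.prems, of n] by (intro order_trans[OF GS[OF Suc.prems]] mult_left_mono)
          (auto simp: norm_minus_commute)
      have "norm (R (F (Suc n)) (F' (Suc n)) x v) \<le> K * norm v * (M * (1/2) ^ n) + ?\<rho> * norm v / 2"
        unfolding eq by (rule norm_triangle_le, rule add_mono[OF i2 i1])
      also have "\<dots> = (K * M + 2 * K * M * Suc n) * (1/2) ^ Suc n * norm v"
        by (simp add: field_simps)
      finally show ?case .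
    qed
    \<comment> \<open>The derivatives \<open>F' n\<close> converge uniformly to
      \<open>G x h (u x)\<close>: the difference splits into the defect of \<open>F n\<close> and
      \<open>G\<close> applied to \<open>u x - F n x\<close>. The two bounds add up to the
      coefficient 3 in front of \<open>K * M\<close>.\<close>
    have "\<exists>g. \<forall>x\<in>?S. (\<lambda>n. F n x) \<longlonglongrightarrow> g x \<and> (g has_derivative (\<lambda>v. G x v (u x))) (at x within ?S)"
    proof (rule has_derivative_sequence[OF S(2)])
      show "(F n has_derivative F' n x) (at x within ?S)" if "x \<in> ?S" for n x
        using C1D(1)[OF C that] has_derivative_at_withinI by blast
      show "\<forall>\<^sub>F n in sequentially. \<forall>x\<in>?S. \<forall>h. norm (F' n x h - G x h (u x)) \<le> e * norm h" if "e > 0" for e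
      proof -
        have "\<forall>\<^sub>F n in sequentially. (3 * (K * M) + 2 * K * M * n) * (1/2) ^ n < e"
          using order_tendstoD(2)[OF lim0 that] by simp
        then show ?thesis
        proof (rule eventually_mono, intro ballI allI)
          fix n x h assume n: "(3 * (K * M) + 2 * K * M * n) * (1/2) ^ n < e" and x: "x \<in> ?S"
          have "F' n x h - G x h (u x) = R (F n) (F' n) x h - G x h (u x - F n x)"
            using line x SU by (simp add: R_def linear_diff[OF line] subset_iff)
          also have "norm \<dots> \<le> norm (R (F n) (F' n) x h) + norm (G x h (u x - F n x))"
            by (rule norm_triangle_ineq4)
          also have "\<dots> \<le> (K * M + 2 * K * M * n) * (1/2) ^ n * norm h + K * norm h * (2 * M * (1/2) ^ n)"
            using K by (intro add_mono Rb x order_trans[OF GS[OF x]] mult_left_mono ub) auto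
          also have "\<dots> = ((3 * (K * M) + 2 * K * M * n) * (1/2) ^ n) * norm h" by (simp add: algebra_simps)
          also have "\<dots> \<le> e * norm h" using n by (intro mult_right_mono) auto
          finally show "norm (F' n x h - G x h (u x)) \<le> e * norm h" .
        qed
      qed
      show "(\<lambda>n. F n x0) \<longlonglongrightarrow> u x0" using conv[OF S(3)] by (simp add: u_def)
    qed (fact S)
    then obtain g where g: "\<And>x. x \<in> ?S \<Longrightarrow> (\<lambda>n. F n x) \<longlonglongrightarrow> g x"
      "\<And>x. x \<in> ?S \<Longrightarrow> (g has_derivative (\<lambda>v. G x v (u x))) (at x within ?S)" by blast
    have gu: "g x = u x" if "x \<in> ?S" for x
      using LIMSEQ_unique[OF g(1)[OF that] conv[OF that]] by (simp add: u_def)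
    \<comment> \<open>At the endpoint \<open>x0\<close> the vector \<open>x - x0\<close> is 0, so
      the integrand of \<open>P\<close> vanishes by linearity of \<open>G\<close> in its direction
      argument.\<close>
    have "F n x0 = u0" for n
    proof (cases n)
      case (Suc k)
      have "G x0 0 e = 0" for e using linear_0[OF linv[OF x0U]] .
      then show ?thesis using Suc by (simp add: FS P_def)
    qed (simp add: F0)
    then have "g x0 = u0" using g(1)[OF S(3)] by (simp add: LIMSEQ_const_iff)
    moreover have "(g has_derivative (\<lambda>v. G x v (g x))) (at x)" if "x \<in> ?S" for x
      using g(2)[OF that] gu[OF that] at_within_open[OF that S(1)] by simp
    ultimately show ?thesis by blast
  qed
  show thesis using that[OF r(1) SU sol] .
qed


section \<open>Smooth manifolds\<close>

locale smooth_mfd =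
  fixes A :: "('b::{t2_space, second_countable_topology}, 'n::finite) chart set"
  assumes smooth_manifold: "smooth_manifold A"
begin

lemma chart_homeomorphism: "c \<in> A \<Longrightarrow> homeomorphism (fst c) (snd c ` fst c) (snd c) (chart_inv c)"
  and chart_dom_open: "c \<in> A \<Longrightarrow> open (fst c)"
  and chart_ran_open: "c \<in> A \<Longrightarrow> open (snd c ` fst c)"
  using smooth_manifold unfolding smooth_manifold_def is_chart_def by blast+

lemma charts_at_ex: "\<exists>c. c \<in> charts_at A p"
  using smooth_manifold unfolding smooth_manifold_def charts_at_def by blast

lemma charts_atD: "c \<in> charts_at A p \<Longrightarrow> c \<in> A" "c \<in> charts_at A p \<Longrightarrow> p \<in> fst c"
  by (simp_all add: charts_at_def)

lemma charts_atI: "c \<in> A \<Longrightarrow> p \<in> fst c \<Longrightarrow> c \<in> charts_at A p"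
  by (simp add: charts_at_def)

lemma chart_inv_left [simp]: "c \<in> A \<Longrightarrow> p \<in> fst c \<Longrightarrow> chart_inv c (snd c p) = p"
  using chart_homeomorphism homeomorphism_apply1 by blast

lemma chart_inv_right [simp]: "c \<in> A \<Longrightarrow> x \<in> snd c ` fst c \<Longrightarrow> snd c (chart_inv c x) = x"
  using chart_homeomorphism homeomorphism_apply2 by blast

lemma chart_image_open:
  assumes "c \<in> A" "open V"
  shows "open (snd c ` (V \<inter> fst c))"
proof -
  have "openin (top_of_set (snd c ` fst c)) (snd c ` (V \<inter> fst c))"
    using homeomorphism_imp_open_map[OF chart_homeomorphism[OF assms(1)], of "V \<inter> fst c"] assms
    by (metis Int_commute openin_open_Int)
  then show ?thesis using chart_ran_open[OF assms(1)] openin_open_trans by blast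
qed

lemma chart_image_open': "c \<in> A \<Longrightarrow> open V \<Longrightarrow> V \<subseteq> fst c \<Longrightarrow> open (snd c ` V)"
  using chart_image_open[of c V] by (simp add: Int_absorb2)

lemma chart_preimage_open:
  assumes "c \<in> A" "open X" "X \<subseteq> snd c ` fst c"
  shows "open (chart_inv c ` X)"
proof -
  have "openin (top_of_set (fst c)) (chart_inv c ` X)"
    using homeomorphism_imp_open_map[OF homeomorphism_sym[THEN iffD1, OF chart_homeomorphism[OF assms(1)]], of X] assms
    by (simp add: openin_open_eq chart_ran_open)
  then show ?thesis using chart_dom_open[OF assms(1)] openin_open_trans by blast
qed

lemma chart_preimage_subset: "c \<in> A \<Longrightarrow> X \<subseteq> snd c ` fst c \<Longrightarrow> chart_inv c ` X \<subseteq> fst c"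
  by (auto simp: subset_iff)

lemma chart_image_preimage: "c \<in> A \<Longrightarrow> X \<subseteq> snd c ` fst c \<Longrightarrow> snd c ` chart_inv c ` X = X"
  by (simp add: image_image subset_iff cong: image_cong)


section \<open>Jacobians of coordinate changes\<close>

definition jac :: "('b, 'n) chart \<Rightarrow> ('b, 'n) chart \<Rightarrow> 'b \<Rightarrow> real^'n \<Rightarrow> real^'n" where
  "jac c d p = frechet_derivative (snd d \<circ> chart_inv c) (at (snd c p))"

lemma transition_smooth:
  "c \<in> A \<Longrightarrow> d \<in> A \<Longrightarrow> smooth_on (snd c ` (fst c \<inter> fst d)) (snd d \<circ> chart_inv c)"
  using smooth_manifold unfolding smooth_manifold_def compatible_def by blast

lemma overlap_open: "c \<in> A \<Longrightarrow> d \<in> A \<Longrightarrow> open (snd c ` (fst c \<inter> fst d))"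
  using chart_image_open[of c "fst d"] chart_dom_open by (simp add: Int_commute)

lemma transition_has_derivative:
  assumes "c \<in> charts_at A p" "d \<in> charts_at A p"
  shows "(snd d \<circ> chart_inv c has_derivative jac c d p) (at (snd c p))"
  unfolding jac_def using assms
  by (intro smooth_on_has_derivative[OF transition_smooth]) (auto dest: charts_atD)

lemma jac_linear: "c \<in> charts_at A p \<Longrightarrow> d \<in> charts_at A p \<Longrightarrow> linear (jac c d p)"
  using transition_has_derivative has_derivative_linear by blast

lemma jac_self: "c \<in> charts_at A p \<Longrightarrow> jac c c p w = w"
proof -
  assume c: "c \<in> charts_at A p"
  have "((\<lambda>x. x) has_derivative jac c c p) (at (snd c p))"
    by (rule has_derivative_transform_within_open[OF transition_has_derivative[OF c c] chart_ran_open])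
      (use charts_atD[OF c] in auto)
  from has_derivative_unique[OF this has_derivative_ident] show ?thesis by simp
qed

lemma jac_comp:
  assumes c: "c \<in> charts_at A p" and d: "d \<in> charts_at A p" and e: "e \<in> charts_at A p"
  shows "jac d e p (jac c d p w) = jac c e p w"
proof -
  note m = charts_atD[OF c] charts_atD[OF d] charts_atD[OF e]
  have "snd d p = (snd d \<circ> chart_inv c) (snd c p)" using m by simp
  with diff_chain_at[OF transition_has_derivative[OF c d]] transition_has_derivative[OF d e]
  have "((snd e \<circ> chart_inv d) \<circ> (snd d \<circ> chart_inv c) has_derivative jac d e p \<circ> jac c d p) (at (snd c p))"
    by metis
  then have "(snd e \<circ> chart_inv c has_derivative jac d e p \<circ> jac c d p) (at (snd c p))"
    by (rule has_derivative_transform_within_open[OF _ overlap_open[of c d]])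
      (use m in auto)
  from has_derivative_unique[OF this transition_has_derivative[OF c e]] show ?thesis by (metis comp_apply)
qed


subsection \<open>Smooth maps\<close>

lemma smooth_map_onD: "smooth_map_on A U f \<Longrightarrow> c \<in> A \<Longrightarrow> smooth_on (snd c ` (U \<inter> fst c)) (f \<circ> chart_inv c)"
  by (simp add: smooth_map_on_def)

lemma smooth_map_on_subset: "smooth_map_on A U f \<Longrightarrow> V \<subseteq> U \<Longrightarrow> smooth_map_on A V f"
  unfolding smooth_map_on_def by (meson Int_mono image_mono order_refl smooth_on_subset)

lemma smooth_map_on_local:
  assumes "\<And>p. p \<in> U \<Longrightarrow> \<exists>V. open V \<and> p \<in> V \<and> smooth_map_on A V f"
  shows "smooth_map_on A U f"
  unfolding smooth_map_on_def
proof (intro ballI smooth_on_local)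
  fix c x assume c: "c \<in> A" and "x \<in> snd c ` (U \<inter> fst c)"
  then obtain p where p: "p \<in> U" "p \<in> fst c" "x = snd c p" by blast
  obtain V where "open V" "p \<in> V" "smooth_map_on A V f" using assms p by blast
  then show "\<exists>X. open X \<and> x \<in> X \<and> smooth_on X (f \<circ> chart_inv c)"
    using chart_image_open[OF c] smooth_map_onD c p by blast
qed

text \<open>The expression of \<open>f\<close> in another chart is the given one composed with a
  smooth transition map, so one chart that covers \<open>U\<close> decides smoothness in all of
  them.\<close>

lemma smooth_map_onI_chart:
  assumes c: "c \<in> A" and U: "open U" "U \<subseteq> fst c" and f: "smooth_on (snd c ` U) (f \<circ> chart_inv c)"
  shows "smooth_map_on A U f"
  unfolding smooth_map_on_def
proof
  fix d assume d: "d \<in> A"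
  let ?X = "snd d ` (U \<inter> fst d)"
  have X: "open ?X" using chart_image_open[OF d U(1)] .
  have "smooth_on ?X (\<lambda>x. (f \<circ> chart_inv c) ((snd c \<circ> chart_inv d) x))"
  proof (rule smooth_on_compose[OF X chart_image_open'[OF c U] _ _ f])
    show "(snd c \<circ> chart_inv d) ` ?X \<subseteq> snd c ` U" using d by auto
    show "smooth_on ?X (snd c \<circ> chart_inv d)"
      by (rule smooth_on_subset[OF transition_smooth[OF d c]]) (use U in auto)
  qed
  then show "smooth_on ?X (f \<circ> chart_inv d)"
    by (rule smooth_on_cong[OF X, THEN iffD1, rotated])
      (use c d U in auto)
qed

lemma smooth_map_on_cong:
  assumes U: "open U" and "\<And>p. p \<in> U \<Longrightarrow> f p = g p"
  shows "smooth_map_on A U f \<longleftrightarrow> smooth_map_on A U g"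
  unfolding smooth_map_on_def
proof (intro ball_cong refl)
  fix c assume c: "c \<in> A"
  show "smooth_on (snd c ` (U \<inter> fst c)) (f \<circ> chart_inv c) \<longleftrightarrow> smooth_on (snd c ` (U \<inter> fst c)) (g \<circ> chart_inv c)"
    by (rule smooth_on_cong[OF chart_image_open[OF c U]]) (use assms c in auto)
qed

lemma smooth_map_on_transform:
  "smooth_map_on A U f \<Longrightarrow> open U \<Longrightarrow> (\<And>p. p \<in> U \<Longrightarrow> f p = g p) \<Longrightarrow> smooth_map_on A U g"
  using smooth_map_on_cong[of U f g] by simp

lemma smooth_map_on_const [simp]: "smooth_map_on A U (\<lambda>p. a)"
  by (simp add: smooth_map_on_def o_def)

lemma smooth_map_on_bounded_linear:
  "bounded_linear h \<Longrightarrow> open U \<Longrightarrow> smooth_map_on A U f \<Longrightarrow> smooth_map_on A U (\<lambda>p. h (f p))"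
  unfolding smooth_map_on_def o_def by (rule ballI, rule smooth_on_bounded_linear, assumption, rule chart_image_open) simp_all

lemma smooth_map_on_add:
  "open U \<Longrightarrow> smooth_map_on A U f \<Longrightarrow> smooth_map_on A U g \<Longrightarrow> smooth_map_on A U (\<lambda>p. f p + g p)"
  unfolding smooth_map_on_def o_def by (intro ballI smooth_on_add chart_image_open) simp_all

lemma smooth_map_on_sum:
  "open U \<Longrightarrow> (\<And>i. i \<in> I \<Longrightarrow> smooth_map_on A U (f i)) \<Longrightarrow> smooth_map_on A U (\<lambda>p. \<Sum>i\<in>I. f i p)"
  unfolding smooth_map_on_def o_def by (intro ballI smooth_on_sum chart_image_open) simp_all

lemma smooth_map_on_bilinear:
  "bounded_bilinear prd \<Longrightarrow> open U \<Longrightarrow> smooth_map_on A U f \<Longrightarrow> smooth_map_on A U g \<Longrightarrow>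
    smooth_map_on A U (\<lambda>p. prd (f p) (g p))"
  unfolding smooth_map_on_def o_def by (rule ballI, rule smooth_on_bilinear, assumption, rule chart_image_open) simp_all

lemmas smooth_map_on_mult = smooth_map_on_bilinear[OF bounded_bilinear_mult]
lemmas smooth_map_on_scaleR = smooth_map_on_bilinear[OF bounded_bilinear_scaleR]

lemma smooth_map_on_vec_iff:
  fixes f :: "'b \<Rightarrow> real^'m"
  assumes U: "open U"
  shows "smooth_map_on A U f \<longleftrightarrow> (\<forall>i. smooth_map_on A U (\<lambda>p. f p $ i))"
proof -
  have "smooth_on (snd c ` (U \<inter> fst c)) (\<lambda>x. f (chart_inv c x)) \<longleftrightarrow>
      (\<forall>i. smooth_on (snd c ` (U \<inter> fst c)) (\<lambda>x. f (chart_inv c x) $ i))" if "c \<in> A" for c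
    by (rule smooth_on_vec_iff[OF chart_image_open[OF that U]])
  then show ?thesis unfolding smooth_map_on_def o_def by blast
qed

lemma smooth_map_on_Pair:
  assumes U: "open U" and "smooth_map_on A U f" "smooth_map_on A U g"
  shows "smooth_map_on A U (\<lambda>p. (f p, g p))"
proof -
  have "bounded_linear (\<lambda>x. (x, 0))" "bounded_linear (\<lambda>x. (0, x))"
    by (intro bounded_linear_Pair bounded_linear_ident bounded_linear_zero)+
  then have "smooth_map_on A U (\<lambda>p. (f p, 0) + (0, g p))"
    using assms by (intro smooth_map_on_add U smooth_map_on_bounded_linear[where h="\<lambda>x. (x, 0)"]
        smooth_map_on_bounded_linear[where h="\<lambda>x. (0, x)"])
  then show ?thesis by simp
qed

lemma smooth_map_on_compose:
  fixes f :: "'b \<Rightarrow> 'e::euclidean_space"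
  assumes U: "open U" and W: "open W" "f ` U \<subseteq> W" and f: "smooth_map_on A U f" and g: "smooth_on W g"
  shows "smooth_map_on A U (\<lambda>p. g (f p))"
  unfolding smooth_map_on_def o_def
proof
  fix c assume c: "c \<in> A"
  show "smooth_on (snd c ` (U \<inter> fst c)) (\<lambda>x. g (f (chart_inv c x)))"
    by (rule smooth_on_compose[OF chart_image_open[OF c U] W(1) _ _ g])
      (use W(2) c smooth_map_onD[OF f c] in \<open>auto simp: o_def\<close>)
qed

lemma smooth_map_on_coord: "c \<in> A \<Longrightarrow> smooth_map_on A (fst c) (snd c)"
  by (rule smooth_map_onI_chart) (auto simp: chart_dom_open chart_ran_open chart_inv_right
      intro!: smooth_on_cong[THEN iffD1, OF _ _ smooth_on_ident])

lemma smooth_map_on_pullback: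
  assumes c: "c \<in> A" and U: "open U" "U \<subseteq> fst c" and g: "smooth_on (snd c ` U) g"
  shows "smooth_map_on A U (\<lambda>p. g (snd c p))"
  by (rule smooth_map_on_compose[OF U(1) chart_image_open'[OF c U] order_refl _ g])
    (rule smooth_map_on_subset[OF smooth_map_on_coord[OF c] U(2)])

lemma smooth_map_on_solution:
  fixes M :: "'b \<Rightarrow> real^'m^'m"
  assumes U: "open U" and M: "\<And>i j. smooth_map_on A U (\<lambda>p. M p $ i $ j)"
    and b: "\<And>i. smooth_map_on A U (\<lambda>p. b p $ i)"
    and y: "\<And>p. p \<in> U \<Longrightarrow> M p *v y p = b p" and det: "\<And>p. p \<in> U \<Longrightarrow> det (M p) \<noteq> 0"
  shows "smooth_map_on A U y"
  unfolding smooth_map_on_def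
proof
  fix c assume c: "c \<in> A"
  show "smooth_on (snd c ` (U \<inter> fst c)) (y \<circ> chart_inv c)"
    by (rule smooth_on_solution[OF chart_image_open[OF c U], where M="\<lambda>x. M (chart_inv c x)"
          and b="\<lambda>x. b (chart_inv c x)"])
      (use y det c smooth_map_onD[OF M c] smooth_map_onD[OF b c] in \<open>auto simp: o_def\<close>)
qed


subsection \<open>Derivations\<close>

lemma smooth_map_has_derivative:
  assumes f: "smooth_map_on A U f" and p: "p \<in> U" and c: "c \<in> charts_at A p"
  shows "(f \<circ> chart_inv c has_derivative frechet_derivative (f \<circ> chart_inv c) (at (snd c p))) (at (snd c p))"
  by (rule smooth_on_has_derivative[OF smooth_map_onD[OF f]]) (use p charts_atD[OF c] in auto)

text \<open>Chain rule for the transition map. It is the reason why the definite description in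
  \<open>tderiv\<close> denotes a value and why any chart around \<open>p\<close> may be used to
  compute it.\<close>

lemma frechet_derivative_chart_change:
  assumes f: "smooth_map_on A U f" and U: "open U" and p: "p \<in> U"
    and c: "c \<in> charts_at A p" and d: "d \<in> charts_at A p"
  shows "frechet_derivative (f \<circ> chart_inv c) (at (snd c p)) w =
    frechet_derivative (f \<circ> chart_inv d) (at (snd d p)) (jac c d p w)"
proof -
  note m = charts_atD[OF c] charts_atD[OF d]
  have "snd d p = (snd d \<circ> chart_inv c) (snd c p)" using m by simp
  with diff_chain_at[OF transition_has_derivative[OF c d]] smooth_map_has_derivative[OF f p d]
  have "((f \<circ> chart_inv d) \<circ> (snd d \<circ> chart_inv c) has_derivative
      frechet_derivative (f \<circ> chart_inv d) (at (snd d p)) \<circ> jac c d p) (at (snd c p))"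
    by metis
  then have "(f \<circ> chart_inv c has_derivative
      frechet_derivative (f \<circ> chart_inv d) (at (snd d p)) \<circ> jac c d p) (at (snd c p))"
    by (rule has_derivative_transform_within_open[OF _ overlap_open[of c d]])
      (use m in auto)
  from has_derivative_unique[OF smooth_map_has_derivative[OF f p c] this] show ?thesis by (metis comp_apply)
qed

lemma tangent_change:
  "v \<in> tangent_space A p \<Longrightarrow> c \<in> charts_at A p \<Longrightarrow> d \<in> charts_at A p \<Longrightarrow> v d = jac c d p (v c)"
  unfolding tangent_space_def jac_def by blast

lemma tangent_outside: "v \<in> tangent_space A p \<Longrightarrow> c \<notin> charts_at A p \<Longrightarrow> v c = 0"
  unfolding tangent_space_def by blast

lemma tangentI:
  assumes "\<And>c d. c \<in> charts_at A p \<Longrightarrow> d \<in> charts_at A p \<Longrightarrow> v d = jac c d p (v c)"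
    and "\<And>c. c \<notin> charts_at A p \<Longrightarrow> v c = 0"
  shows "v \<in> tangent_space A p"
  unfolding tangent_space_def using assms unfolding jac_def by blast

lemma tderiv_eq:
  assumes f: "smooth_map_on A U f" and U: "open U" and p: "p \<in> U"
    and v: "v \<in> tangent_space A p" and c: "c \<in> charts_at A p"
  shows "tderiv A p v f = frechet_derivative (f \<circ> chart_inv c) (at (snd c p)) (v c)"
proof -
  have "frechet_derivative (f \<circ> chart_inv c) (at (snd c p)) (v c) =
      frechet_derivative (f \<circ> chart_inv d) (at (snd d p)) (v d)" if d: "d \<in> charts_at A p" for d
    using frechet_derivative_chart_change[OF f U p c d] tangent_change[OF v c d] by simp
  then show ?thesis unfolding tderiv_def using c by (intro the_equality) blast+
qed

text \<open>Inverse of evaluation at the chart \<open>c\<close>: since a tangent vector is a family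
  over all charts, its components in one chart have to be spread to the others by Jacobians. The
  value 0 on the remaining charts is the normal form that lets tangent vectors be compared as
  functions.\<close>

definition tvec :: "('b, 'n) chart \<Rightarrow> 'b \<Rightarrow> real^'n \<Rightarrow> ('b, 'n) tvec" where
  "tvec c p w = (\<lambda>d. if d \<in> charts_at A p then jac c d p w else 0)"

lemma tvec_in: "c \<in> charts_at A p \<Longrightarrow> tvec c p w \<in> tangent_space A p"
  by (rule tangentI) (simp_all add: tvec_def jac_comp)

lemma tvec_same: "c \<in> charts_at A p \<Longrightarrow> tvec c p w c = w"
  by (simp add: tvec_def jac_self)

lemma tangent_eqI:
  assumes "v \<in> tangent_space A p" "w \<in> tangent_space A p" "c \<in> charts_at A p" "v c = w c"
  shows "v = w"
proof
  fix d show "v d = w d"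
  proof (cases "d \<in> charts_at A p")
    case True
    then show ?thesis
      by (simp add: tangent_change[OF assms(1,3)] tangent_change[OF assms(2,3)] assms(4))
  qed (simp add: tangent_outside[OF assms(1)] tangent_outside[OF assms(2)])
qed

lemma tvec_self: "v \<in> tangent_space A p \<Longrightarrow> c \<in> charts_at A p \<Longrightarrow> tvec c p (v c) = v"
  using tangent_eqI tvec_in tvec_same by metis

lemma coord_field_tvec: "coord_field A c i p = tvec c p (axis i 1)"
  unfolding coord_field_def tvec_def jac_def by (rule refl)

lemma subspace_tangent: "subspace (tangent_space A p)"
  unfolding subspace_def
proof (intro conjI ballI allI)
  show "0 \<in> tangent_space A p"
    by (rule tangentI) (simp_all add: linear_0[OF jac_linear])
  fix v assume v: "v \<in> tangent_space A p"
  fix w assume w: "w \<in> tangent_space A p"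
  show "v + w \<in> tangent_space A p"
  proof (rule tangentI)
    fix c d assume cd: "c \<in> charts_at A p" "d \<in> charts_at A p"
    show "(v + w) d = jac c d p ((v + w) c)"
      by (simp add: linear_add[OF jac_linear[OF cd]] tangent_change[OF v cd] tangent_change[OF w cd])
  qed (simp add: tangent_outside[OF v] tangent_outside[OF w])
next
  fix v assume v: "v \<in> tangent_space A p"
  fix a :: real
  show "a *\<^sub>R v \<in> tangent_space A p"
  proof (rule tangentI)
    fix c d assume cd: "c \<in> charts_at A p" "d \<in> charts_at A p"
    show "(a *\<^sub>R v) d = jac c d p ((a *\<^sub>R v) c)"
      by (simp add: scaleR_fun_def linear_cmul[OF jac_linear[OF cd]] tangent_change[OF v cd])
  qed (simp add: scaleR_fun_def tangent_outside[OF v])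
qed

lemmas tangent_zero [simp] = subspace_0[OF subspace_tangent]
  and tangent_add = subspace_add[OF subspace_tangent]
  and tangent_diff = subspace_diff[OF subspace_tangent]
  and tangent_scale = subspace_scale[OF subspace_tangent]
  and tangent_sum = subspace_sum[OF subspace_tangent]

lemma sum_fun_apply: "(\<Sum>i\<in>I. f i) x = (\<Sum>i\<in>I. f i x)" for f :: "'i \<Rightarrow> 'x \<Rightarrow> 'y::comm_monoid_add"
  by (induction I rule: infinite_finite_induct) auto

lemma scaleR_fun_apply: "(a *\<^sub>R f) x = a *\<^sub>R f x" for f :: "'x \<Rightarrow> 'y::real_vector"
  by (simp add: scaleR_fun_def)

lemma coord_field_in: "c \<in> A \<Longrightarrow> p \<in> fst c \<Longrightarrow> coord_field A c i p \<in> tangent_space A p"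
  by (simp add: coord_field_tvec tvec_in charts_atI)

lemma coord_field_same: "c \<in> A \<Longrightarrow> p \<in> fst c \<Longrightarrow> coord_field A c i p c = axis i 1"
  by (simp add: coord_field_tvec tvec_same charts_atI)

lemma vec_expand: "w = (\<Sum>i\<in>UNIV. (w $ i) *\<^sub>R axis i 1)" for w :: "real^'m"
  using basis_expansion[of w] by (simp add: vector_scalar_mult_def scalar_mult_eq_scaleR)

lemma tangent_expand:
  assumes v: "v \<in> tangent_space A p" and c: "c \<in> A" "p \<in> fst c"
  shows "v = (\<Sum>i\<in>UNIV. (v c $ i) *\<^sub>R coord_field A c i p)"
proof (rule tangent_eqI[OF v _ charts_atI[OF c]])
  show "(\<Sum>i\<in>UNIV. (v c $ i) *\<^sub>R coord_field A c i p) \<in> tangent_space A p"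
    by (intro tangent_sum tangent_scale coord_field_in c)
  show "v c = (\<Sum>i\<in>UNIV. (v c $ i) *\<^sub>R coord_field A c i p) c"
    by (simp add: sum_fun_apply scaleR_fun_apply coord_field_same[OF c] vec_expand[of "v c", symmetric])
qed

lemma tderiv_coord:
  assumes f: "smooth_map_on A U f" "open U" "p \<in> U" and c: "c \<in> A" "p \<in> fst c"
  shows "tderiv A p (coord_field A c i p) f = partial i (f \<circ> chart_inv c) (snd c p)"
  by (simp add: tderiv_eq[OF f coord_field_in[OF c] charts_atI[OF c]] coord_field_same[OF c] partial_def)

lemma tderiv_cong:
  assumes f: "smooth_map_on A U f" and U: "open U" and p: "p \<in> U" and v: "v \<in> tangent_space A p"
    and eq: "\<And>q. q \<in> U \<Longrightarrow> f q = g q"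
  shows "tderiv A p v f = tderiv A p v g"
proof -
  have g: "smooth_map_on A U g" using smooth_map_on_cong[OF U, of f g] eq f by blast
  obtain c where c: "c \<in> charts_at A p" using charts_at_ex by blast
  have "frechet_derivative (f \<circ> chart_inv c) (at (snd c p)) = frechet_derivative (g \<circ> chart_inv c) (at (snd c p))"
    by (rule frechet_derivative_transform_within_open[OF _ chart_image_open[OF charts_atD(1)[OF c] U]])
      (use smooth_map_has_derivative[OF f p c] charts_atD[OF c] p eq
        in \<open>auto simp: differentiable_def\<close>)
  then show ?thesis using tderiv_eq[OF f U p v c] tderiv_eq[OF g U p v c] by simp
qed

lemma tderiv_const [simp]: "v \<in> tangent_space A p \<Longrightarrow> tderiv A p v (\<lambda>q. a) = 0"
proof -
  assume v: "v \<in> tangent_space A p"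
  obtain c where c: "c \<in> charts_at A p" using charts_at_ex by blast
  show ?thesis using tderiv_eq[OF smooth_map_on_const open_UNIV UNIV_I v c, of a] by (simp add: o_def)
qed

lemma tderiv_add:
  assumes f: "smooth_map_on A U f" and g: "smooth_map_on A U g" and U: "open U" "p \<in> U"
    and v: "v \<in> tangent_space A p"
  shows "tderiv A p v (\<lambda>q. f q + g q) = tderiv A p v f + tderiv A p v g"
proof -
  obtain c where c: "c \<in> charts_at A p" using charts_at_ex by blast
  have "frechet_derivative ((\<lambda>q. f q + g q) \<circ> chart_inv c) (at (snd c p)) =
    (\<lambda>w. frechet_derivative (f \<circ> chart_inv c) (at (snd c p)) w + frechet_derivative (g \<circ> chart_inv c) (at (snd c p)) w)"
    using has_derivative_add[OF smooth_map_has_derivative[OF f U(2) c] smooth_map_has_derivative[OF g U(2) c]]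
    by (intro frechet_derivative_at[symmetric]) (simp add: o_def)
  then show ?thesis
    using tderiv_eq[OF f U v c] tderiv_eq[OF g U v c] tderiv_eq[OF smooth_map_on_add[OF U(1) f g] U v c] by simp
qed

lemma tderiv_sum:
  assumes f: "\<And>i. i \<in> I \<Longrightarrow> smooth_map_on A U (f i)" and U: "open U" "p \<in> U"
    and v: "v \<in> tangent_space A p"
  shows "tderiv A p v (\<lambda>q. \<Sum>i\<in>I. f i q) = (\<Sum>i\<in>I. tderiv A p v (f i))"
  using f
proof (induction I rule: infinite_finite_induct)
  case (insert i I)
  then show ?case
    using tderiv_add[OF _ smooth_map_on_sum[OF U(1), of I f] U v, of "f i"] by simp
qed (simp_all add: v)

lemma tderiv_mult:
  assumes f: "smooth_map_on A U f" and g: "smooth_map_on A U g" and U: "open U" "p \<in> U"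
    and v: "v \<in> tangent_space A p"
  shows "tderiv A p v (\<lambda>q. f q * g q) = f p * tderiv A p v g + tderiv A p v f * g p"
proof -
  obtain c where c: "c \<in> charts_at A p" using charts_at_ex by blast
  have "frechet_derivative ((\<lambda>q. f q * g q) \<circ> chart_inv c) (at (snd c p)) =
    (\<lambda>w. f p * frechet_derivative (g \<circ> chart_inv c) (at (snd c p)) w +
      frechet_derivative (f \<circ> chart_inv c) (at (snd c p)) w * g p)"
    using has_derivative_mult[OF smooth_map_has_derivative[OF f U(2) c] smooth_map_has_derivative[OF g U(2) c]]
      charts_atD[OF c]
    by (intro frechet_derivative_at[symmetric]) (simp add: o_def)
  then show ?thesis
    using tderiv_eq[OF f U v c] tderiv_eq[OF g U v c] tderiv_eq[OF smooth_map_on_mult[OF U(1) f g] U v c] by simp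
qed

lemma tderiv_expand:
  assumes f: "smooth_map_on A U f" "open U" "p \<in> U" and v: "v \<in> tangent_space A p"
    and c: "c \<in> A" "p \<in> fst c"
  shows "tderiv A p v f = (\<Sum>i\<in>UNIV. v c $ i * partial i (f \<circ> chart_inv c) (snd c p))"
proof -
  have "linear (frechet_derivative (f \<circ> chart_inv c) (at (snd c p)))"
    using smooth_map_has_derivative[OF f(1,3) charts_atI[OF c]] has_derivative_linear by blast
  then have "frechet_derivative (f \<circ> chart_inv c) (at (snd c p)) (\<Sum>i\<in>UNIV. (v c $ i) *\<^sub>R axis i 1) =
    (\<Sum>i\<in>UNIV. v c $ i * frechet_derivative (f \<circ> chart_inv c) (at (snd c p)) (axis i 1))"
    by (simp add: linear_sum linear_cmul)
  then show ?thesis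
    using tderiv_eq[OF f v charts_atI[OF c]] vec_expand[of "v c"] by (simp add: partial_def)
qed

lemma smooth_map_on_frechet_derivative:
  assumes f: "smooth_map_on A U f" and U: "open U" "U \<subseteq> fst c" and c: "c \<in> A"
  shows "smooth_map_on A U (\<lambda>p. frechet_derivative (f \<circ> chart_inv c) (at (snd c p)) w)"
  using smooth_on_frechet_derivative[OF smooth_map_onD[OF f c], of w] U
  by (intro smooth_map_on_pullback[OF c U, where g="\<lambda>x. frechet_derivative (f \<circ> chart_inv c) (at x) w"])
    (simp add: Int_absorb2)

lemma smooth_map_on_partial:
  assumes "smooth_map_on A U f" "open U" "U \<subseteq> fst c" "c \<in> A"
  shows "smooth_map_on A U (\<lambda>p. partial i (f \<circ> chart_inv c) (snd c p))"
  unfolding partial_def using smooth_map_on_frechet_derivative[OF assms] .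

lemma smooth_map_on_jac:
  assumes c: "c \<in> A" and d: "d \<in> A"
  shows "smooth_map_on A (fst c \<inter> fst d) (\<lambda>p. jac c d p w)"
  unfolding jac_def
  by (rule smooth_map_on_frechet_derivative)
    (auto intro: smooth_map_on_subset[OF smooth_map_on_coord[OF d]] simp: chart_dom_open c d open_Int)


subsection \<open>Vector fields\<close>

lemma vector_field_iff:
  "vector_field A U X \<longleftrightarrow> open U \<and> (\<forall>p\<in>U. X p \<in> tangent_space A p) \<and>
    (\<forall>c\<in>A. smooth_map_on A (U \<inter> fst c) (\<lambda>p. X p c))"
  by (auto simp: smooth_section_def tangent_bundle_def)

lemma vector_fieldD:
  assumes "vector_field A U X"
  shows "open U" "p \<in> U \<Longrightarrow> X p \<in> tangent_space A p" "c \<in> A \<Longrightarrow> smooth_map_on A (U \<inter> fst c) (\<lambda>p. X p c)"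
  using assms by (auto simp: vector_field_iff)

lemma vector_field_component:
  "vector_field A U X \<Longrightarrow> c \<in> A \<Longrightarrow> U \<subseteq> fst c \<Longrightarrow> smooth_map_on A U (\<lambda>p. X p c $ i)"
  using vector_fieldD(3)[of U X c] smooth_map_on_vec_iff[of U "\<lambda>p. X p c"] vector_fieldD(1)
  by (simp add: Int_absorb2)

text \<open>The components in any chart \<open>d\<close> are combinations of the columns of the
  Jacobian, with the components in \<open>c\<close> as coefficients. One suitable chart near each
  point thus replaces the check in all charts.\<close>

lemma vector_field_localI:
  assumes U: "open U" and "\<And>p. p \<in> U \<Longrightarrow> X p \<in> tangent_space A p"
    and loc: "\<And>p. p \<in> U \<Longrightarrow> \<exists>c V. c \<in> A \<and> open V \<and> p \<in> V \<and> V \<subseteq> fst c \<and> smooth_map_on A V (\<lambda>p. X p c)"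
  shows "vector_field A U X"
  unfolding vector_field_iff
proof (intro conjI ballI)
  fix d assume d: "d \<in> A"
  show "smooth_map_on A (U \<inter> fst d) (\<lambda>p. X p d)"
  proof (rule smooth_map_on_local)
    fix p assume p: "p \<in> U \<inter> fst d"
    then obtain c V where cV: "c \<in> A" "open V" "p \<in> V" "V \<subseteq> fst c" "smooth_map_on A V (\<lambda>p. X p c)"
      using loc by blast
    let ?W = "U \<inter> fst d \<inter> V"
    have W: "open ?W" using U cV d chart_dom_open by (intro open_Int)
    have "smooth_map_on A ?W (\<lambda>q. \<Sum>i\<in>UNIV. (X q c $ i) *\<^sub>R jac c d q (axis i 1))"
    proof (intro smooth_map_on_sum smooth_map_on_scaleR W)
      show "smooth_map_on A ?W (\<lambda>q. X q c $ i)" for i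
        using smooth_map_on_subset[OF cV(5), of ?W] smooth_map_on_vec_iff[OF W, of "\<lambda>q. X q c"] by blast
      show "smooth_map_on A ?W (\<lambda>q. jac c d q (axis i 1))" for i
        using smooth_map_on_subset[OF smooth_map_on_jac[OF cV(1) d], of ?W] cV by blast
    qed
    moreover have "(\<Sum>i\<in>UNIV. (X q c $ i) *\<^sub>R jac c d q (axis i 1)) = X q d" if q: "q \<in> ?W" for q
    proof -
      have cd: "c \<in> charts_at A q" "d \<in> charts_at A q" using cV d q by (auto intro: charts_atI)
      have "X q d = jac c d q (\<Sum>i\<in>UNIV. (X q c $ i) *\<^sub>R axis i 1)"
        using tangent_change[OF assms(2)[of q] cd] q vec_expand[of "X q c"] by simp
      then show ?thesis using jac_linear[OF cd] by (simp add: linear_sum linear_cmul)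
    qed
    ultimately have "smooth_map_on A ?W (\<lambda>q. X q d)" by (rule smooth_map_on_transform[OF _ W])
    then show "\<exists>V. open V \<and> p \<in> V \<and> smooth_map_on A V (\<lambda>q. X q d)" using W p cV by blast
  qed
qed (use assms in auto)

lemma vector_field_chartI:
  assumes "open U" "c \<in> A" "U \<subseteq> fst c" "\<And>p. p \<in> U \<Longrightarrow> X p \<in> tangent_space A p"
    "smooth_map_on A U (\<lambda>p. X p c)"
  shows "vector_field A U X"
  using assms by (intro vector_field_localI) blast+

lemma vector_field_subset: "vector_field A U X \<Longrightarrow> open V \<Longrightarrow> V \<subseteq> U \<Longrightarrow> vector_field A V X"
  unfolding vector_field_iff by (meson Int_mono order_refl smooth_map_on_subset subsetD)

lemma tvec_vector_field: "c \<in> A \<Longrightarrow> vector_field A (fst c) (\<lambda>p. tvec c p w)"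
  by (rule vector_field_chartI[of _ c])
    (auto simp: chart_dom_open tvec_in tvec_same charts_atI cong: smooth_map_on_cong)

lemma coord_vector_field: "c \<in> A \<Longrightarrow> vector_field A (fst c) (coord_field A c i)"
  using tvec_vector_field[of c "axis i 1"] by (simp add: coord_field_tvec[abs_def])

lemma tderiv_smooth:
  assumes f: "smooth_map_on A U f" and X: "vector_field A U X"
  shows "smooth_map_on A U (\<lambda>p. tderiv A p (X p) f)"
proof (rule smooth_map_on_local)
  fix p assume p: "p \<in> U"
  obtain c where c: "c \<in> A" "p \<in> fst c" using charts_at_ex[of p] charts_atD by blast
  let ?W = "U \<inter> fst c"
  have W: "open ?W" using vector_fieldD(1)[OF X] chart_dom_open c by blast
  have "smooth_map_on A ?W (\<lambda>q. \<Sum>i\<in>UNIV. X q c $ i * partial i (f \<circ> chart_inv c) (snd c q))"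
    using vector_field_component[OF vector_field_subset[OF X W] c(1)]
    by (intro smooth_map_on_sum smooth_map_on_mult W smooth_map_on_partial smooth_map_on_subset[OF f] c) auto
  moreover have "(\<Sum>i\<in>UNIV. X q c $ i * partial i (f \<circ> chart_inv c) (snd c q)) = tderiv A q (X q) f" if "q \<in> ?W" for q
    using tderiv_expand[OF f vector_fieldD(1)[OF X] _ vector_fieldD(2)[OF X] c(1), of q] that by simp
  ultimately have "smooth_map_on A ?W (\<lambda>q. tderiv A q (X q) f)" by (rule smooth_map_on_transform[OF _ W])
  then show "\<exists>V. open V \<and> p \<in> V \<and> smooth_map_on A V (\<lambda>q. tderiv A q (X q) f)" using W p c by blast
qed

end


section \<open>Vector bundles\<close>

lemma los_comb:
  "linear_on_subspace S f \<Longrightarrow> x \<in> S \<Longrightarrow> y \<in> S \<Longrightarrow> f (a *\<^sub>R x + b *\<^sub>R y) = a *\<^sub>R f x + b *\<^sub>R f y"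
  by (simp add: linear_on_subspace_def)

lemma los_add: "linear_on_subspace S f \<Longrightarrow> x \<in> S \<Longrightarrow> y \<in> S \<Longrightarrow> f (x + y) = f x + f y"
  using los_comb[of S f x y 1 1] by simp

lemma los_scale: "linear_on_subspace S f \<Longrightarrow> x \<in> S \<Longrightarrow> f (a *\<^sub>R x) = a *\<^sub>R f x"
  using los_comb[of S f x x a 0] by simp

lemma los_diff: "linear_on_subspace S f \<Longrightarrow> x \<in> S \<Longrightarrow> y \<in> S \<Longrightarrow> f (x - y) = f x - f y"
  using los_comb[of S f x y 1 "-1"] by simp

lemma los_zero: "linear_on_subspace S f \<Longrightarrow> subspace S \<Longrightarrow> f 0 = 0"
  using los_scale[of S f 0 0] by (simp add: subspace_0)

lemma los_sum:
  "linear_on_subspace S f \<Longrightarrow> subspace S \<Longrightarrow> (\<And>i. i \<in> I \<Longrightarrow> x i \<in> S) \<Longrightarrow> f (\<Sum>i\<in>I. x i) = (\<Sum>i\<in>I. f (x i))"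
  by (induction I rule: infinite_finite_induct) (simp_all add: los_zero los_add subspace_sum)

lemma los_lincomb:
  "linear_on_subspace S f \<Longrightarrow> subspace S \<Longrightarrow> (\<And>i. i \<in> I \<Longrightarrow> x i \<in> S) \<Longrightarrow>
    f (\<Sum>i\<in>I. a i *\<^sub>R x i) = (\<Sum>i\<in>I. a i *\<^sub>R f (x i))"
  by (simp add: los_sum los_scale subspace_scale)

lemma los_cong:
  "linear_on_subspace S f \<Longrightarrow> subspace S \<Longrightarrow> (\<And>x. x \<in> S \<Longrightarrow> f x = g x) \<Longrightarrow> linear_on_subspace S g"
  unfolding linear_on_subspace_def by (metis subspace_add subspace_scale)

lemma los_inv:
  assumes f: "linear_on_subspace S f" "subspace S" and bij: "bij_betw f S T"
  shows "linear_on_subspace T (inv_into S f)"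
  unfolding linear_on_subspace_def
proof (intro ballI allI)
  fix x y a b assume xy: "x \<in> T" "y \<in> T"
  let ?g = "inv_into S f"
  have g: "?g x \<in> S" "?g y \<in> S" "f (?g x) = x" "f (?g y) = y"
    using xy bij by (auto simp: bij_betw_def inv_into_into f_inv_into_f)
  then have "f (a *\<^sub>R ?g x + b *\<^sub>R ?g y) = a *\<^sub>R x + b *\<^sub>R y" by (simp add: los_comb[OF f(1)])
  moreover have "a *\<^sub>R ?g x + b *\<^sub>R ?g y \<in> S" using f g by (simp add: subspace_add subspace_scale)
  ultimately show "?g (a *\<^sub>R x + b *\<^sub>R y) = a *\<^sub>R ?g x + b *\<^sub>R ?g y"
    using bij by (metis bij_betw_def inv_into_f_f)
qed

section \<open>Fibrewise inverses\<close>

lemma bundle_inv_in: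
  "(\<And>p. bij_betw (\<Phi> p) (fibre E p) (fibre F p)) \<Longrightarrow> y \<in> fibre F p \<Longrightarrow> bundle_inv E \<Phi> p y \<in> fibre E p"
  and bundle_inv_right:
  "(\<And>p. bij_betw (\<Phi> p) (fibre E p) (fibre F p)) \<Longrightarrow> y \<in> fibre F p \<Longrightarrow> \<Phi> p (bundle_inv E \<Phi> p y) = y"
  and bundle_inv_left:
  "(\<And>p. bij_betw (\<Phi> p) (fibre E p) (fibre F p)) \<Longrightarrow> x \<in> fibre E p \<Longrightarrow> bundle_inv E \<Phi> p (\<Phi> p x) = x"
  unfolding bundle_inv_def bij_betw_def by (auto simp: inv_into_into f_inv_into_f)

lemma bundle_inv_unique:
  assumes "\<And>p. bij_betw (\<Phi> p) (fibre E p) (fibre F p)" "x \<in> fibre E p" "\<Phi> p x = y"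
  shows "bundle_inv E \<Phi> p y = x"
  using bundle_inv_left[OF assms(1,2)] assms(3) by simp

lemma bundle_inv_cong:
  assumes "\<And>p x. x \<in> fibre E p \<Longrightarrow> \<Phi> p x = \<Psi> p x"
  shows "bundle_inv E \<Phi> = bundle_inv E \<Psi>"
proof (intro ext)
  fix p y
  show "bundle_inv E \<Phi> p y = bundle_inv E \<Psi> p y"
    unfolding bundle_inv_def inv_into_def using assms by metis
qed

lemma conn_eqD:
  "conn_eq A E n n' \<Longrightarrow> smooth_section A E U s \<Longrightarrow> p \<in> U \<Longrightarrow> v \<in> tangent_space A p \<Longrightarrow> n p v s = n' p v s"
  unfolding conn_eq_def by blast

locale smooth_vbundle = smooth_mfd A
  for A :: "('b::{t2_space, second_countable_topology}, 'n::finite) chart set" +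
  fixes E :: "('b, 'h::real_vector, 'f::euclidean_space) vbundle"
  assumes vector_bundle: "vector_bundle A E"
begin

lemma fibre_subspace: "subspace (fibre E p)"
  using vector_bundle unfolding vector_bundle_def by (elim conjE) (erule spec)

lemma triv_ex: "\<exists>U \<tau>. (U, \<tau>) \<in> trivs E \<and> p \<in> U"
proof -
  have "(\<Union>(U, \<tau>)\<in>trivs E. U) = UNIV"
    using vector_bundle unfolding vector_bundle_def by (elim conjE)
  then have "p \<in> (\<Union>(U, \<tau>)\<in>trivs E. U)" by simp
  then show ?thesis by auto
qed

lemma triv_open: "(U, \<tau>) \<in> trivs E \<Longrightarrow> open U"
  and triv_linear: "(U, \<tau>) \<in> trivs E \<Longrightarrow> p \<in> U \<Longrightarrow> linear_on_subspace (fibre E p) (\<tau> p)"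
  and triv_bij: "(U, \<tau>) \<in> trivs E \<Longrightarrow> p \<in> U \<Longrightarrow> bij_betw (\<tau> p) (fibre E p) UNIV"
  using vector_bundle unfolding vector_bundle_def by blast+

lemma triv_transition: "(U, \<tau>) \<in> trivs E \<Longrightarrow> (V, \<sigma>) \<in> trivs E \<Longrightarrow>
    smooth_map_on A (U \<inter> V) (\<lambda>p. \<sigma> p (inv_into (fibre E p) (\<tau> p) w))"
  using vector_bundle unfolding vector_bundle_def by blast

lemma frame_in: "(U, \<tau>) \<in> trivs E \<Longrightarrow> p \<in> U \<Longrightarrow> inv_into (fibre E p) (\<tau> p) w \<in> fibre E p"
  and frame_right: "(U, \<tau>) \<in> trivs E \<Longrightarrow> p \<in> U \<Longrightarrow> \<tau> p (inv_into (fibre E p) (\<tau> p) w) = w"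
  using bij_betw_imp_surj_on[OF triv_bij, of U \<tau> p]
  by (auto intro: inv_into_into f_inv_into_f)

lemma frame_left: "(U, \<tau>) \<in> trivs E \<Longrightarrow> p \<in> U \<Longrightarrow> x \<in> fibre E p \<Longrightarrow> inv_into (fibre E p) (\<tau> p) (\<tau> p x) = x"
  by (rule inv_into_f_f[OF bij_betw_imp_inj_on[OF triv_bij]])

lemma frame_linear:
  assumes "(U, \<tau>) \<in> trivs E" "p \<in> U"
  shows "linear (inv_into (fibre E p) (\<tau> p))"
  using los_inv[OF triv_linear[OF assms] fibre_subspace triv_bij[OF assms]]
  by (intro linearI) (simp_all add: los_add los_scale)

lemma fibre_expand:
  assumes "(U, \<tau>) \<in> trivs E" "p \<in> U" "x \<in> fibre E p"
  shows "x = (\<Sum>b\<in>Basis. (\<tau> p x \<bullet> b) *\<^sub>R inv_into (fibre E p) (\<tau> p) b)"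
  using linear_Basis_expand[OF frame_linear[OF assms(1,2)], of "\<tau> p x"] frame_left[OF assms] by simp

lemma section_open: "smooth_section A E U s \<Longrightarrow> open U"
  and section_in: "smooth_section A E U s \<Longrightarrow> p \<in> U \<Longrightarrow> s p \<in> fibre E p"
  and section_smooth: "smooth_section A E U s \<Longrightarrow> (V, \<tau>) \<in> trivs E \<Longrightarrow> smooth_map_on A (U \<inter> V) (\<lambda>p. \<tau> p (s p))"
  unfolding smooth_section_def by blast+

lemma sectionI:
  assumes "open U" "\<And>p. p \<in> U \<Longrightarrow> s p \<in> fibre E p"
    "\<And>V \<tau>. (V, \<tau>) \<in> trivs E \<Longrightarrow> smooth_map_on A (U \<inter> V) (\<lambda>p. \<tau> p (s p))"
  shows "smooth_section A E U s"
  using assms unfolding smooth_section_def by blast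

lemma section_cong:
  assumes s: "smooth_section A E U s" and eq: "\<And>p. p \<in> U \<Longrightarrow> s p = t p"
  shows "smooth_section A E U t"
proof (rule sectionI[OF section_open[OF s]])
  show "t p \<in> fibre E p" if "p \<in> U" for p using section_in[OF s that] eq[OF that] by simp
  show "smooth_map_on A (U \<inter> V) (\<lambda>p. \<tau> p (t p))" if V: "(V, \<tau>) \<in> trivs E" for V \<tau>
    by (rule smooth_map_on_transform[OF section_smooth[OF s V]])
      (use section_open[OF s] triv_open[OF V] eq in auto)
qed

lemma section_zero: "open U \<Longrightarrow> smooth_section A E U (\<lambda>p. 0)"
proof (rule sectionI)
  fix V \<tau> assume U: "open U" and V: "(V, \<tau>) \<in> trivs E"
  show "smooth_map_on A (U \<inter> V) (\<lambda>p. \<tau> p 0)"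
    by (rule smooth_map_on_transform[OF smooth_map_on_const[of _ 0]])
      (use U triv_open[OF V] los_zero[OF triv_linear[OF V] fibre_subspace] in auto)
qed (simp_all add: subspace_0[OF fibre_subspace])

lemma section_add:
  assumes s: "smooth_section A E U s" and t: "smooth_section A E U t"
  shows "smooth_section A E U (\<lambda>p. s p + t p)"
proof (rule sectionI[OF section_open[OF s]])
  show "s p + t p \<in> fibre E p" if "p \<in> U" for p
    using section_in[OF s that] section_in[OF t that] subspace_add[OF fibre_subspace] by blast
  fix V \<tau> assume V: "(V, \<tau>) \<in> trivs E"
  have W: "open (U \<inter> V)" using section_open[OF s] triv_open[OF V] by blast
  show "smooth_map_on A (U \<inter> V) (\<lambda>p. \<tau> p (s p + t p))"
    by (rule smooth_map_on_transform[OF smooth_map_on_add[OF W section_smooth[OF s V] section_smooth[OF t V]] W])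
      (simp add: los_add[OF triv_linear[OF V]] section_in[OF s] section_in[OF t])
qed

lemma section_scale:
  assumes f: "smooth_map_on A U f" and s: "smooth_section A E U s"
  shows "smooth_section A E U (\<lambda>p. f p *\<^sub>R s p)"
proof (rule sectionI[OF section_open[OF s]])
  show "f p *\<^sub>R s p \<in> fibre E p" if "p \<in> U" for p
    using section_in[OF s that] subspace_scale[OF fibre_subspace] by blast
  fix V \<tau> assume V: "(V, \<tau>) \<in> trivs E"
  have W: "open (U \<inter> V)" using section_open[OF s] triv_open[OF V] by blast
  show "smooth_map_on A (U \<inter> V) (\<lambda>p. \<tau> p (f p *\<^sub>R s p))"
    by (rule smooth_map_on_transform[OF smooth_map_on_scaleR[OF W smooth_map_on_subset[OF f] section_smooth[OF s V]] W])
      (auto simp: los_scale[OF triv_linear[OF V]] section_in[OF s])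
qed

lemma section_sum:
  assumes "open U" "\<And>i. i \<in> I \<Longrightarrow> smooth_section A E U (s i)"
  shows "smooth_section A E U (\<lambda>p. \<Sum>i\<in>I. s i p)"
  using assms by (induction I rule: infinite_finite_induct) (simp_all add: section_zero section_add)

end

lemma bundle_mapD:
  assumes "bundle_map A E F \<Phi>"
  shows "x \<in> fibre E p \<Longrightarrow> \<Phi> p x \<in> fibre F p" "linear_on_subspace (fibre E p) (\<Phi> p)"
    "(U, \<tau>) \<in> trivs E \<Longrightarrow> (V, \<sigma>) \<in> trivs F \<Longrightarrow>
      smooth_map_on A (U \<inter> V) (\<lambda>p. \<sigma> p (\<Phi> p (inv_into (fibre E p) (\<tau> p) w)))"
  using assms unfolding bundle_map_def by blast+

lemma bundle_isoD:
  assumes "bundle_iso A E F \<Phi>"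
  shows "bundle_map A E F \<Phi>" "bij_betw (\<Phi> p) (fibre E p) (fibre F p)" "bundle_map A F E (bundle_inv E \<Phi>)"
  using assms unfolding bundle_iso_def by blast+

locale smooth_vbundle2 = smooth_vbundle A E + F: smooth_vbundle A F
  for A :: "('b::{t2_space, second_countable_topology}, 'n::finite) chart set"
  and E :: "('b, 'h::real_vector, 'f::euclidean_space) vbundle"
  and F :: "('b, 'k::real_vector, 'g::euclidean_space) vbundle"
begin

text \<open>The definition of a bundle map demands smoothness on frame vectors with constant
  coefficients. A general section is expanded over such a frame, and linearity on the fibres leaves
  smooth coefficients times smooth terms.\<close>

lemma section_bundle_map:
  assumes \<Phi>: "bundle_map A E F \<Phi>" and s: "smooth_section A E U s"
  shows "smooth_section A F U (\<lambda>p. \<Phi> p (s p))"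
proof (rule F.sectionI[OF section_open[OF s]])
  show "\<Phi> p (s p) \<in> fibre F p" if "p \<in> U" for p using bundle_mapD(1)[OF \<Phi> section_in[OF s that]] .
  fix V \<sigma> assume V: "(V, \<sigma>) \<in> trivs F"
  show "smooth_map_on A (U \<inter> V) (\<lambda>p. \<sigma> p (\<Phi> p (s p)))"
  proof (rule smooth_map_on_local)
    fix p assume p: "p \<in> U \<inter> V"
    obtain W \<tau> where W: "(W, \<tau>) \<in> trivs E" "p \<in> W" using triv_ex by blast
    let ?X = "U \<inter> W \<inter> V"
    have X: "open ?X" using section_open[OF s] triv_open[OF W(1)] F.triv_open[OF V] by blast
    have "smooth_map_on A ?X (\<lambda>p. \<Sum>b\<in>Basis. (\<tau> p (s p) \<bullet> b) *\<^sub>R \<sigma> p (\<Phi> p (inv_into (fibre E p) (\<tau> p) b)))"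
    proof (intro smooth_map_on_sum smooth_map_on_scaleR X)
      fix b :: 'f
      show "smooth_map_on A ?X (\<lambda>p. \<tau> p (s p) \<bullet> b)"
        by (rule smooth_map_on_bounded_linear[OF bounded_linear_inner_left X
              smooth_map_on_subset[OF section_smooth[OF s W(1)]]]) auto
      show "smooth_map_on A ?X (\<lambda>p. \<sigma> p (\<Phi> p (inv_into (fibre E p) (\<tau> p) b)))"
        by (rule smooth_map_on_subset[OF bundle_mapD(3)[OF \<Phi> W(1) V]]) auto
    qed
    then have "smooth_map_on A ?X (\<lambda>p. \<sigma> p (\<Phi> p (s p)))"
    proof (rule smooth_map_on_transform[OF _ X])
      fix q assume q: "q \<in> ?X"
      have fr: "inv_into (fibre E q) (\<tau> q) b \<in> fibre E q" for b using frame_in[OF W(1)] q by blast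
      have "\<Phi> q (s q) = \<Phi> q (\<Sum>b\<in>Basis. (\<tau> q (s q) \<bullet> b) *\<^sub>R inv_into (fibre E q) (\<tau> q) b)"
        using fibre_expand[OF W(1) _ section_in[OF s]] q by simp
      also have "\<dots> = (\<Sum>b\<in>Basis. (\<tau> q (s q) \<bullet> b) *\<^sub>R \<Phi> q (inv_into (fibre E q) (\<tau> q) b))"
        by (rule los_lincomb[OF bundle_mapD(2)[OF \<Phi>] fibre_subspace fr])
      finally show "(\<Sum>b\<in>Basis. (\<tau> q (s q) \<bullet> b) *\<^sub>R \<sigma> q (\<Phi> q (inv_into (fibre E q) (\<tau> q) b))) = \<sigma> q (\<Phi> q (s q))"
        using los_lincomb[OF F.triv_linear[OF V, of q] F.fibre_subspace,
            where x="\<lambda>b. \<Phi> q (inv_into (fibre E q) (\<tau> q) b)"] bundle_mapD(1)[OF \<Phi> fr] q by simp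
    qed
    then show "\<exists>V. open V \<and> p \<in> V \<and> smooth_map_on A V (\<lambda>p. \<sigma> p (\<Phi> p (s p)))" using X p W by blast
  qed
qed

lemma bundle_map_cong:
  assumes \<Phi>: "bundle_map A E F \<Phi>" and eq: "\<And>p x. x \<in> fibre E p \<Longrightarrow> \<Phi> p x = \<Psi> p x"
  shows "bundle_map A E F \<Psi>"
  unfolding bundle_map_def
proof (intro conjI allI; (intro ballI)?; clarify?)
  fix p
  show "\<Psi> p x \<in> fibre F p" if "x \<in> fibre E p" for x using bundle_mapD(1)[OF \<Phi> that] eq[OF that] by simp
  show "linear_on_subspace (fibre E p) (\<Psi> p)"
    using los_cong[OF bundle_mapD(2)[OF \<Phi>] fibre_subspace eq] .
next
  fix U \<tau> V \<sigma> w assume U: "(U, \<tau>) \<in> trivs E" and V: "(V, \<sigma>) \<in> trivs F"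
  show "smooth_map_on A (U \<inter> V) (\<lambda>p. \<sigma> p (\<Psi> p (inv_into (fibre E p) (\<tau> p) w)))"
    by (rule smooth_map_on_transform[OF bundle_mapD(3)[OF \<Phi> U V]])
      (use triv_open[OF U] F.triv_open[OF V] eq[OF frame_in[OF U]] in auto)
qed

text \<open>The inverse of \<open>bundle_inv E \<Phi>\<close> agrees with \<open>\<Phi>\<close> on
  the fibres, while \<open>inv_into\<close> is arbitrary elsewhere; \<open>bundle_map_cong\<close>
  bridges the difference.\<close>

lemma bundle_iso_sym:
  assumes \<Phi>: "bundle_iso A E F \<Phi>"
  shows "bundle_iso A F E (bundle_inv E \<Phi>)"
proof -
  note bij = bundle_isoD(2)[OF \<Phi>]
  have bij': "bij_betw (bundle_inv E \<Phi> p) (fibre F p) (fibre E p)" for p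
    unfolding bundle_inv_def using bij bij_betw_inv_into by blast
  have "bundle_map A E F (bundle_inv F (bundle_inv E \<Phi>))"
    by (rule bundle_map_cong[OF bundle_isoD(1)[OF \<Phi>]])
      (rule bundle_inv_unique[symmetric, OF bij'], auto simp: bundle_inv_left[OF bij] bundle_mapD(1)[OF bundle_isoD(1)[OF \<Phi>]])
  then show ?thesis unfolding bundle_iso_def using bundle_isoD[OF \<Phi>] bij' by blast
qed

lemma bundle_inv_bundle_inv:
  assumes \<Phi>: "bundle_iso A E F \<Phi>" and x: "x \<in> fibre E p"
  shows "bundle_inv F (bundle_inv E \<Phi>) p x = \<Phi> p x"
proof (rule bundle_inv_unique)
  show "bij_betw (bundle_inv E \<Phi> q) (fibre F q) (fibre E q)" for q
    unfolding bundle_inv_def using bundle_isoD(2)[OF \<Phi>] bij_betw_inv_into by blast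
qed (use x bundle_mapD(1)[OF bundle_isoD(1)[OF \<Phi>]] bundle_inv_left[OF bundle_isoD(2)[OF \<Phi>]] in auto)

end

text \<open>In trivialisations a fibrewise bijective bundle map is a smooth family of invertible
  matrices, and Cramer's rule makes the inverse smooth. Model fibres \<open>real^'m\<close> with the
  same \<open>'m\<close> on both sides keep the matrices square.\<close>

lemma (in smooth_mfd) bundle_iso_bijI:
  fixes E :: "('b, 'h::real_vector, real^'m) vbundle" and F :: "('b, 'k::real_vector, real^'m) vbundle"
  assumes "vector_bundle A E" "vector_bundle A F"
    and \<Phi>: "bundle_map A E F \<Phi>" and bij: "\<And>p. bij_betw (\<Phi> p) (fibre E p) (fibre F p)"
  shows "bundle_iso A E F \<Phi>"
proof -
  interpret smooth_vbundle2 A E F using assms by unfold_locales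
  have "bundle_map A F E (bundle_inv E \<Phi>)"
    unfolding bundle_map_def
  proof (intro conjI allI; (intro ballI)?; clarify?)
    fix p
    show "bundle_inv E \<Phi> p y \<in> fibre E p" if "y \<in> fibre F p" for y using bundle_inv_in[OF bij that] .
    show "linear_on_subspace (fibre F p) (bundle_inv E \<Phi> p)"
      using los_inv[OF bundle_mapD(2)[OF \<Phi>] fibre_subspace bij, of p] by (simp add: bundle_inv_def[abs_def])
  next
    fix V \<sigma> U \<tau> w assume V: "(V, \<sigma>) \<in> trivs F" and U: "(U, \<tau>) \<in> trivs E"
    define h where "h p x = \<sigma> p (\<Phi> p (inv_into (fibre E p) (\<tau> p) x))" for p x
    have h: "linear (h p)" "bij (h p)" if p: "p \<in> U \<inter> V" for p
    proof -
      note fr = frame_in[OF U, of p]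
      show "linear (h p)"
        using p fr linear_add[OF frame_linear[OF U]] linear_cmul[OF frame_linear[OF U]]
        by (intro linearI) (simp_all add: h_def los_add[OF bundle_mapD(2)[OF \<Phi>]] los_scale[OF bundle_mapD(2)[OF \<Phi>]]
            los_add[OF F.triv_linear[OF V]] los_scale[OF F.triv_linear[OF V]] bundle_mapD(1)[OF \<Phi>])
      have "bij_betw (\<sigma> p \<circ> \<Phi> p \<circ> inv_into (fibre E p) (\<tau> p)) UNIV UNIV"
        using p triv_bij[OF U] F.triv_bij[OF V] bij bij_betw_inv_into by (blast intro: bij_betw_trans)
      then show "bij (h p)" by (simp add: h_def[abs_def] o_def)
    qed
    have W: "open (V \<inter> U)" using triv_open[OF U] F.triv_open[OF V] by blast
    show "smooth_map_on A (V \<inter> U) (\<lambda>p. \<tau> p (bundle_inv E \<Phi> p (inv_into (fibre F p) (\<sigma> p) w)))"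
    proof (rule smooth_map_on_solution[OF W, where M="\<lambda>p. matrix (h p)" and b="\<lambda>p. w"])
      show "smooth_map_on A (V \<inter> U) (\<lambda>p. matrix (h p) $ i $ j)" for i j
        using smooth_map_on_vec_iff[OF W, THEN iffD1, rule_format,
            OF smooth_map_on_subset[OF bundle_mapD(3)[OF \<Phi> U V, of "axis j 1"]]] by (simp add: matrix_def h_def Int_commute)
      show "det (matrix (h p)) \<noteq> 0" if "p \<in> V \<inter> U" for p
        using det_matrix_nz_iff_bij h[of p] that by blast
      fix p assume p: "p \<in> V \<inter> U"
      have y: "inv_into (fibre F p) (\<sigma> p) w \<in> fibre F p" using F.frame_in[OF V] p by blast
      have "h p (\<tau> p (bundle_inv E \<Phi> p (inv_into (fibre F p) (\<sigma> p) w))) = w"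
        unfolding h_def using p bundle_inv_in[OF bij y] bundle_inv_right[OF bij y] F.frame_right[OF V]
        by (simp add: frame_left[OF U])
      then show "matrix (h p) *v \<tau> p (bundle_inv E \<Phi> p (inv_into (fibre F p) (\<sigma> p) w)) = w"
        using h[of p] p by (simp add: matrix_works)
    qed simp
  qed
  then show ?thesis unfolding bundle_iso_def using \<Phi> bij by blast
qed


section \<open>Connections\<close>

locale conn_vbundle = smooth_vbundle A E
  for A :: "('b::{t2_space, second_countable_topology}, 'n::finite) chart set"
  and E :: "('b, 'h::real_vector, 'f::euclidean_space) vbundle" +
  fixes nabla :: "('b, 'n, 'h) conn"
  assumes connection: "connection A E nabla"
begin

lemmas conn_rules = connection[unfolded connection_def]

lemma conn_in:
  "smooth_section A E U s \<Longrightarrow> p \<in> U \<Longrightarrow> v \<in> tangent_space A p \<Longrightarrow> nabla p v s \<in> fibre E p"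
  by (rule conn_rules[THEN conjunct1, rule_format], intro conjI)

lemma conn_cong:
  assumes "smooth_section A E U s" "smooth_section A E U t" "\<And>q. q \<in> U \<Longrightarrow> s q = t q" "p \<in> U"
    "v \<in> tangent_space A p"
  shows "nabla p v s = nabla p v t"
  by (rule conn_rules[THEN conjunct2, THEN conjunct1, rule_format, of U]) (use assms in blast)

text \<open>The form used for rewriting under a covariant derivative: smoothness of the rewritten
  section is derived from that of the original one by \<open>section_cong\<close>.\<close>

lemma conn_cong':
  "smooth_section A E U s \<Longrightarrow> (\<And>q. q \<in> U \<Longrightarrow> s q = t q) \<Longrightarrow> p \<in> U \<Longrightarrow>
    v \<in> tangent_space A p \<Longrightarrow> nabla p v s = nabla p v t"
  using conn_cong section_cong by blast

lemma conn_linear: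
  "smooth_section A E U s \<Longrightarrow> p \<in> U \<Longrightarrow> linear_on_subspace (tangent_space A p) (\<lambda>v. nabla p v s)"
  by (rule conn_rules[THEN conjunct2, THEN conjunct2, THEN conjunct1, rule_format], intro conjI)

lemma conn_add:
  "smooth_section A E U s \<Longrightarrow> smooth_section A E U t \<Longrightarrow> p \<in> U \<Longrightarrow> v \<in> tangent_space A p \<Longrightarrow>
    nabla p v (\<lambda>q. s q + t q) = nabla p v s + nabla p v t"
  by (rule conn_rules[THEN conjunct2, THEN conjunct2, THEN conjunct2, THEN conjunct1, rule_format, of U], intro conjI)

lemma conn_scale:
  "smooth_map_on A U f \<Longrightarrow> smooth_section A E U s \<Longrightarrow> p \<in> U \<Longrightarrow> v \<in> tangent_space A p \<Longrightarrow>
    nabla p v (\<lambda>q. f q *\<^sub>R s q) = tderiv A p v f *\<^sub>R s p + f p *\<^sub>R nabla p v s"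
  by (rule conn_rules[THEN conjunct2, THEN conjunct2, THEN conjunct2, THEN conjunct2, THEN conjunct1, rule_format, of U],
      intro conjI)

lemma conn_smooth:
  "vector_field A U Z \<Longrightarrow> smooth_section A E U s \<Longrightarrow> smooth_section A E U (\<lambda>p. nabla p (Z p) s)"
  by (rule conn_rules[THEN conjunct2, THEN conjunct2, THEN conjunct2, THEN conjunct2, THEN conjunct2, rule_format], intro conjI)

lemma conn_zero: "p \<in> U \<Longrightarrow> open U \<Longrightarrow> v \<in> tangent_space A p \<Longrightarrow> nabla p v (\<lambda>q. 0) = 0"
  using conn_scale[OF smooth_map_on_const[of _ 0] section_zero, of U p v] by simp

lemma conn_sum:
  assumes "\<And>i. i \<in> I \<Longrightarrow> smooth_section A E U (s i)" "open U" "p \<in> U" "v \<in> tangent_space A p"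
  shows "nabla p v (\<lambda>q. \<Sum>i\<in>I. s i q) = (\<Sum>i\<in>I. nabla p v (s i))"
  using assms
proof (induction I rule: infinite_finite_induct)
  case (insert i I)
  then show ?case using conn_add[OF _ section_sum[of U I s], of "s i" p v] by simp
qed (simp_all add: conn_zero)

lemma conn_lincomb:
  assumes "\<And>i. i \<in> I \<Longrightarrow> smooth_map_on A U (f i)" "\<And>i. i \<in> I \<Longrightarrow> smooth_section A E U (s i)"
    "open U" "p \<in> U" "v \<in> tangent_space A p"
  shows "nabla p v (\<lambda>q. \<Sum>i\<in>I. f i q *\<^sub>R s i q) =
    (\<Sum>i\<in>I. tderiv A p v (f i) *\<^sub>R s i p + f i p *\<^sub>R nabla p v (s i))"
  using assms by (subst conn_sum[of _ U]) (auto intro!: section_scale sum.cong conn_scale)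

end

context smooth_vbundle2
begin

lemma swap: "smooth_vbundle2 A F E"
  by unfold_locales

lemma transport_section:
  "bundle_iso A E F \<Phi> \<Longrightarrow> smooth_section A F U s \<Longrightarrow> smooth_section A E U (\<lambda>q. bundle_inv E \<Phi> q (s q))"
  using smooth_vbundle2.section_bundle_map[OF swap bundle_isoD(3)] .

text \<open>Conjugation by \<open>\<Phi>\<close> preserves each axiom. Linearity of the inverse is
  available on fibres, so inverses of sums and multiples are rewritten pointwise on
  \<open>U\<close>, and the locality axiom carries this through \<open>nabla\<close>.\<close>

lemma transport_connection:
  assumes \<Phi>: "bundle_iso A E F \<Phi>" and nabla: "connection A E nabla"
  shows "connection A F (transport_conn E \<Phi> nabla)"
proof -
  interpret conn_vbundle A E nabla by unfold_locales (rule nabla)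
  note bij = bundle_isoD(2)[OF \<Phi>] and map = bundle_isoD(1)[OF \<Phi>] and inv = bundle_isoD(3)[OF \<Phi>]
  note ts = transport_section[OF \<Phi>]
  let ?i = "bundle_inv E \<Phi>"
  show ?thesis
    unfolding connection_def transport_conn_def
  proof (intro conjI allI impI; (elim conjE)?)
    fix U s p v assume s: "smooth_section A F U s" and p: "p \<in> U" and v: "v \<in> tangent_space A p"
    show "\<Phi> p (nabla p v (\<lambda>q. ?i q (s q))) \<in> fibre F p"
      by (rule bundle_mapD(1)[OF map conn_in[OF ts[OF s] p v]])
  next
    fix U s t p v assume s: "smooth_section A F U s" and t: "smooth_section A F U t"
      and eq: "\<forall>q\<in>U. s q = t q" and p: "p \<in> U" and v: "v \<in> tangent_space A p"
    show "\<Phi> p (nabla p v (\<lambda>q. ?i q (s q))) = \<Phi> p (nabla p v (\<lambda>q. ?i q (t q)))"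
      by (rule arg_cong[where f="\<Phi> p"], rule conn_cong[OF ts[OF s] ts[OF t] _ p v]) (simp add: eq)
  next
    fix U s p assume s: "smooth_section A F U s" and p: "p \<in> U"
    have "\<Phi> p (nabla p (a *\<^sub>R v + b *\<^sub>R w) (\<lambda>q. ?i q (s q))) =
        a *\<^sub>R \<Phi> p (nabla p v (\<lambda>q. ?i q (s q))) + b *\<^sub>R \<Phi> p (nabla p w (\<lambda>q. ?i q (s q)))"
      if "v \<in> tangent_space A p" "w \<in> tangent_space A p" for a b v w
      by (simp add: los_comb[OF conn_linear[OF ts[OF s] p] that]
          los_comb[OF bundle_mapD(2)[OF map] conn_in[OF ts[OF s] p that(1)] conn_in[OF ts[OF s] p that(2)]])
    then show "linear_on_subspace (tangent_space A p) (\<lambda>v. \<Phi> p (nabla p v (\<lambda>q. ?i q (s q))))"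
      unfolding linear_on_subspace_def by blast
  next
    fix U s t p v assume s: "smooth_section A F U s" and t: "smooth_section A F U t"
      and p: "p \<in> U" and v: "v \<in> tangent_space A p"
    have "nabla p v (\<lambda>q. ?i q (s q + t q)) = nabla p v (\<lambda>q. ?i q (s q) + ?i q (t q))"
      by (rule conn_cong'[OF ts[OF F.section_add[OF s t]] _ p v])
        (simp add: los_add[OF bundle_mapD(2)[OF inv]] F.section_in[OF s] F.section_in[OF t])
    also have "\<dots> = nabla p v (\<lambda>q. ?i q (s q)) + nabla p v (\<lambda>q. ?i q (t q))"
      by (rule conn_add[OF ts[OF s] ts[OF t] p v])
    finally show "\<Phi> p (nabla p v (\<lambda>q. ?i q (s q + t q))) =
        \<Phi> p (nabla p v (\<lambda>q. ?i q (s q))) + \<Phi> p (nabla p v (\<lambda>q. ?i q (t q)))"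
      by (simp add: los_add[OF bundle_mapD(2)[OF map] conn_in[OF ts[OF s] p v] conn_in[OF ts[OF t] p v]])
  next
    fix U and f :: "'b \<Rightarrow> real" and s p v assume f: "smooth_map_on A U f" and s: "smooth_section A F U s"
      and p: "p \<in> U" and v: "v \<in> tangent_space A p"
    have "nabla p v (\<lambda>q. ?i q (f q *\<^sub>R s q)) = nabla p v (\<lambda>q. f q *\<^sub>R ?i q (s q))"
      by (rule conn_cong'[OF ts[OF F.section_scale[OF f s]] _ p v])
        (simp add: los_scale[OF bundle_mapD(2)[OF inv]] F.section_in[OF s])
    also have "\<dots> = tderiv A p v f *\<^sub>R ?i p (s p) + f p *\<^sub>R nabla p v (\<lambda>q. ?i q (s q))"
      by (rule conn_scale[OF f ts[OF s] p v])
    finally show "\<Phi> p (nabla p v (\<lambda>q. ?i q (f q *\<^sub>R s q))) =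
        tderiv A p v f *\<^sub>R s p + f p *\<^sub>R \<Phi> p (nabla p v (\<lambda>q. ?i q (s q)))"
      by (simp add: los_comb[OF bundle_mapD(2)[OF map] section_in[OF ts[OF s] p] conn_in[OF ts[OF s] p v]]
          bundle_inv_right[OF bij F.section_in[OF s p]])
  next
    fix U Z s assume Z: "vector_field A U Z" and s: "smooth_section A F U s"
    show "smooth_section A F U (\<lambda>p. \<Phi> p (nabla p (Z p) (\<lambda>q. ?i q (s q))))"
      by (rule section_bundle_map[OF map conn_smooth[OF Z ts[OF s]]])
  qed
qed

text \<open>The curvature of the transported connection is the image of the original curvature under
  \<open>\<Phi>\<close>. The hypothesis on brackets puts the third curvature term into the fibre,
  where \<open>\<Phi>\<close> is additive; it is later supplied by a torsion-free connection on the
  tangent bundle.\<close>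

lemma transport_flat:
  assumes \<Phi>: "bundle_iso A E F \<Phi>" and nabla: "connection A E nabla" and flat: "flat A E nabla"
    and bracket: "\<And>U X Y p. vector_field A U X \<Longrightarrow> vector_field A U Y \<Longrightarrow> p \<in> U \<Longrightarrow>
      lie_bracket A X Y p \<in> tangent_space A p"
  shows "flat A F (transport_conn E \<Phi> nabla)"
  unfolding flat_def
proof (intro allI impI ballI; elim conjE)
  interpret conn_vbundle A E nabla by unfold_locales (rule nabla)
  note bij = bundle_isoD(2)[OF \<Phi>] and map = bundle_isoD(1)[OF \<Phi>]
  note ts = transport_section[OF \<Phi>]
  fix U X Y s p assume X: "vector_field A U X" and Y: "vector_field A U Y"
    and s: "smooth_section A F U s" and p: "p \<in> U"
  define t where "t q = bundle_inv E \<Phi> q (s q)" for q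
  have t: "smooth_section A E U t" unfolding t_def using ts[OF s] .
  note Xp = vector_fieldD(2)[OF X p] and Yp = vector_fieldD(2)[OF Y p]
  have 1: "transport_conn E \<Phi> nabla p v s = \<Phi> p (nabla p v t)" for p v
    unfolding transport_conn_def t_def[abs_def] by (rule refl)
  have 2: "transport_conn E \<Phi> nabla p v (\<lambda>q. transport_conn E \<Phi> nabla q (Z q) s) =
      \<Phi> p (nabla p v (\<lambda>q. nabla q (Z q) t))"
    if Z: "vector_field A U Z" and v: "v \<in> tangent_space A p" for Z v
    unfolding 1 unfolding transport_conn_def
    by (rule arg_cong[where f="\<Phi> p"], rule conn_cong'[symmetric, OF conn_smooth[OF Z t] _ p v])
      (simp add: bundle_inv_left[OF bij conn_in[OF t _ vector_fieldD(2)[OF Z]]])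
  note in1 = conn_in[OF conn_smooth[OF Y t] p Xp] and in2 = conn_in[OF conn_smooth[OF X t] p Yp]
    and in3 = conn_in[OF t p bracket[OF X Y p]]
  have "nabla p (X p) (\<lambda>q. nabla q (Y q) t) - nabla p (Y p) (\<lambda>q. nabla q (X q) t)
      - nabla p (lie_bracket A X Y p) t = 0"
    using flat X Y t p unfolding flat_def by blast
  then have "\<Phi> p (nabla p (X p) (\<lambda>q. nabla q (Y q) t)) - \<Phi> p (nabla p (Y p) (\<lambda>q. nabla q (X q) t))
      - \<Phi> p (nabla p (lie_bracket A X Y p) t) = 0"
    using los_diff[OF bundle_mapD(2)[OF map] in1 in2]
      los_diff[OF bundle_mapD(2)[OF map] subspace_diff[OF fibre_subspace in1 in2] in3]
      los_zero[OF bundle_mapD(2)[OF map] fibre_subspace] by metis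
  then show "transport_conn E \<Phi> nabla p (X p) (\<lambda>q. transport_conn E \<Phi> nabla q (Y q) s) -
      transport_conn E \<Phi> nabla p (Y p) (\<lambda>q. transport_conn E \<Phi> nabla q (X q) s) -
      transport_conn E \<Phi> nabla p (lie_bracket A X Y p) s = 0"
    unfolding 2[OF Y Xp] 2[OF X Yp] unfolding 1 .
qed

text \<open>Going forth and back conjugates \<open>nabla\<close> by maps that are inverse to each
  other on fibres, which gives \<open>conn_eq\<close> rather than equality.\<close>

lemma transport_conn_back:
  assumes \<Phi>: "bundle_iso A E F \<Phi>" and nabla: "connection A E nabla"
  shows "conn_eq A E (transport_conn F (bundle_inv E \<Phi>) (transport_conn E \<Phi> nabla)) nabla"
  unfolding conn_eq_def
proof (intro allI impI; elim conjE)
  interpret conn_vbundle A E nabla by unfold_locales (rule nabla)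
  note bij = bundle_isoD(2)[OF \<Phi>] and map = bundle_isoD(1)[OF \<Phi>]
  fix U s p v assume s: "smooth_section A E U s" and p: "p \<in> U" and v: "v \<in> tangent_space A p"
  have "nabla p v (\<lambda>q. bundle_inv E \<Phi> q (bundle_inv F (bundle_inv E \<Phi>) q (s q))) = nabla p v s"
    by (rule conn_cong'[symmetric, OF s _ p v])
      (simp add: bundle_inv_bundle_inv[OF \<Phi> section_in[OF s]] bundle_inv_left[OF bij section_in[OF s]])
  then show "transport_conn F (bundle_inv E \<Phi>) (transport_conn E \<Phi> nabla) p v s = nabla p v s"
    unfolding transport_conn_def by (simp add: bundle_inv_left[OF bij conn_in[OF s p v]])
qed

lemma transport_conn_forth:
  assumes \<Phi>: "bundle_iso A E F \<Phi>" and nabla: "connection A F nabla"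
  shows "conn_eq A F (transport_conn E \<Phi> (transport_conn F (bundle_inv E \<Phi>) nabla)) nabla"
  unfolding conn_eq_def
proof (intro allI impI; elim conjE)
  interpret F: conn_vbundle A F nabla by unfold_locales (rule nabla)
  note bij = bundle_isoD(2)[OF \<Phi>]
  fix U s p v assume s: "smooth_section A F U s" and p: "p \<in> U" and v: "v \<in> tangent_space A p"
  have "nabla p v (\<lambda>q. bundle_inv F (bundle_inv E \<Phi>) q (bundle_inv E \<Phi> q (s q))) = nabla p v s"
    by (rule F.conn_cong'[symmetric, OF s _ p v])
      (simp add: bundle_inv_bundle_inv[OF \<Phi> section_in[OF transport_section[OF \<Phi> s]]] bundle_inv_right[OF bij F.section_in[OF s]])
  then show "transport_conn E \<Phi> (transport_conn F (bundle_inv E \<Phi>) nabla) p v s = nabla p v s"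
    unfolding transport_conn_def by (simp add: bundle_inv_right[OF bij F.conn_in[OF s p v]])
qed

lemma transport_conn_cong:
  assumes \<Phi>: "bundle_iso A E F \<Phi>" and eq: "conn_eq A E n n'"
  shows "conn_eq A F (transport_conn E \<Phi> n) (transport_conn E \<Phi> n')"
  unfolding conn_eq_def transport_conn_def
proof (intro allI impI; elim conjE)
  fix U s p v assume s: "smooth_section A F U s" and p: "p \<in> U" and v: "v \<in> tangent_space A p"
  show "\<Phi> p (n p v (\<lambda>q. bundle_inv E \<Phi> q (s q))) = \<Phi> p (n' p v (\<lambda>q. bundle_inv E \<Phi> q (s q)))"
    by (rule arg_cong[where f="\<Phi> p"], rule conn_eqD[OF eq transport_section[OF \<Phi> s] p v])
qed

end


section \<open>Introduction rules for bundles and bundle maps\<close>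

lemma vector_bundleI:
  assumes "\<And>p. subspace (fibre E p)" and cover: "\<And>p. \<exists>U \<tau>. (U, \<tau>) \<in> trivs E \<and> p \<in> U"
    and "\<And>U \<tau>. (U, \<tau>) \<in> trivs E \<Longrightarrow> open U"
    and "\<And>U \<tau> p. (U, \<tau>) \<in> trivs E \<Longrightarrow> p \<in> U \<Longrightarrow> linear_on_subspace (fibre E p) (\<tau> p)"
    and "\<And>U \<tau> p. (U, \<tau>) \<in> trivs E \<Longrightarrow> p \<in> U \<Longrightarrow> bij_betw (\<tau> p) (fibre E p) UNIV"
    and "\<And>U \<tau> V \<sigma> w. (U, \<tau>) \<in> trivs E \<Longrightarrow> (V, \<sigma>) \<in> trivs E \<Longrightarrow>
      smooth_map_on A (U \<inter> V) (\<lambda>p. \<sigma> p (inv_into (fibre E p) (\<tau> p) w))"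
  shows "vector_bundle A E"
proof -
  have "p \<in> (\<Union>(U, \<tau>)\<in>trivs E. U)" for p using cover[of p] by auto
  then have "(\<Union>(U, \<tau>)\<in>trivs E. U) = UNIV" by blast
  with assms(1,3-) show ?thesis unfolding vector_bundle_def by (simp add: Ball_def)
qed

lemma bundle_mapI:
  assumes "\<And>p x. x \<in> fibre E p \<Longrightarrow> \<Phi> p x \<in> fibre F p" and "\<And>p. linear_on_subspace (fibre E p) (\<Phi> p)"
    and "\<And>U \<tau> V \<sigma> w. (U, \<tau>) \<in> trivs E \<Longrightarrow> (V, \<sigma>) \<in> trivs F \<Longrightarrow>
      smooth_map_on A (U \<inter> V) (\<lambda>p. \<sigma> p (\<Phi> p (inv_into (fibre E p) (\<tau> p) w)))"
  shows "bundle_map A E F \<Phi>"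
  using assms unfolding bundle_map_def by (simp add: split_beta image_subset_iff)

section \<open>Tangent and cotangent bundles\<close>

context smooth_mfd
begin

abbreviation tangent_triv :: "('b, 'n) chart \<Rightarrow> 'b \<Rightarrow> ('b, 'n) tvec \<Rightarrow> real^'n" where
  "tangent_triv c \<equiv> \<lambda>p v. v c"

abbreviation cotangent_triv :: "('b, 'n) chart \<Rightarrow> 'b \<Rightarrow> ('b, 'n) covec \<Rightarrow> real^'n" where
  "cotangent_triv c \<equiv> \<lambda>p \<alpha>. \<chi> i. \<alpha> (coord_field A c i p)"

lemma tangent_bundle_simps [simp]:
  "fibre (tangent_bundle A) = tangent_space A"
  "trivs (tangent_bundle A) = (\<lambda>c. (fst c, tangent_triv c)) ` A"
  by (simp_all add: tangent_bundle_def)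

lemma tangent_frame:
  assumes "c \<in> A" "p \<in> fst c"
  shows "inv_into (tangent_space A p) (\<lambda>v. v c) w = tvec c p w"
  using tvec_in tvec_same tangent_eqI charts_atI[OF assms]
  by (intro inv_into_f_eq) (auto simp: inj_on_def)

lemma trivs_tangentE:
  assumes "(U, \<tau>) \<in> trivs (tangent_bundle A)"
  obtains c where "c \<in> A" "U = fst c" "\<tau> = tangent_triv c"
proof -
  from assms have "(U, \<tau>) \<in> (\<lambda>c. (fst c, tangent_triv c)) ` A" by simp
  then obtain c where "c \<in> A" "(U, \<tau>) = (fst c, tangent_triv c)" by (rule imageE)
  then show thesis using that[of c] unfolding prod.inject by (elim conjE)
qed

lemma vector_bundle_tangent: "vector_bundle A (tangent_bundle A)"
proof (rule vector_bundleI)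
  show "\<exists>U \<tau>. (U, \<tau>) \<in> trivs (tangent_bundle A) \<and> p \<in> U" for p
    using charts_at_ex[of p] charts_atD unfolding tangent_bundle_simps by blast
  show "subspace (fibre (tangent_bundle A) p)" for p by (simp add: subspace_tangent)
  fix U \<tau> assume "(U, \<tau>) \<in> trivs (tangent_bundle A)"
  then obtain c where c: "c \<in> A" "U = fst c" "\<tau> = tangent_triv c" by (rule trivs_tangentE)
  show "open U" using c chart_dom_open by simp
  show "linear_on_subspace (fibre (tangent_bundle A) p) (\<tau> p)" for p
    by (simp add: linear_on_subspace_def scaleR_fun_apply c)
  show "bij_betw (\<tau> p) (fibre (tangent_bundle A) p) UNIV" if p: "p \<in> U" for p
  proof (rule bij_betw_byWitness[where f'="tvec c p"])
    note cp = charts_atI[OF c(1) p[unfolded c(2)]]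
    show "\<forall>v\<in>fibre (tangent_bundle A) p. tvec c p (\<tau> p v) = v" using tvec_self[OF _ cp] c by simp
    show "\<forall>w\<in>UNIV. \<tau> p (tvec c p w) = w" using tvec_same[OF cp] c by simp
    show "tvec c p ` UNIV \<subseteq> fibre (tangent_bundle A) p" using tvec_in[OF cp] by auto
  qed simp
  fix V \<sigma> w assume "(V, \<sigma>) \<in> trivs (tangent_bundle A)"
  then obtain d where d: "d \<in> A" "V = fst d" "\<sigma> = tangent_triv d" by (rule trivs_tangentE)
  have "smooth_map_on A (fst c \<inter> fst d) (\<lambda>p. inv_into (tangent_space A p) (\<lambda>v. v c) w d)"
    by (rule smooth_map_on_transform[OF smooth_map_on_jac[OF c(1) d(1), of w]])
      (auto simp: tangent_frame c d tvec_def charts_at_def chart_dom_open open_Int)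
  then show "smooth_map_on A (U \<inter> V) (\<lambda>p. \<sigma> p (inv_into (fibre (tangent_bundle A) p) (\<tau> p) w))"
    by (simp add: c d)
qed

text \<open>Counterpart of \<open>tvec\<close> for covectors. The value 0 off the tangent space is
  demanded by \<open>cotangent_space\<close> and makes covectors comparable as functions.\<close>

definition cov :: "('b, 'n) chart \<Rightarrow> 'b \<Rightarrow> real^'n \<Rightarrow> ('b, 'n) covec" where
  "cov c p w = (\<lambda>v. if v \<in> tangent_space A p then w \<bullet> v c else 0)"

lemma cotangentI:
  "linear_on_subspace (tangent_space A p) \<alpha> \<Longrightarrow> (\<And>v. v \<notin> tangent_space A p \<Longrightarrow> \<alpha> v = 0) \<Longrightarrow> \<alpha> \<in> cotangent_space A p"
  by (simp add: cotangent_space_def)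

lemma cotangentD:
  assumes "\<alpha> \<in> cotangent_space A p"
  shows "linear_on_subspace (tangent_space A p) \<alpha>" "v \<notin> tangent_space A p \<Longrightarrow> \<alpha> v = 0"
  using assms by (simp_all add: cotangent_space_def)

lemma subspace_cotangent: "subspace (cotangent_space A p)"
  unfolding subspace_def
  by (auto simp: cotangent_space_def linear_on_subspace_def scaleR_fun_apply algebra_simps)

lemma cov_in: "cov c p w \<in> cotangent_space A p"
  by (rule cotangentI)
    (simp_all add: cov_def linear_on_subspace_def tangent_add tangent_scale scaleR_fun_apply inner_add_right)

lemma cov_coord: "c \<in> A \<Longrightarrow> p \<in> fst c \<Longrightarrow> cov c p w (coord_field A c i p) = w $ i"
  by (simp add: cov_def coord_field_in coord_field_same inner_axis)

lemma covector_expand: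
  assumes \<alpha>: "\<alpha> \<in> cotangent_space A p" and v: "v \<in> tangent_space A p" and c: "c \<in> A" "p \<in> fst c"
  shows "\<alpha> v = (\<Sum>i\<in>UNIV. v c $ i * \<alpha> (coord_field A c i p))"
proof -
  have "\<alpha> v = \<alpha> (\<Sum>i\<in>UNIV. (v c $ i) *\<^sub>R coord_field A c i p)" using tangent_expand[OF v c] by simp
  also have "\<dots> = (\<Sum>i\<in>UNIV. (v c $ i) *\<^sub>R \<alpha> (coord_field A c i p))"
    by (rule los_lincomb[OF cotangentD(1)[OF \<alpha>] subspace_tangent coord_field_in[OF c]])
  finally show ?thesis by simp
qed

lemma cotangent_eqI:
  assumes \<alpha>: "\<alpha> \<in> cotangent_space A p" and \<beta>: "\<beta> \<in> cotangent_space A p" and c: "c \<in> A" "p \<in> fst c"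
    and eq: "\<And>i. \<alpha> (coord_field A c i p) = \<beta> (coord_field A c i p)"
  shows "\<alpha> = \<beta>"
proof
  fix v show "\<alpha> v = \<beta> v"
    by (cases "v \<in> tangent_space A p")
      (simp_all add: covector_expand[OF \<alpha> _ c] covector_expand[OF \<beta> _ c] eq cotangentD(2)[OF \<alpha>] cotangentD(2)[OF \<beta>])
qed

lemma cotangent_bundle_simps [simp]:
  "fibre (cotangent_bundle A) = cotangent_space A"
  "trivs (cotangent_bundle A) = (\<lambda>c. (fst c, cotangent_triv c)) ` A"
  by (simp_all add: cotangent_bundle_def)

lemma cotangent_frame:
  assumes c: "c \<in> A" "p \<in> fst c"
  shows "inv_into (cotangent_space A p) (\<lambda>\<alpha>. \<chi> i. \<alpha> (coord_field A c i p)) w = cov c p w"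
  by (rule inv_into_f_eq)
    (auto simp: inj_on_def cov_in cov_coord c vec_eq_iff intro: cotangent_eqI[OF _ _ c])

lemma trivs_cotangentE:
  assumes "(U, \<tau>) \<in> trivs (cotangent_bundle A)"
  obtains c where "c \<in> A" "U = fst c" "\<tau> = cotangent_triv c"
proof -
  from assms have "(U, \<tau>) \<in> (\<lambda>c. (fst c, cotangent_triv c)) ` A" by simp
  then obtain c where "c \<in> A" "(U, \<tau>) = (fst c, cotangent_triv c)" by (rule imageE)
  then show thesis using that[of c] unfolding prod.inject by (elim conjE)
qed

lemma vector_bundle_cotangent: "vector_bundle A (cotangent_bundle A)"
proof (rule vector_bundleI)
  show "\<exists>U \<tau>. (U, \<tau>) \<in> trivs (cotangent_bundle A) \<and> p \<in> U" for p
    using charts_at_ex[of p] charts_atD unfolding cotangent_bundle_simps by blast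
  show "subspace (fibre (cotangent_bundle A) p)" for p by (simp add: subspace_cotangent)
  fix U \<tau> assume "(U, \<tau>) \<in> trivs (cotangent_bundle A)"
  then obtain c where c: "c \<in> A" "U = fst c" "\<tau> = cotangent_triv c" by (rule trivs_cotangentE)
  show "open U" using c chart_dom_open by simp
  show "linear_on_subspace (fibre (cotangent_bundle A) p) (\<tau> p)" for p
    by (simp add: linear_on_subspace_def scaleR_fun_apply c vec_eq_iff)
  show "bij_betw (\<tau> p) (fibre (cotangent_bundle A) p) UNIV" if "p \<in> U" for p
  proof (rule bij_betw_byWitness[where f'="cov c p"])
    have p: "p \<in> fst c" using that c by simp
    show "\<forall>\<alpha>\<in>fibre (cotangent_bundle A) p. cov c p (\<tau> p \<alpha>) = \<alpha>"
      unfolding cotangent_bundle_simps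
      by (intro ballI cotangent_eqI[OF cov_in _ c(1) p]) (simp_all add: cov_coord c p)
    show "\<forall>w\<in>UNIV. \<tau> p (cov c p w) = w"
      by (simp add: cov_coord c p)
    show "cov c p ` UNIV \<subseteq> fibre (cotangent_bundle A) p" by (simp add: image_subset_iff cov_in)
  qed simp
  fix V \<sigma> w assume "(V, \<sigma>) \<in> trivs (cotangent_bundle A)"
  then obtain d where d: "d \<in> A" "V = fst d" "\<sigma> = cotangent_triv d" by (rule trivs_cotangentE)
  have W: "open (fst c \<inter> fst d)" using c d chart_dom_open by blast
  have J: "smooth_map_on A (fst c \<inter> fst d) (\<lambda>p. jac d c p v)" for v
    using smooth_map_on_jac[OF d(1) c(1)] by (simp add: Int_commute)
  \<comment> \<open>Covectors transform by the transpose: the components in \<open>d\<close> pair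
    \<open>w\<close> with the columns of the Jacobian from \<open>d\<close> to
    \<open>c\<close>.\<close>
  have "smooth_map_on A (fst c \<inter> fst d) (\<lambda>p. \<chi> i. w \<bullet> jac d c p (axis i 1))"
    by (subst smooth_map_on_vec_iff[OF W])
      (auto intro!: smooth_map_on_bounded_linear[OF bounded_linear_inner_right W] J)
  then have "smooth_map_on A (fst c \<inter> fst d) (\<lambda>p. \<chi> i.
      inv_into (cotangent_space A p) (cotangent_triv c p) w (coord_field A d i p))"
  proof (rule smooth_map_on_transform[OF _ W])
    fix p assume p: "p \<in> fst c \<inter> fst d"
    then show "(\<chi> i. w \<bullet> jac d c p (axis i 1)) =
        (\<chi> i. inv_into (cotangent_space A p) (cotangent_triv c p) w (coord_field A d i p))"
      using coord_field_in[OF d(1), of p]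
      by (simp add: cotangent_frame c d cov_def vec_eq_iff) (simp add: coord_field_tvec tvec_def charts_atI c)
  qed
  then show "smooth_map_on A (U \<inter> V) (\<lambda>p. \<sigma> p (inv_into (fibre (cotangent_bundle A) p) (\<tau> p) w))"
    by (simp add: c d)
qed

sublocale TB: smooth_vbundle A "tangent_bundle A"
  by unfold_locales (rule vector_bundle_tangent)

sublocale CB: smooth_vbundle A "cotangent_bundle A"
  by unfold_locales (rule vector_bundle_cotangent)

lemma covector_field_eval_smooth:
  assumes \<alpha>: "smooth_section A (cotangent_bundle A) U \<alpha>" and X: "vector_field A U X"
  shows "smooth_map_on A U (\<lambda>p. \<alpha> p (X p))"
proof (rule smooth_map_on_local)
  fix p assume p: "p \<in> U"
  obtain c where c: "c \<in> A" "p \<in> fst c" using charts_at_ex[of p] charts_atD by blast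
  let ?W = "U \<inter> fst c"
  have W: "open ?W" using vector_fieldD(1)[OF X] chart_dom_open c by blast
  have "smooth_map_on A ?W (\<lambda>p. \<chi> i. \<alpha> p (coord_field A c i p))"
    using \<alpha> c by (auto simp: smooth_section_def)
  then have "smooth_map_on A ?W (\<lambda>p. \<alpha> p (coord_field A c i p))" for i
    using smooth_map_on_vec_iff[OF W, THEN iffD1, rule_format, of _ i] by fastforce
  then have "smooth_map_on A ?W (\<lambda>q. \<Sum>i\<in>UNIV. X q c $ i * \<alpha> q (coord_field A c i q))"
    using vector_field_component[OF vector_field_subset[OF X W] c(1)]
    by (intro smooth_map_on_sum smooth_map_on_mult W) auto
  moreover have "(\<Sum>i\<in>UNIV. X q c $ i * \<alpha> q (coord_field A c i q)) = \<alpha> q (X q)" if "q \<in> ?W" for q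
    using covector_expand[of "\<alpha> q" q "X q" c] CB.section_in[OF \<alpha>, of q] vector_fieldD(2)[OF X, of q] c that by simp
  ultimately have "smooth_map_on A ?W (\<lambda>q. \<alpha> q (X q))" by (rule smooth_map_on_transform[OF _ W])
  then show "\<exists>V. open V \<and> p \<in> V \<and> smooth_map_on A V (\<lambda>q. \<alpha> q (X q))" using W p c by blast
qed

lemma tderiv_los:
  assumes f: "smooth_map_on A U f" "open U" "p \<in> U"
  shows "linear_on_subspace (tangent_space A p) (\<lambda>v. tderiv A p v f)"
proof -
  obtain c where c: "c \<in> A" "p \<in> fst c" using charts_at_ex[of p] charts_atD by blast
  show ?thesis
    unfolding linear_on_subspace_def
    by (auto simp: tderiv_expand[OF f _ c] tangent_add tangent_scale scaleR_fun_apply algebra_simps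
        sum.distrib sum_distrib_left)
qed


subsection \<open>The identification given by a metric\<close>

lemma metricD:
  assumes "riemannian_metric A g"
  shows "X \<in> tangent_space A p \<Longrightarrow> linear_on_subspace (tangent_space A p) (\<lambda>Y. g p X Y)"
    and "X \<in> tangent_space A p \<Longrightarrow> Y \<in> tangent_space A p \<Longrightarrow> g p X Y = g p Y X"
    and "X \<in> tangent_space A p \<Longrightarrow> X \<noteq> 0 \<Longrightarrow> g p X X > 0"
    and "vector_field A U V \<Longrightarrow> vector_field A U W \<Longrightarrow> smooth_map_on A U (\<lambda>p. g p (V p) (W p))"
  using assms unfolding riemannian_metric_def by blast+

lemma metric_los_left:
  assumes g: "riemannian_metric A g" and Y: "Y \<in> tangent_space A p"
  shows "linear_on_subspace (tangent_space A p) (\<lambda>X. g p X Y)"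
  by (rule los_cong[OF metricD(1)[OF g Y] subspace_tangent]) (rule metricD(2)[OF g Y])

lemma metric_flat_apply: "X \<in> tangent_space A p \<Longrightarrow> metric_flat A g p Y X = g p Y X"
  by (simp add: metric_flat_def)

lemma metric_flat_in:
  "riemannian_metric A g \<Longrightarrow> Y \<in> tangent_space A p \<Longrightarrow> metric_flat A g p Y \<in> cotangent_space A p"
  by (rule cotangentI)
    (auto intro: los_cong[OF metricD(1) subspace_tangent] simp: metric_flat_def)

lemma metric_zero_iff:
  assumes g: "riemannian_metric A g" and X: "X \<in> tangent_space A p" and 0: "g p X X = 0"
  shows "X = 0"
  using metricD(3)[OF g X] 0 by fastforce

lemma metric_flat_los:
  assumes g: "riemannian_metric A g"
  shows "linear_on_subspace (tangent_space A p) (metric_flat A g p)"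
  unfolding linear_on_subspace_def
proof (intro ballI allI ext)
  fix X Y a b Z assume X: "X \<in> tangent_space A p" and Y: "Y \<in> tangent_space A p"
  show "metric_flat A g p (a *\<^sub>R X + b *\<^sub>R Y) Z = (a *\<^sub>R metric_flat A g p X + b *\<^sub>R metric_flat A g p Y) Z"
    by (auto simp: metric_flat_def scaleR_fun_apply los_comb[OF metric_los_left[OF g] X Y])
qed

lemma metric_flat_bij:
  assumes g: "riemannian_metric A g"
  shows "bij_betw (metric_flat A g p) (tangent_space A p) (cotangent_space A p)"
proof -
  obtain c where c: "c \<in> A" "p \<in> fst c" using charts_at_ex[of p] charts_atD by blast
  note cp = charts_atI[OF c]
  note los = metric_flat_los[OF g, of p]
  have inj: "inj_on (metric_flat A g p) (tangent_space A p)"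
  proof (rule inj_onI)
    fix X Y assume XY: "X \<in> tangent_space A p" "Y \<in> tangent_space A p" and eq: "metric_flat A g p X = metric_flat A g p Y"
    have "metric_flat A g p (X - Y) = 0" using los_diff[OF los XY] eq by simp
    then have "metric_flat A g p (X - Y) (X - Y) = 0" by simp
    then have "X - Y = 0"
      using metric_zero_iff[OF g tangent_diff[OF XY]] tangent_diff[OF XY] by (simp add: metric_flat_def)
    then show "X = Y" by simp
  qed
  \<comment> \<open>Surjectivity is a dimension count, which needs a map from \<open>real^'n\<close>
    to itself: \<open>h\<close> is the metric map in the components of one chart, and an injective
    linear endomorphism is onto.\<close>
  define h where "h w = (\<chi> i. metric_flat A g p (tvec c p w) (coord_field A c i p))" for w
  have tv: "linear (tvec c p)"
    using jac_linear cp by (intro linearI)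
      (auto simp: tvec_def fun_eq_iff scaleR_fun_apply linear_add linear_cmul)
  have h: "linear h"
    by (rule linearI) (simp_all add: h_def vec_eq_iff linear_add[OF tv] linear_cmul[OF tv]
        los_add[OF los] los_scale[OF los] tvec_in[OF cp] scaleR_fun_apply)
  have hinj: "inj h"
  proof (rule injI)
    fix v w assume "h v = h w"
    then have "metric_flat A g p (tvec c p v) = metric_flat A g p (tvec c p w)"
      by (intro cotangent_eqI[OF metric_flat_in[OF g] metric_flat_in[OF g] c] tvec_in cp)
        (simp add: h_def vec_eq_iff)
    then have "tvec c p v = tvec c p w" using inj tvec_in[OF cp] by (auto simp: inj_on_def)
    then show "v = w" using tvec_same[OF cp] by metis
  qed
  have "\<alpha> \<in> metric_flat A g p ` tangent_space A p" if \<alpha>: "\<alpha> \<in> cotangent_space A p" for \<alpha>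
  proof -
    obtain w where w: "h w = (\<chi> i. \<alpha> (coord_field A c i p))"
      using linear_injective_imp_surjective[OF h hinj] by (metis surjD)
    have "metric_flat A g p (tvec c p w) = \<alpha>"
      by (rule cotangent_eqI[OF metric_flat_in[OF g tvec_in[OF cp]] \<alpha> c])
        (use w in \<open>simp add: h_def vec_eq_iff\<close>)
    then show ?thesis using tvec_in[OF cp] by blast
  qed
  then show ?thesis using inj metric_flat_in[OF g] unfolding bij_betw_def by blast
qed

lemma metric_flat_iso:
  assumes g: "riemannian_metric A g"
  shows "bundle_iso A (tangent_bundle A) (cotangent_bundle A) (metric_flat A g)"
proof (rule bundle_iso_bijI[OF vector_bundle_tangent vector_bundle_cotangent])
  show "bij_betw (metric_flat A g p) (fibre (tangent_bundle A) p) (fibre (cotangent_bundle A) p)" for p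
    using metric_flat_bij[OF g] by simp
  show "bundle_map A (tangent_bundle A) (cotangent_bundle A) (metric_flat A g)"
  proof (rule bundle_mapI)
    fix p
    show "metric_flat A g p Y \<in> fibre (cotangent_bundle A) p" if "Y \<in> fibre (tangent_bundle A) p" for Y
      using metric_flat_in[OF g] that by simp
    show "linear_on_subspace (fibre (tangent_bundle A) p) (metric_flat A g p)"
      using metric_flat_los[OF g] by simp
  next
    fix U \<tau> V \<sigma> w assume "(U, \<tau>) \<in> trivs (tangent_bundle A)" "(V, \<sigma>) \<in> trivs (cotangent_bundle A)"
    then obtain c d where c: "c \<in> A" "U = fst c" "\<tau> = tangent_triv c"
      and d: "d \<in> A" "V = fst d" "\<sigma> = cotangent_triv d"
      by (elim trivs_tangentE trivs_cotangentE)
    have W: "open (fst c \<inter> fst d)" using c d chart_dom_open by blast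
    have "smooth_map_on A (fst c \<inter> fst d) (\<lambda>p. \<chi> i. g p (tvec c p w) (coord_field A d i p))"
      by (subst smooth_map_on_vec_iff[OF W])
        (auto intro!: metricD(4)[OF g] vector_field_subset[OF tvec_vector_field[OF c(1)] W]
          vector_field_subset[OF coord_vector_field[OF d(1)] W])
    then have "smooth_map_on A (fst c \<inter> fst d) (\<lambda>p. \<chi> i.
        metric_flat A g p (inv_into (tangent_space A p) (\<lambda>v. v c) w) (coord_field A d i p))"
      by (rule smooth_map_on_transform[OF _ W])
        (simp add: tangent_frame c d metric_flat_def coord_field_in)
    then show "smooth_map_on A (U \<inter> V) (\<lambda>p. \<sigma> p (metric_flat A g p (inv_into (fibre (tangent_bundle A) p) (\<tau> p) w)))"
      by (simp add: c d)
  qed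
qed

lemma TB_CB: "smooth_vbundle2 A (tangent_bundle A) (cotangent_bundle A)"
  by unfold_locales

end

context smooth_vbundle
begin

lemma bundle_iso_id: "bundle_iso A E E (\<lambda>p x. x)"
proof -
  have map: "bundle_map A E E (\<lambda>p x. x)"
    unfolding bundle_map_def
    by (auto simp: linear_on_subspace_def triv_transition)
  have inv: "bundle_inv E (\<lambda>p x. x) p x = x" if "x \<in> fibre E p" for p x
    by (rule bundle_inv_unique[of _ _ E]) (use that in \<open>auto simp: bij_betw_def inj_on_def\<close>)
  interpret smooth_vbundle2 A E E by unfold_locales
  have "bundle_map A E E (bundle_inv E (\<lambda>p x. x))"
    by (rule bundle_map_cong[OF map]) (simp add: inv)
  with map show ?thesis by (simp add: bundle_iso_def bij_betw_def inj_on_def)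
qed

lemma bundle_inv_id: "x \<in> fibre E p \<Longrightarrow> bundle_inv E (\<lambda>p x. x) p x = x"
  by (rule bundle_inv_unique[of _ _ E]) (auto simp: bij_betw_def inj_on_def)

text \<open>The identifications in \<open>legendre_of\<close> are identities, yet the induced base
  connections still pass through \<open>transport_conn\<close>. There the inverse of the identity is
  known to be the identity on fibres, so the outcome is a \<open>conn_eq\<close>.\<close>

lemma transport_conn_id:
  assumes nabla: "connection A E nabla"
  shows "conn_eq A E (transport_conn E (\<lambda>p x. x) nabla) nabla"
  unfolding conn_eq_def transport_conn_def
proof (intro allI impI; elim conjE)
  interpret conn_vbundle A E nabla by unfold_locales (rule nabla)
  fix U s p v assume s: "smooth_section A E U s" and p: "p \<in> U" and v: "v \<in> tangent_space A p"
  show "nabla p v (\<lambda>q. bundle_inv E (\<lambda>p x. x) q (s q)) = nabla p v s"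
    by (rule conn_cong'[symmetric, OF s _ p v]) (simp add: bundle_inv_id section_in[OF s])
qed

end


lemma has_derivative_vec_lambda:
  fixes f :: "'i::finite \<Rightarrow> 'a::real_normed_vector \<Rightarrow> real"
  assumes "\<And>i. (f i has_derivative f' i) (at x)"
  shows "((\<lambda>x. \<chi> i. f i x) has_derivative (\<lambda>v. \<chi> i. f' i v)) (at x)"
  by (subst has_derivative_componentwise_within) (auto simp: Basis_vec_def inner_axis assms)

section \<open>Construction of charts\<close>

context smooth_mfd
begin

text \<open>New charts enter the atlas by its maximality, which is why compatibility with every
  chart \<open>e\<close> has to be checked. Both transition maps factor through \<open>c\<close> and
  the smooth maps \<open>F\<close> and \<open>G\<close>.\<close>

lemma chart_compose:
  assumes c: "c \<in> A" and X: "open X" "X \<subseteq> snd c ` fst c" and F: "smooth_on X F"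
    and hom: "homeomorphism X (F ` X) F G" and FX: "open (F ` X)" and G: "smooth_on (F ` X) G"
  shows "(chart_inv c ` X, F \<circ> snd c) \<in> A"
proof -
  define V where "V = chart_inv c ` X"
  define d where "d = (V, F \<circ> snd c)"
  have V: "open V" "V \<subseteq> fst c" "snd c ` V = X"
    unfolding V_def using chart_preimage_open[OF c X] chart_preimage_subset[OF c X(2)]
      chart_image_preimage[OF c X(2)] by auto
  have GF: "G (F x) = x" if "x \<in> X" for x using hom that by (simp add: homeomorphism_def)
  have FG: "F (G y) = y" "G y \<in> X" if "y \<in> F ` X" for y using hom that by (auto simp: homeomorphism_def)
  have inX: "snd c p \<in> X" if "p \<in> V" for p using that V(3) by blast
  have inV: "chart_inv c x \<in> V" if "x \<in> X" for x using that by (simp add: V_def)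
  have dsimps [simp]: "fst d = V" "snd d = F \<circ> snd c" by (simp_all add: d_def)
  have img: "snd d ` V = F ` X" by (simp only: dsimps image_comp[symmetric] V(3))
  \<comment> \<open>\<open>chart_inv d\<close> is given by \<open>inv_into\<close>. On the image it
    is \<open>G\<close> followed by \<open>chart_inv c\<close>, and both continuity and smoothness
    of the inverse are read off this formula.\<close>
  have inv: "chart_inv d y = chart_inv c (G y)" if y: "y \<in> F ` X" for y
    unfolding chart_inv_def[of d] dsimps
  proof (rule inv_into_f_eq)
    show "inj_on (F \<circ> snd c) V"
    proof (rule inj_onI)
      fix p q assume pq: "p \<in> V" "q \<in> V" and "(F \<circ> snd c) p = (F \<circ> snd c) q"
      then have "G (F (snd c p)) = G (F (snd c q))" by simp
      then have "snd c p = snd c q" using GF inX pq by simp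
      then show "p = q" using chart_inv_left[OF c] V(2) pq by (metis subsetD)
    qed
    show "chart_inv c (G y) \<in> V" using FG(2)[OF y] inV by blast
    show "(F \<circ> snd c) (chart_inv c (G y)) = y" using FG[OF y] X(2) c by (simp add: subset_iff)
  qed
  have chom: "continuous_on (fst c) (snd c)" "continuous_on (snd c ` fst c) (chart_inv c)"
    using chart_homeomorphism[OF c] by (simp_all add: homeomorphism_def)
  have ic: "is_chart d"
    unfolding is_chart_def dsimps(1) img
  proof (intro conjI V(1) FX homeomorphismI)
    show "continuous_on V (snd d)"
      unfolding dsimps using V smooth_on_imp_continuous_on[OF F]
      by (intro continuous_on_compose continuous_on_subset[OF chom(1)]) auto
    have "continuous_on (F ` X) (\<lambda>y. chart_inv c (G y))"
      by (rule continuous_on_compose2[OF chom(2) smooth_on_imp_continuous_on[OF G]]) (use FG X in blast)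
    then show "continuous_on (F ` X) (chart_inv d)" using inv by (simp cong: continuous_on_cong)
    show "snd d ` V \<subseteq> F ` X" using img by simp
    show "chart_inv d ` F ` X \<subseteq> V" using inv GF inV by auto
    show "chart_inv d (snd d p) = p" if "p \<in> V" for p
      using inv[of "snd d p"] GF[OF inX[OF that]] inX[OF that] V(2) that c by (simp add: subset_iff)
    show "snd d (chart_inv d y) = y" if "y \<in> F ` X" for y
      using FG[OF that] X(2) c by (simp add: inv[OF that] subset_iff)
  qed
  have comp: "compatible d e" if e: "e \<in> A" for e
    unfolding compatible_def dsimps(1)
  proof
    let ?Z = "snd c ` (V \<inter> fst e)"
    have eq: "snd d ` (V \<inter> fst e) = F ` ?Z" by (simp add: image_comp)
    have ZX: "?Z \<subseteq> X" using inX by blast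
    have Z: "open ?Z"
      using chart_image_open'[OF c, of "V \<inter> fst e"] V chart_dom_open[OF e] by (simp add: open_Int le_infI1)
    have "openin (top_of_set X) ?Z" using Z ZX by (metis open_openin_trans X(1) openin_open_eq)
    then have "openin (top_of_set (F ` X)) (F ` ?Z)" by (rule homeomorphism_imp_open_map[OF hom])
    then have FZ: "open (F ` ?Z)" using FX openin_open_trans by blast
    have "smooth_on (F ` ?Z) (\<lambda>y. (snd e \<circ> chart_inv c) (G y))"
    proof (rule smooth_on_compose[OF FZ overlap_open[OF c e] _ smooth_on_subset[OF G] transition_smooth[OF c e]])
      show "G ` F ` ?Z \<subseteq> snd c ` (fst c \<inter> fst e)" using GF inX V(2) by auto
      show "F ` ?Z \<subseteq> F ` X" using ZX by blast
    qed
    then show "smooth_on (snd d ` (V \<inter> fst e)) (snd e \<circ> chart_inv d)"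
      unfolding eq
    proof (rule smooth_on_cong[OF FZ, THEN iffD1, rotated])
      fix y assume "y \<in> F ` ?Z"
      then have "y \<in> F ` X" using ZX by blast
      then show "(snd e \<circ> chart_inv c) (G y) = (snd e \<circ> chart_inv d) y" by (simp add: inv)
    qed
    have Y: "open (snd e ` (V \<inter> fst e))" by (rule chart_image_open[OF e V(1)])
    have "smooth_on (snd e ` (V \<inter> fst e)) (\<lambda>y. F ((snd c \<circ> chart_inv e) y))"
    proof (rule smooth_on_compose[OF Y X(1) _ smooth_on_subset[OF transition_smooth[OF e c]] F])
      show "(snd c \<circ> chart_inv e) ` snd e ` (V \<inter> fst e) \<subseteq> X" using inX e by auto
      show "snd e ` (V \<inter> fst e) \<subseteq> snd e ` (fst e \<inter> fst c)" using V(2) by blast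
    qed
    then show "smooth_on (snd e ` (V \<inter> fst e)) (snd d \<circ> chart_inv e)" by (simp add: o_def)
  qed
  have "d \<in> A" using smooth_manifold ic comp unfolding smooth_manifold_def by blast
  then show ?thesis by (simp add: d_def V_def)
qed

lemma chart_restrict:
  assumes c: "c \<in> A" and V: "open V" "V \<subseteq> fst c"
  shows "(V, snd c) \<in> A"
proof -
  have X: "open (snd c ` V)" by (rule chart_image_open'[OF c V])
  have "(chart_inv c ` snd c ` V, (\<lambda>x. x) \<circ> snd c) \<in> A"
    by (rule chart_compose[OF c X, where G="\<lambda>x. x"]) (use V X in \<open>auto simp: homeomorphism_def\<close>)
  moreover have "chart_inv c ` snd c ` V = V" using c V(2) by (force simp: image_image subset_iff)
  moreover have "(\<lambda>x. x) \<circ> snd c = snd c" by (simp add: o_def)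
  ultimately show ?thesis by simp
qed

lemma coord_field_restrict:
  assumes c: "c \<in> A" and V: "open V" "V \<subseteq> fst c" and p: "p \<in> V"
  shows "coord_field A (V, snd c) i p = coord_field A c i p"
proof (rule tangent_eqI)
  let ?d = "(V, snd c)"
  have d: "?d \<in> A" by (rule chart_restrict[OF c V])
  have pc: "p \<in> fst c" and pd: "p \<in> fst ?d" using p V by auto
  show "coord_field A ?d i p \<in> tangent_space A p" by (rule coord_field_in[OF d pd])
  show "coord_field A c i p \<in> tangent_space A p" by (rule coord_field_in[OF c pc])
  show "?d \<in> charts_at A p" by (rule charts_atI[OF d pd])
  have "jac c ?d p = jac c c p" by (simp add: jac_def)
  then have "coord_field A c i p ?d = axis i 1"
    using charts_atI[OF d pd] jac_self[OF charts_atI[OF c pc]] by (simp add: coord_field_tvec tvec_def)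
  then show "coord_field A ?d i p ?d = coord_field A c i p ?d" using coord_field_same[OF d pd] by simp
qed


text \<open>The bracket is defined chart by chart, and a direct proof of its transformation law
  would involve second derivatives of transition maps. A torsion-free connection writes it as a
  difference of tangent vectors instead.\<close>

lemma torsion_free_bracket_in:
  assumes n: "connection A (tangent_bundle A) n" and tf: "torsion_free A n"
    and X: "vector_field A U X" and Y: "vector_field A U Y" and p: "p \<in> U"
  shows "lie_bracket A X Y p \<in> tangent_space A p"
proof -
  interpret conn_vbundle A "tangent_bundle A" n by unfold_locales (rule n)
  have "lie_bracket A X Y p = n p (X p) Y - n p (Y p) X"
    using tf X Y p unfolding torsion_free_def by metis
  moreover have "n p (X p) Y \<in> tangent_space A p" "n p (Y p) X \<in> tangent_space A p"
    using conn_in[OF Y p vector_fieldD(2)[OF X p]] conn_in[OF X p vector_fieldD(2)[OF Y p]] by simp_all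
  ultimately show ?thesis using tangent_diff by simp
qed


section \<open>Iterated coordinate derivatives\<close>

text \<open>A coordinate derivative read as a function on the manifold again, so that it can be
  iterated and differentiated by \<open>tderiv\<close>; \<open>hessian\<close>, in contrast,
  differentiates on coordinate space.\<close>

definition cderiv :: "('b, 'n) chart \<Rightarrow> 'n \<Rightarrow> ('b \<Rightarrow> real) \<Rightarrow> 'b \<Rightarrow> real" where
  "cderiv c i f q = partial i (f \<circ> chart_inv c) (snd c q)"

lemma cderiv_smooth:
  "smooth_map_on A U f \<Longrightarrow> open U \<Longrightarrow> U \<subseteq> fst c \<Longrightarrow> c \<in> A \<Longrightarrow> smooth_map_on A U (cderiv c i f)"
  using smooth_map_on_partial[of U f c i] by (simp add: cderiv_def[abs_def])

lemma cderiv_cong: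
  assumes f: "smooth_map_on A U f" and U: "open U" and c: "c \<in> A" and p: "p \<in> U" "p \<in> fst c"
    and eq: "\<And>q. q \<in> U \<Longrightarrow> f q = g q"
  shows "cderiv c i f p = cderiv c i g p"
proof -
  have "frechet_derivative (f \<circ> chart_inv c) (at (snd c p)) = frechet_derivative (g \<circ> chart_inv c) (at (snd c p))"
    by (rule frechet_derivative_transform_within_open[OF _ chart_image_open[OF c U]])
      (use smooth_map_has_derivative[OF f p(1) charts_atI[OF c p(2)]] c p eq in \<open>auto simp: differentiable_def\<close>)
  then show ?thesis by (simp add: cderiv_def partial_def)
qed

lemma cderiv_cderiv:
  assumes f: "smooth_map_on A U f" and U: "open U" "U \<subseteq> fst c" and c: "c \<in> A" and p: "p \<in> U"
  shows "cderiv c i (cderiv c j f) p = partial i (partial j (f \<circ> chart_inv c)) (snd c p)"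
proof -
  let ?h = "\<lambda>x. frechet_derivative (f \<circ> chart_inv c) (at x) (axis j 1)"
  have X: "open (snd c ` U)" by (rule chart_image_open'[OF c U])
  have "smooth_on (snd c ` U) (f \<circ> chart_inv c)"
    using smooth_map_onD[OF f c] U by (simp add: Int_absorb2)
  from smooth_on_has_derivative[OF smooth_on_frechet_derivative[OF this], of "snd c p" "axis j 1"]
  have "?h differentiable (at (snd c p))" using p by (auto simp: differentiable_def)
  moreover have "?h x = (cderiv c j f \<circ> chart_inv c) x" if "x \<in> snd c ` U" for x
    using that U c by (auto simp: cderiv_def partial_def subset_iff)
  ultimately have "frechet_derivative ?h (at (snd c p)) = frechet_derivative (cderiv c j f \<circ> chart_inv c) (at (snd c p))"
    using X p by (intro frechet_derivative_transform_within_open[of _ _ "snd c ` U"]) auto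
  then show ?thesis by (simp add: cderiv_def[of c i] partial_def[abs_def])
qed

lemma cderiv_commute:
  assumes f: "smooth_map_on A U f" and U: "open U" "U \<subseteq> fst c" and c: "c \<in> A" and p: "p \<in> U"
  shows "cderiv c i (cderiv c j f) p = cderiv c j (cderiv c i f) p"
proof -
  have "smooth_on (snd c ` U) (f \<circ> chart_inv c)"
    using smooth_map_onD[OF f c] U by (simp add: Int_absorb2)
  from smooth_on_derivative_commute[OF chart_image_open'[OF c U] this, of "snd c p"]
  show ?thesis unfolding cderiv_cderiv[OF assms] using p by (simp add: partial_def[abs_def])
qed

lemma hessian_cderiv:
  assumes f: "smooth_map_on A UNIV f" and c: "c \<in> A" and p: "p \<in> fst c"
  shows "hessian c f p i j = cderiv c i (cderiv c j f) p"
  using cderiv_cderiv[OF smooth_map_on_subset[OF f, of "fst c"] chart_dom_open[OF c] _ c p] by (simp add: hessian_def)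

lemma tderiv_cderiv:
  assumes f: "smooth_map_on A U f" "open U" "p \<in> U" and v: "v \<in> tangent_space A p"
    and c: "c \<in> A" "p \<in> fst c"
  shows "tderiv A p v f = (\<Sum>i\<in>UNIV. v c $ i * cderiv c i f p)"
  using tderiv_expand[OF assms] by (simp add: cderiv_def)

end


section \<open>Flat coordinates\<close>

locale flat_mfd = smooth_mfd A + N: conn_vbundle A "tangent_bundle A" nabla
  for A :: "('b::{t2_space, second_countable_topology}, 'n::finite) chart set"
  and nabla :: "('b, 'n, ('b, 'n) tvec) conn" +
  assumes flat: "flat A (tangent_bundle A) nabla" and torsion_free: "torsion_free A nabla"
begin

lemma nabla_in:
  "vector_field A U X \<Longrightarrow> p \<in> U \<Longrightarrow> v \<in> tangent_space A p \<Longrightarrow> nabla p v X \<in> tangent_space A p"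
  using N.conn_in by simp

lemma torsion:
  "vector_field A U X \<Longrightarrow> vector_field A U Y \<Longrightarrow> p \<in> U \<Longrightarrow> nabla p (X p) Y - nabla p (Y p) X = lie_bracket A X Y p"
  using torsion_free unfolding torsion_free_def by blast

lemmas bracket_in = torsion_free_bracket_in[OF N.connection torsion_free]

text \<open>In their own chart the coordinate fields have constant components, so the bracket
  vanishes there; being tangent, it then vanishes in all charts.\<close>

lemma coord_bracket:
  assumes c: "c \<in> A" and p: "p \<in> fst c"
  shows "lie_bracket A (coord_field A c i) (coord_field A c j) p = 0"
proof (rule tangent_eqI[OF bracket_in[OF coord_vector_field[OF c] coord_vector_field[OF c] p] tangent_zero charts_atI[OF c p]])
  have "frechet_derivative (\<lambda>x. coord_field A c k (chart_inv c x) c) (at (snd c p)) =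
      frechet_derivative (\<lambda>x. axis k 1) (at (snd c p))" for k
    by (rule frechet_derivative_transform_within_open[symmetric, OF _ chart_ran_open[OF c]])
      (use c p in \<open>auto simp: coord_field_same\<close>)
  then show "lie_bracket A (coord_field A c i) (coord_field A c j) p c = 0 c"
    using charts_atI[OF c p] by (simp add: lie_bracket_def)
qed

lemma flat_coordsD:
  assumes "flat_coords A nabla c"
  shows "c \<in> A" "p \<in> fst c \<Longrightarrow> v \<in> tangent_space A p \<Longrightarrow> nabla p v (coord_field A c i) = 0"
  using assms by (auto simp: flat_coords_def)

lemma flat_coords_restrict:
  assumes c: "flat_coords A nabla c" and V: "open V" "V \<subseteq> fst c"
  shows "flat_coords A nabla (V, snd c)"
  unfolding flat_coords_def
proof (intro conjI ballI allI)
  note cA = flat_coordsD(1)[OF c]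
  show d: "(V, snd c) \<in> A" by (rule chart_restrict[OF cA V])
  fix p v i assume "p \<in> fst (V, snd c)" and v: "v \<in> tangent_space A p"
  then have p: "p \<in> V" by simp
  have "nabla p v (coord_field A c i) = nabla p v (coord_field A (V, snd c) i)"
    by (rule N.conn_cong'[OF vector_field_subset[OF coord_vector_field[OF cA] V] _ p v])
      (rule coord_field_restrict[OF cA V, symmetric])
  then show "nabla p v (coord_field A (V, snd c) i) = 0" using flat_coordsD(2)[OF c _ v] p V by auto
qed

text \<open>The differentials of flat coordinates are the parallel covector fields: the latter form, in an
  arbitrary chart, an integrable linear system with matrix the Christoffel symbols \<open>\<gamma>\<close>, and
  they are closed because \<open>\<gamma>\<close> is symmetric.\<close>

lemma flat_coords_ex: "\<exists>c. flat_coords A nabla c \<and> p0 \<in> fst c"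
proof -
  obtain c where c: "c \<in> A" "p0 \<in> fst c" using charts_at_ex[of p0] charts_atD by blast
  let ?O = "snd c ` fst c"
  note O = chart_ran_open[OF c(1)] and dom = chart_dom_open[OF c(1)]
  let ?e = "coord_field A c"
  note ev = coord_vector_field[OF c(1)] and ein = coord_field_in[OF c(1)]
  \<comment> \<open>Christoffel symbols of \<open>nabla\<close> in the chart \<open>c\<close>, kept
    as functions on the manifold: the last index is the component, the first one the direction of
    differentiation.\<close>
  define \<gamma> where "\<gamma> i j k q = nabla q (?e i q) (?e j) c $ k" for i j k q
  have nv: "vector_field A (fst c) (\<lambda>q. nabla q (?e i q) (?e j))" for i j
    using N.conn_smooth[OF ev ev] .
  have \<gamma>sm: "smooth_map_on A (fst c) (\<gamma> i j k)" for i j k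
    unfolding \<gamma>_def[abs_def] by (rule vector_field_component[OF nv c(1) order_refl])
  have nexp: "nabla q (?e i q) (?e j) = (\<Sum>k\<in>UNIV. \<gamma> i j k q *\<^sub>R ?e k q)" if "q \<in> fst c" for i j q
    unfolding \<gamma>_def by (rule tangent_expand[OF nabla_in[OF ev that ein[OF that]] c(1) that])
  have nexpv: "nabla q v (?e j) = (\<Sum>k\<in>UNIV. (\<Sum>i\<in>UNIV. v c $ i * \<gamma> i j k q) *\<^sub>R ?e k q)"
    if q: "q \<in> fst c" and v: "v \<in> tangent_space A q" for j q v
  proof -
    have "nabla q v (?e j) = nabla q (\<Sum>i\<in>UNIV. (v c $ i) *\<^sub>R ?e i q) (?e j)"
      using tangent_expand[OF v c(1) q] by simp
    also have "\<dots> = (\<Sum>i\<in>UNIV. (v c $ i) *\<^sub>R nabla q (?e i q) (?e j))"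
      by (rule los_lincomb[OF N.conn_linear[OF ev q] subspace_tangent ein[OF q]])
    also have "\<dots> = (\<Sum>i\<in>UNIV. \<Sum>k\<in>UNIV. (v c $ i * \<gamma> i j k q) *\<^sub>R ?e k q)"
      by (simp add: nexp[OF q] scaleR_sum_right)
    also have "\<dots> = (\<Sum>k\<in>UNIV. \<Sum>i\<in>UNIV. (v c $ i * \<gamma> i j k q) *\<^sub>R ?e k q)" by (rule sum.swap)
    finally show ?thesis by (simp add: scaleR_sum_left)
  qed
  have \<gamma>sym: "\<gamma> i j k q = \<gamma> j i k q" if q: "q \<in> fst c" for i j k q
    using torsion[OF ev ev q, of i j] coord_bracket[OF c(1) q, of i j] by (simp add: \<gamma>_def)
  \<comment> \<open>Vanishing curvature on coordinate fields: as their bracket is 0, the two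
    iterated covariant derivatives have the same components.\<close>
  have curv: "cderiv c i (\<gamma> j k m) q + (\<Sum>l\<in>UNIV. \<gamma> j k l q * \<gamma> i l m q) =
      cderiv c j (\<gamma> i k m) q + (\<Sum>l\<in>UNIV. \<gamma> i k l q * \<gamma> j l m q)" if q: "q \<in> fst c" for i j k m q
  proof -
    have second: "nabla q (?e i q) (\<lambda>q. nabla q (?e j q) (?e k)) c $ m =
        cderiv c i (\<gamma> j k m) q + (\<Sum>l\<in>UNIV. \<gamma> j k l q * \<gamma> i l m q)" for i j
    proof -
      have "nabla q (?e i q) (\<lambda>q. nabla q (?e j q) (?e k)) = nabla q (?e i q) (\<lambda>q. \<Sum>l\<in>UNIV. \<gamma> j k l q *\<^sub>R ?e l q)"
        by (rule N.conn_cong'[OF nv nexp q ein[OF q]])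
      also have "\<dots> = (\<Sum>l\<in>UNIV. tderiv A q (?e i q) (\<gamma> j k l) *\<^sub>R ?e l q + \<gamma> j k l q *\<^sub>R nabla q (?e i q) (?e l))"
        by (rule N.conn_lincomb[OF \<gamma>sm ev dom q ein[OF q]])
      finally show ?thesis
        by (simp add: sum_fun_apply scaleR_fun_apply coord_field_same[OF c(1) q] sum.distrib \<gamma>_def[symmetric]
            tderiv_coord[OF \<gamma>sm dom q c(1) q] cderiv_def axis_def if_distrib[of "\<lambda>x. _ * x"] cong: if_cong)
    qed
    have "nabla q (?e i q) (\<lambda>q. nabla q (?e j q) (?e k)) - nabla q (?e j q) (\<lambda>q. nabla q (?e i q) (?e k))
        - nabla q (lie_bracket A (?e i) (?e j) q) (?e k) = 0"
      using flat ev q unfolding flat_def by blast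
    moreover have "nabla q 0 (?e k) = 0"
      by (rule los_zero[OF N.conn_linear[OF ev q] subspace_tangent])
    ultimately have "nabla q (?e i q) (\<lambda>q. nabla q (?e j q) (?e k)) = nabla q (?e j q) (\<lambda>q. nabla q (?e i q) (?e k))"
      by (simp add: coord_bracket[OF c(1) q])
    then show ?thesis using second[of i j] second[of j i] by simp
  qed
  define \<Gamma> where "\<Gamma> i j k x = \<gamma> i j k (chart_inv c x)" for i j k x
  have \<Gamma>sm: "smooth_on ?O (\<Gamma> i j k)" for i j k
    using smooth_map_onD[OF \<gamma>sm c(1)] by (simp add: \<Gamma>_def[abs_def] o_def)
  have \<Gamma>sym: "\<Gamma> i j k x = \<Gamma> j i k x" if "x \<in> ?O" for i j k x
    unfolding \<Gamma>_def by (rule \<gamma>sym) (use that c in auto)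
  have \<Gamma>curv: "partial i (\<Gamma> j k m) x + (\<Sum>l\<in>UNIV. \<Gamma> j k l x * \<Gamma> i l m x) =
      partial j (\<Gamma> i k m) x + (\<Sum>l\<in>UNIV. \<Gamma> i k l x * \<Gamma> j l m x)" if x: "x \<in> ?O" for i j k m x
    using curv[of "chart_inv c x" i j k m] x c(1) by (auto simp: cderiv_def \<Gamma>_def[abs_def] o_def)
  have \<Gamma>D: "(\<Gamma> i k l has_derivative (\<lambda>w. \<Sum>j\<in>UNIV. w $ j * partial j (\<Gamma> i k l) x)) (at x)" if x: "x \<in> ?O" for i k l x
  proof -
    have d: "(\<Gamma> i k l has_derivative frechet_derivative (\<Gamma> i k l) (at x)) (at x)"
      by (rule smooth_on_has_derivative[OF \<Gamma>sm x])
    have "frechet_derivative (\<Gamma> i k l) (at x) w = (\<Sum>j\<in>UNIV. w $ j * partial j (\<Gamma> i k l) x)" for w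
      by (subst vec_expand[of w])
        (simp add: linear_sum[OF has_derivative_linear[OF d]] linear_cmul[OF has_derivative_linear[OF d]] partial_def)
    then show ?thesis using d by (metis (no_types, lifting) ext)
  qed
  \<comment> \<open>The equation \<open>du(v) = G x v u\<close> says that the covector field with
    components \<open>u\<close> is parallel: the derivative of \<open>u $ k\<close> in the
    \<open>i\<close>-th direction is the sum over \<open>l\<close> of
    \<open>\<Gamma> i k l * u $ l\<close>.\<close>
  define G where "G x v e = (\<chi> k. \<Sum>i\<in>UNIV. \<Sum>l\<in>UNIV. v $ i * e $ l * \<Gamma> i k l x)" for x and v e :: "real^'n"
  define x0 where "x0 = snd c p0"
  have x0: "x0 \<in> ?O" using c by (simp add: x0_def)
  have Gsm: "smooth_on ?O (\<lambda>x. G x v e)" for v e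
    unfolding G_def by (subst smooth_on_vec_iff[OF O])
      (auto intro!: smooth_on_sum smooth_on_mult O \<Gamma>sm)
  have Glin1: "linear (\<lambda>v. G x v e)" and Glin2: "linear (G x v)" for x v e
    by (auto intro!: linearI simp: G_def vec_eq_iff algebra_simps sum.distrib sum_distrib_left)
  have GD: "frechet_derivative (\<lambda>x. G x v e) (at x) w =
      (\<chi> k. \<Sum>i\<in>UNIV. \<Sum>l\<in>UNIV. v $ i * e $ l * (\<Sum>j\<in>UNIV. w $ j * partial j (\<Gamma> i k l) x))" if x: "x \<in> ?O" for x v e w
  proof -
    have "((\<lambda>x. G x v e) has_derivative (\<lambda>w. \<chi> k. \<Sum>i\<in>UNIV. \<Sum>l\<in>UNIV.
        v $ i * e $ l * (\<Sum>j\<in>UNIV. w $ j * partial j (\<Gamma> i k l) x))) (at x)"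
      unfolding G_def
      by (intro has_derivative_vec_lambda has_derivative_sum has_derivative_mult_right \<Gamma>D[OF x])
    from frechet_derivative_at[OF this] show ?thesis by (rule fun_cong[symmetric])
  qed
  have Gint: "frechet_derivative (\<lambda>x. G x v e) (at x) w + G x v (G x w e) =
      frechet_derivative (\<lambda>x. G x w e) (at x) v + G x w (G x v e)" if x: "x \<in> ?O" for x v w e
  proof -
    \<comment> \<open>Coefficients of the integrability expression as a trilinear form in
      \<open>v\<close>, \<open>w\<close> and \<open>e\<close>. Their symmetry in the first two
      indices is the vanishing of the curvature.\<close>
    define C where "C i j k m = partial j (\<Gamma> i k m) x + (\<Sum>l\<in>UNIV. \<Gamma> i k l x * \<Gamma> j l m x)" for i j k m
    have Csym: "C i j k m = C j i k m" for i j k m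
      unfolding C_def using \<Gamma>curv[OF x, of j i k m] by simp
    have form: "(frechet_derivative (\<lambda>x. G x v e) (at x) w + G x v (G x w e)) $ k =
        (\<Sum>i\<in>UNIV. \<Sum>j\<in>UNIV. \<Sum>m\<in>UNIV. v $ i * w $ j * e $ m * C i j k m)" for v w k
    proof -
      have 1: "(\<Sum>l\<in>UNIV. v $ i * e $ l * (\<Sum>j\<in>UNIV. w $ j * partial j (\<Gamma> i k l) x)) =
          (\<Sum>j\<in>UNIV. \<Sum>m\<in>UNIV. v $ i * w $ j * e $ m * partial j (\<Gamma> i k m) x)" for i
        by (simp add: sum_distrib_left mult_ac) (rule sum.swap)
      have 2: "(\<Sum>l\<in>UNIV. v $ i * (\<Sum>j\<in>UNIV. \<Sum>m\<in>UNIV. w $ j * e $ m * \<Gamma> j l m x) * \<Gamma> i k l x) =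
          (\<Sum>j\<in>UNIV. \<Sum>m\<in>UNIV. v $ i * w $ j * e $ m * (\<Sum>l\<in>UNIV. \<Gamma> i k l x * \<Gamma> j l m x))" for i
      proof -
        have "(\<Sum>l\<in>UNIV. v $ i * (\<Sum>j\<in>UNIV. \<Sum>m\<in>UNIV. w $ j * e $ m * \<Gamma> j l m x) * \<Gamma> i k l x) =
          (\<Sum>l\<in>UNIV. \<Sum>j\<in>UNIV. \<Sum>m\<in>UNIV. v $ i * w $ j * e $ m * (\<Gamma> i k l x * \<Gamma> j l m x))"
          by (simp add: sum_distrib_left sum_distrib_right mult_ac)
        also have "\<dots> = (\<Sum>j\<in>UNIV. \<Sum>l\<in>UNIV. \<Sum>m\<in>UNIV. v $ i * w $ j * e $ m * (\<Gamma> i k l x * \<Gamma> j l m x))"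
          by (rule sum.swap)
        also have "\<dots> = (\<Sum>j\<in>UNIV. \<Sum>m\<in>UNIV. \<Sum>l\<in>UNIV. v $ i * w $ j * e $ m * (\<Gamma> i k l x * \<Gamma> j l m x))"
          by (rule sum.cong[OF refl sum.swap])
        finally show ?thesis by (simp add: sum_distrib_left)
      qed
      show ?thesis
        unfolding GD[OF x] unfolding G_def C_def
        by (simp add: 1 2 sum.distrib distrib_left)
    qed
    have "(\<Sum>i\<in>UNIV. \<Sum>j\<in>UNIV. \<Sum>m\<in>UNIV. v $ i * w $ j * e $ m * C i j k m) =
        (\<Sum>i\<in>UNIV. \<Sum>j\<in>UNIV. \<Sum>m\<in>UNIV. w $ i * v $ j * e $ m * C i j k m)" for k
      by (subst sum.swap) (simp add: Csym mult_ac)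
    then show ?thesis by (simp only: vec_eq_iff form) blast
  qed
  obtain r where r: "r > 0" "ball x0 r \<subseteq> ?O"
    and sol: "\<And>u0. \<exists>u. u x0 = u0 \<and> (\<forall>x\<in>ball x0 r. (u has_derivative (\<lambda>v. G x v (u x))) (at x))"
    by (rule linear_frobenius[OF O x0 Glin1 Glin2 Gsm Gint]) (assumption, rule that)
  let ?S = "ball x0 r"
  have S: "open ?S" "convex ?S" "x0 \<in> ?S" using r by auto
  \<comment> \<open>The parallel covector fields start as the standard coframe at \<open>x0\<close>,
    so that the map formed by their primitives will have the identity as derivative there.\<close>
  have "\<exists>u. \<forall>a. u a x0 = axis a 1 \<and> (\<forall>x\<in>?S. (u a has_derivative (\<lambda>v. G x v (u a x))) (at x))"
    using sol by (intro choice) blast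
  then obtain u :: "'n \<Rightarrow> real^'n \<Rightarrow> real^'n" where u0: "\<And>a. u a x0 = axis a 1"
    and uD: "\<And>a x. x \<in> ?S \<Longrightarrow> (u a has_derivative (\<lambda>v. G x v (u a x))) (at x)" by blast
  \<comment> \<open>Bootstrapping: the derivative of \<open>u a\<close> is \<open>G\<close> applied
    to \<open>u a\<close> and hence as regular as \<open>u a\<close> itself.\<close>
  have usm: "smooth_on ?S (u a)" for a
  proof (rule smooth_onI)
    fix k show "Ck_on k ?S (u a)"
    proof (induction k)
      case 0
      then show ?case
        by (auto intro!: continuous_at_imp_continuous_on has_derivative_continuous[OF uD])
    next
      case (Suc k)
      have "Ck_on k ?S (\<lambda>x. G x v (u a x))" for v
        unfolding G_def
      proof (subst Ck_on_vec_iff[OF S(1)], intro allI, simp, intro Ck_on_sum Ck_on_mult S(1) Ck_on_const)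
        show "Ck_on k ?S (\<lambda>x. u a x $ l)" for l
          using Suc.IH by (subst (asm) Ck_on_vec_iff[OF S(1)]) blast
        show "Ck_on k ?S (\<Gamma> i j l)" for i j l
          by (rule Ck_on_subset[OF smooth_onD[OF \<Gamma>sm] r(2)])
      qed
      from Ck_on_SucI[OF uD this S(1)] show ?case .
    qed
  qed
  define f where "f a x = integral {0..1} (\<lambda>t. u a (x0 + t *\<^sub>R (x - x0)) \<bullet> (x - x0))" for a x
  have fD: "(f a has_derivative (\<lambda>v. u a x \<bullet> v)) (at x)" if x: "x \<in> ?S" for a x
  proof -
    \<comment> \<open>Symmetry of \<open>\<Gamma>\<close> in its first two indices makes the
      derivative of the covector field symmetric. The remainder in the homotopy formula therefore
      vanishes and \<open>f a\<close> is a primitive of \<open>u a\<close>.\<close>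
    have sym: "G y v e \<bullet> w = G y w e \<bullet> v" if "y \<in> ?S" for y v w e
    proof -
      have "G y v e \<bullet> w = (\<Sum>k\<in>UNIV. \<Sum>i\<in>UNIV. \<Sum>l\<in>UNIV. v $ i * w $ k * e $ l * \<Gamma> i k l y)" for v w
        by (simp add: G_def inner_vec_def sum_distrib_right sum_distrib_left mult_ac)
      moreover have "(\<Sum>k\<in>UNIV. \<Sum>i\<in>UNIV. \<Sum>l\<in>UNIV. v $ i * w $ k * e $ l * \<Gamma> i k l y) =
          (\<Sum>k\<in>UNIV. \<Sum>i\<in>UNIV. \<Sum>l\<in>UNIV. w $ i * v $ k * e $ l * \<Gamma> i k l y)"
        by (subst sum.swap) (use \<Gamma>sym[of y] that r in \<open>auto intro!: sum.cong simp: mult_ac\<close>)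
      ultimately show ?thesis by simp
    qed
    have "(f a has_derivative (\<lambda>v. u a x \<bullet> v + integral {0..1} (\<lambda>t. t *\<^sub>R
        (G (x0 + t *\<^sub>R (x - x0)) v (u a (x0 + t *\<^sub>R (x - x0))) \<bullet> (x - x0)
        - G (x0 + t *\<^sub>R (x - x0)) (x - x0) (u a (x0 + t *\<^sub>R (x - x0))) \<bullet> v)))) (at x)"
      unfolding f_def
    proof (rule radial_primitive_has_derivative[OF S x])
      show "linear (\<lambda>w. u a y \<bullet> w)" for y by (simp add: bounded_linear.linear bounded_linear_inner_right)
      show "((\<lambda>y. u a y \<bullet> w) has_derivative (\<lambda>v. G y v (u a y) \<bullet> w)) (at y)" if "y \<in> ?S" for y w
        by (rule has_derivative_inner_left[OF uD[OF that]])
      show "continuous_on ?S (\<lambda>y. G y v (u a y) \<bullet> w)" for v w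
      proof -
        have "continuous_on ?S (\<Gamma> i j l)" for i j l
          by (rule continuous_on_subset[OF smooth_on_imp_continuous_on[OF \<Gamma>sm] r(2)])
        then show ?thesis unfolding G_def
          by (intro continuous_intros continuous_on_vec_lambda smooth_on_imp_continuous_on[OF usm])
      qed
    qed
    also have "(\<lambda>v. u a x \<bullet> v + integral {0..1} (\<lambda>t. t *\<^sub>R
        (G (x0 + t *\<^sub>R (x - x0)) v (u a (x0 + t *\<^sub>R (x - x0))) \<bullet> (x - x0)
        - G (x0 + t *\<^sub>R (x - x0)) (x - x0) (u a (x0 + t *\<^sub>R (x - x0))) \<bullet> v))) = (\<lambda>v. u a x \<bullet> v)"
    proof
      fix v
      have "integral {0..1} (\<lambda>t. t *\<^sub>R
        (G (x0 + t *\<^sub>R (x - x0)) v (u a (x0 + t *\<^sub>R (x - x0))) \<bullet> (x - x0)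
        - G (x0 + t *\<^sub>R (x - x0)) (x - x0) (u a (x0 + t *\<^sub>R (x - x0))) \<bullet> v)) = integral {0..1} (\<lambda>t::real. 0)"
        by (intro integral_cong) (simp add: sym[OF radial_mem[OF S(2,3) x]])
      then show "u a x \<bullet> v + integral {0..1} (\<lambda>t. t *\<^sub>R
        (G (x0 + t *\<^sub>R (x - x0)) v (u a (x0 + t *\<^sub>R (x - x0))) \<bullet> (x - x0)
        - G (x0 + t *\<^sub>R (x - x0)) (x - x0) (u a (x0 + t *\<^sub>R (x - x0))) \<bullet> v)) = u a x \<bullet> v" by simp
    qed
    finally show ?thesis .
  qed
  define F where "F x = (\<chi> a. f a x)" for x
  have FD: "(F has_derivative (\<lambda>v. \<chi> a. u a x \<bullet> v)) (at x)" if "x \<in> ?S" for x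
    unfolding F_def by (rule has_derivative_vec_lambda[OF fD[OF that]])
  have Fsm: "smooth_on ?S F"
  proof (rule smooth_onI)
    fix k
    have "Ck_on k ?S (\<lambda>x. \<chi> a. u a x \<bullet> v)" for v
      by (subst Ck_on_vec_iff[OF S(1)]) (auto intro!: Ck_on_inner S(1) smooth_onD[OF usm])
    with FD have "Ck_on (Suc k) ?S F" using S(1) by (rule Ck_on_SucI)
    then show "Ck_on k ?S F" by (rule Ck_on_Suc_imp)
  qed
  have FD': "frechet_derivative F (at x) v = (\<chi> a. u a x \<bullet> v)" if "x \<in> ?S" for x v
    using frechet_derivative_at[OF FD[OF that]] by metis
  \<comment> \<open>At \<open>x0\<close> the derivative of \<open>F\<close> is the identity, because
    of the initial values \<open>axis a 1\<close>.\<close>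
  have "inj (frechet_derivative F (at x0))"
    by (rule injI) (simp add: FD'[OF S(3)] u0 inner_axis' vec_eq_iff)
  from smooth_inverse_function[OF S(1) Fsm S(3) this]
  obtain V H where V: "open V" "V \<subseteq> ?S" "x0 \<in> V" "open (F ` V)" "homeomorphism V (F ` V) F H" "smooth_on (F ` V) H"
    by metis
  have VO: "V \<subseteq> ?O" using V(2) r(2) by blast
  define d where "d = (chart_inv c ` V, F \<circ> snd c)"
  have d: "d \<in> A" unfolding d_def
    by (rule chart_compose[OF c(1) V(1) VO smooth_on_subset[OF Fsm V(2)] V(5) V(4) V(6)])
  have p0d: "p0 \<in> fst d" using V(3) c by (force simp: d_def x0_def)
  have dc: "fst d \<subseteq> fst c" unfolding d_def using chart_preimage_subset[OF c(1) VO] by simp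
  have sndV: "snd c q \<in> V" if "q \<in> fst d" for q
    using that VO c(1) by (auto simp: d_def subset_iff)
  have jcd: "jac c d q w = (\<chi> a. u a (snd c q) \<bullet> w)" if q: "q \<in> fst d" for q w
  proof -
    have x: "snd c q \<in> V" by (rule sndV[OF q])
    have "(snd d \<circ> chart_inv c has_derivative (\<lambda>v. \<chi> a. u a (snd c q) \<bullet> v)) (at (snd c q))"
    proof (rule has_derivative_transform_within_open[OF FD V(1) x])
      show "snd c q \<in> ?S" using x V(2) by blast
      show "F y = (snd d \<circ> chart_inv c) y" if "y \<in> V" for y using that VO c(1) by (auto simp: d_def subset_iff)
    qed
    from frechet_derivative_at[OF this] show ?thesis unfolding jac_def by metis
  qed
  \<comment> \<open>The components of the fields \<open>u a\<close> form the Jacobian from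
    \<open>c\<close> to \<open>d\<close>; this matrix expresses the old coordinate fields through
    the new ones.\<close>
  have coordc: "?e k q = (\<Sum>a\<in>UNIV. (u a (snd c q) $ k) *\<^sub>R coord_field A d a q)" if q: "q \<in> fst d" for k q
  proof -
    have qc: "q \<in> fst c" using q dc by blast
    have "?e k q d $ a = u a (snd c q) $ k" for a
      using charts_atI[OF d q] by (simp add: coord_field_tvec tvec_def jcd[OF q] inner_axis)
    then show ?thesis using tangent_expand[OF ein[OF qc, of k] d q] by simp
  qed
  have "nabla q v (coord_field A d b) = 0" if q: "q \<in> fst d" and v: "v \<in> tangent_space A q" for q v b
  proof -
    have qc: "q \<in> fst c" using q dc by blast
    have x: "snd c q \<in> ?S" using sndV[OF q] V(2) by blast
    note od = chart_dom_open[OF d]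
    let ?u = "\<lambda>a k q. u a (snd c q) $ k" and ?N = "\<lambda>a. nabla q v (coord_field A d a)"
    have us: "smooth_map_on A (fst d) (?u a k)" for a k
    proof (rule smooth_map_on_pullback[OF c(1) od dc])
      have "snd c ` fst d \<subseteq> ?S" using sndV V(2) by blast
      moreover have "smooth_on ?S (\<lambda>x. u a x $ k)" using usm smooth_on_vec_iff[OF S(1)] by blast
      ultimately show "smooth_on (snd c ` fst d) (\<lambda>x. u a x $ k)" using smooth_on_subset by blast
    qed
    have tdu: "tderiv A q v (?u a k) = (\<Sum>l\<in>UNIV. (\<Sum>i\<in>UNIV. v c $ i * \<gamma> i k l q) * ?u a l q)" for a k
    proof -
      have "((\<lambda>x. u a x $ k) has_derivative (\<lambda>w. G (snd c q) w (u a (snd c q)) $ k)) (at (snd c q))"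
        by (rule bounded_linear.has_derivative[OF bounded_linear_vec_nth uD[OF x]])
      then have "(?u a k \<circ> chart_inv c has_derivative (\<lambda>w. G (snd c q) w (u a (snd c q)) $ k)) (at (snd c q))"
        by (rule has_derivative_transform_within_open[OF _ chart_ran_open[OF c(1)]]) (use c(1) qc in auto)
      from frechet_derivative_at[OF this]
      have "tderiv A q v (?u a k) = G (snd c q) (v c) (u a (snd c q)) $ k"
        using tderiv_eq[OF us od q v charts_atI[OF c(1) qc]] by metis
      also have "\<dots> = (\<Sum>l\<in>UNIV. (\<Sum>i\<in>UNIV. v c $ i * \<gamma> i k l q) * ?u a l q)"
        using qc c(1) by (simp add: G_def \<Gamma>_def sum_distrib_right sum_distrib_left mult_ac) (rule sum.swap)
      finally show ?thesis .
    qed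
    \<comment> \<open>The covariant derivative of \<open>?e k\<close> is computed in two ways: by
      Christoffel symbols, and by the product rule in the frame of \<open>d\<close>. The parallel
      equation \<open>tdu\<close> makes the derivative terms cancel, which leaves a linear relation
      between the vectors \<open>?N a\<close>.\<close>
    have zero: "(\<Sum>a\<in>UNIV. ?u a k q *\<^sub>R ?N a) = 0" for k
    proof -
      have "nabla q v (?e k) = nabla q v (\<lambda>q. \<Sum>a\<in>UNIV. ?u a k q *\<^sub>R coord_field A d a q)"
        by (rule N.conn_cong'[OF vector_field_subset[OF ev od dc] coordc q v])
      also have "\<dots> = (\<Sum>a\<in>UNIV. tderiv A q v (?u a k) *\<^sub>R coord_field A d a q + ?u a k q *\<^sub>R ?N a)"
        by (rule N.conn_lincomb[OF us coord_vector_field[OF d] od q v])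
      finally have 1: "nabla q v (?e k) = (\<Sum>a\<in>UNIV. tderiv A q v (?u a k) *\<^sub>R coord_field A d a q) +
          (\<Sum>a\<in>UNIV. ?u a k q *\<^sub>R ?N a)" by (simp add: sum.distrib)
      have "nabla q v (?e k) = (\<Sum>l\<in>UNIV. (\<Sum>i\<in>UNIV. v c $ i * \<gamma> i k l q) *\<^sub>R
          (\<Sum>a\<in>UNIV. ?u a l q *\<^sub>R coord_field A d a q))"
        unfolding nexpv[OF qc v] coordc[OF q] ..
      also have "\<dots> = (\<Sum>l\<in>UNIV. \<Sum>a\<in>UNIV. ((\<Sum>i\<in>UNIV. v c $ i * \<gamma> i k l q) * ?u a l q) *\<^sub>R coord_field A d a q)"
        by (simp add: scaleR_sum_right)
      also have "\<dots> = (\<Sum>a\<in>UNIV. tderiv A q v (?u a k) *\<^sub>R coord_field A d a q)"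
        unfolding tdu scaleR_sum_left by (rule sum.swap)
      finally show ?thesis using 1 by simp
    qed
    \<comment> \<open>Column \<open>b\<close> of the Jacobian from \<open>d\<close> back to
      \<open>c\<close>. It inverts the matrix of components of \<open>u\<close> and so isolates
      \<open>?N b\<close> from the relations \<open>zero\<close>.\<close>
    define P where "P k = jac d c q (axis b 1) $ k" for k
    have "(\<Sum>k\<in>UNIV. P k * ?u a k q) = (if a = b then 1 else 0)" for a
    proof -
      have "jac c d q (jac d c q (axis b 1)) = axis b 1"
        using jac_comp[OF charts_atI[OF d q] charts_atI[OF c(1) qc] charts_atI[OF d q]] jac_self[OF charts_atI[OF d q]] by simp
      then have "u a (snd c q) \<bullet> jac d c q (axis b 1) = axis b 1 $ a"
        by (simp add: jcd[OF q] vec_eq_iff)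
      then show ?thesis by (simp add: inner_vec_def P_def axis_def mult.commute)
    qed
    then have "?N b = (\<Sum>a\<in>UNIV. (\<Sum>k\<in>UNIV. P k * ?u a k q) *\<^sub>R ?N a)"
      by (simp add: if_distrib[of "\<lambda>x. x *\<^sub>R _"] cong: if_cong)
    also have "\<dots> = (\<Sum>a\<in>UNIV. \<Sum>k\<in>UNIV. P k *\<^sub>R (?u a k q *\<^sub>R ?N a))" by (simp add: scaleR_sum_left)
    also have "\<dots> = (\<Sum>k\<in>UNIV. \<Sum>a\<in>UNIV. P k *\<^sub>R (?u a k q *\<^sub>R ?N a))" by (rule sum.swap)
    also have "\<dots> = 0" by (simp only: scaleR_sum_right[symmetric] zero scaleR_zero_right sum.neutral_const)
    finally show ?thesis .
  qed
  then have "flat_coords A nabla d" using d by (simp add: flat_coords_def)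
  then show ?thesis using p0d by blast
qed

end


section \<open>Hessian metrics\<close>

context flat_mfd
begin

text \<open>The left-hand side does not involve the chart, so the Hessian is a tensor on flat charts.\<close>

lemma hessian_intrinsic:
  assumes \<Psi>: "smooth_map_on A UNIV \<Psi>" and c: "flat_coords A nabla c" and Y: "vector_field A U Y"
    and p: "p \<in> U" "p \<in> fst c" and v: "v \<in> tangent_space A p"
  shows "tderiv A p v (\<lambda>q. tderiv A q (Y q) \<Psi>) - tderiv A p (nabla p v Y) \<Psi> =
    (\<Sum>i\<in>UNIV. \<Sum>j\<in>UNIV. hessian c \<Psi> p i j * v c $ i * Y p c $ j)"
proof -
  note cA = flat_coordsD(1)[OF c]
  let ?W = "U \<inter> fst c"
  have W: "open ?W" "p \<in> ?W" using vector_fieldD(1)[OF Y] chart_dom_open[OF cA] p by auto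
  have YW: "vector_field A ?W Y" by (rule vector_field_subset[OF Y W(1)]) simp
  have Yc: "smooth_map_on A ?W (\<lambda>q. Y q c $ j)" for j by (rule vector_field_component[OF YW cA]) simp
  have eW: "vector_field A ?W (coord_field A c j)" for j
    by (rule vector_field_subset[OF coord_vector_field[OF cA] W(1)]) simp
  have \<Psi>W: "smooth_map_on A ?W \<Psi>" by (rule smooth_map_on_subset[OF \<Psi>]) simp
  have d\<Psi>: "smooth_map_on A ?W (cderiv c j \<Psi>)" for j by (rule cderiv_smooth[OF \<Psi>W W(1) _ cA]) simp
  have "tderiv A p v (\<lambda>q. tderiv A q (Y q) \<Psi>) = tderiv A p v (\<lambda>q. \<Sum>j\<in>UNIV. Y q c $ j * cderiv c j \<Psi> q)"
    by (rule tderiv_cong[OF tderiv_smooth[OF \<Psi>W YW] W v])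
      (use tderiv_cderiv[OF \<Psi>W W(1) _ vector_fieldD(2)[OF YW] cA] in auto)
  also have "\<dots> = (\<Sum>j\<in>UNIV. tderiv A p v (\<lambda>q. Y q c $ j * cderiv c j \<Psi> q))"
    by (rule tderiv_sum[OF smooth_map_on_mult[OF W(1) Yc d\<Psi>] W v])
  also have "\<dots> = (\<Sum>j\<in>UNIV. Y p c $ j * tderiv A p v (cderiv c j \<Psi>) + tderiv A p v (\<lambda>q. Y q c $ j) * cderiv c j \<Psi> p)"
    by (intro sum.cong refl tderiv_mult[OF Yc d\<Psi> W v])
  finally have 1: "tderiv A p v (\<lambda>q. tderiv A q (Y q) \<Psi>) =
    (\<Sum>j\<in>UNIV. Y p c $ j * tderiv A p v (cderiv c j \<Psi>)) + (\<Sum>j\<in>UNIV. tderiv A p v (\<lambda>q. Y q c $ j) * cderiv c j \<Psi> p)"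
    by (simp add: sum.distrib)
  have "nabla p v Y = nabla p v (\<lambda>q. \<Sum>j\<in>UNIV. Y q c $ j *\<^sub>R coord_field A c j q)"
    by (rule N.conn_cong'[OF YW _ W(2) v]) (use tangent_expand[OF vector_fieldD(2)[OF YW] cA] in auto)
  also have "\<dots> = (\<Sum>j\<in>UNIV. tderiv A p v (\<lambda>q. Y q c $ j) *\<^sub>R coord_field A c j p)"
    by (simp add: N.conn_lincomb[OF Yc eW W v] flat_coordsD(2)[OF c p(2) v])
  finally have 2: "nabla p v Y = (\<Sum>j\<in>UNIV. tderiv A p v (\<lambda>q. Y q c $ j) *\<^sub>R coord_field A c j p)" .
  have "tderiv A p (nabla p v Y) \<Psi> = (\<Sum>j\<in>UNIV. tderiv A p v (\<lambda>q. Y q c $ j) * cderiv c j \<Psi> p)"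
    using los_lincomb[OF tderiv_los[OF \<Psi>W W] subspace_tangent coord_field_in[OF cA p(2)]]
    by (simp add: 2 tderiv_coord[OF \<Psi>W W cA p(2)] cderiv_def)
  with 1 have "tderiv A p v (\<lambda>q. tderiv A q (Y q) \<Psi>) - tderiv A p (nabla p v Y) \<Psi> =
      (\<Sum>j\<in>UNIV. Y p c $ j * tderiv A p v (cderiv c j \<Psi>))" by simp
  also have "\<dots> = (\<Sum>j\<in>UNIV. Y p c $ j * (\<Sum>i\<in>UNIV. v c $ i * hessian c \<Psi> p i j))"
    by (simp add: tderiv_cderiv[OF d\<Psi> W v cA p(2)] hessian_cderiv[OF \<Psi> cA p(2)])
  also have "\<dots> = (\<Sum>j\<in>UNIV. \<Sum>i\<in>UNIV. hessian c \<Psi> p i j * v c $ i * Y p c $ j)"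
    by (simp add: sum_distrib_left mult_ac)
  also have "\<dots> = (\<Sum>i\<in>UNIV. \<Sum>j\<in>UNIV. hessian c \<Psi> p i j * v c $ i * Y p c $ j)" by (rule sum.swap)
  finally show ?thesis .
qed

text \<open>Choosing some flat chart at each point yields one tensor on the whole manifold;
  \<open>hess_eq\<close> removes the choice.\<close>

definition hess :: "('b \<Rightarrow> real) \<Rightarrow> 'b \<Rightarrow> ('b, 'n) tvec \<Rightarrow> ('b, 'n) tvec \<Rightarrow> real" where
  "hess \<Psi> p v w = (let c = SOME c. flat_coords A nabla c \<and> p \<in> fst c in
    \<Sum>i\<in>UNIV. \<Sum>j\<in>UNIV. hessian c \<Psi> p i j * v c $ i * w c $ j)"

text \<open>The vector \<open>w\<close> is extended to a field with constant components in the
  chosen chart \<open>c\<close>. The chart-free side of \<open>hessian_intrinsic\<close> for this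
  field is then evaluated in both \<open>c\<close> and \<open>d\<close>.\<close>

lemma hess_eq:
  assumes \<Psi>: "smooth_map_on A UNIV \<Psi>" and d: "flat_coords A nabla d" "p \<in> fst d"
    and v: "v \<in> tangent_space A p" and w: "w \<in> tangent_space A p"
  shows "hess \<Psi> p v w = (\<Sum>i\<in>UNIV. \<Sum>j\<in>UNIV. hessian d \<Psi> p i j * v d $ i * w d $ j)"
proof -
  define c where "c = (SOME c. flat_coords A nabla c \<and> p \<in> fst c)"
  have c: "flat_coords A nabla c" "p \<in> fst c"
    using someI_ex[OF flat_coords_ex[of p]] unfolding c_def by blast+
  note cA = flat_coordsD(1)[OF c(1)]
  note Y = tvec_vector_field[OF cA, of "w c"]
  have Yp: "tvec c p (w c) = w" by (rule tvec_self[OF w charts_atI[OF cA c(2)]])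
  show ?thesis
    using hessian_intrinsic[OF \<Psi> c(1) Y c(2,2) v] hessian_intrinsic[OF \<Psi> d(1) Y c(2) d(2) v]
    by (simp add: Yp hess_def c_def[symmetric])
qed

lemma hess_coord:
  assumes \<Psi>: "smooth_map_on A UNIV \<Psi>" and c: "flat_coords A nabla c" "p \<in> fst c"
  shows "hess \<Psi> p (coord_field A c i p) (coord_field A c j p) = hessian c \<Psi> p i j"
proof -
  note cA = flat_coordsD(1)[OF c(1)]
  have "hess \<Psi> p (coord_field A c i p) (coord_field A c j p) =
      (\<Sum>k\<in>UNIV. \<Sum>l\<in>UNIV. hessian c \<Psi> p k l * axis i 1 $ k * axis j 1 $ l)"
    using hess_eq[OF \<Psi> c coord_field_in[OF cA c(2), of i] coord_field_in[OF cA c(2), of j]]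
    by (simp add: coord_field_same[OF cA c(2)])
  also have "\<dots> = hessian c \<Psi> p i j"
    by (simp add: axis_def if_distrib[of "\<lambda>x. _ * x"] cong: if_cong)
  finally show ?thesis .
qed

lemma hessian_sym:
  assumes \<Psi>: "smooth_map_on A UNIV \<Psi>" and c: "c \<in> A" "p \<in> fst c"
  shows "hessian c \<Psi> p i j = hessian c \<Psi> p j i"
  unfolding hessian_cderiv[OF \<Psi> c]
  by (rule cderiv_commute[OF smooth_map_on_subset[OF \<Psi>] chart_dom_open[OF c(1)] _ c]) auto

lemma hessian_smooth:
  assumes \<Psi>: "smooth_map_on A UNIV \<Psi>" and c: "c \<in> A"
  shows "smooth_map_on A (fst c) (\<lambda>p. hessian c \<Psi> p i j)"
proof (rule smooth_map_on_transform)
  note dom = chart_dom_open[OF c]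
  show "smooth_map_on A (fst c) (cderiv c i (cderiv c j \<Psi>))"
    by (intro cderiv_smooth dom c order_refl smooth_map_on_subset[OF \<Psi>]) simp
qed (simp_all add: chart_dom_open c hessian_cderiv[OF \<Psi> c])

lemma hess_bilinear:
  assumes \<Psi>: "smooth_map_on A UNIV \<Psi>" and v: "v \<in> tangent_space A p"
  shows "linear_on_subspace (tangent_space A p) (\<lambda>w. hess \<Psi> p v w)"
proof -
  obtain c where c: "flat_coords A nabla c" "p \<in> fst c" using flat_coords_ex by blast
  show ?thesis
    unfolding linear_on_subspace_def
    by (auto simp: hess_eq[OF \<Psi> c v] tangent_add tangent_scale scaleR_fun_apply sum_distrib_left sum.distrib algebra_simps)
qed

lemma hess_sym:
  assumes \<Psi>: "smooth_map_on A UNIV \<Psi>" and v: "v \<in> tangent_space A p" and w: "w \<in> tangent_space A p"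
  shows "hess \<Psi> p v w = hess \<Psi> p w v"
proof -
  obtain c where c: "flat_coords A nabla c" "p \<in> fst c" using flat_coords_ex by blast
  have "hess \<Psi> p w v = (\<Sum>j\<in>UNIV. \<Sum>i\<in>UNIV. hessian c \<Psi> p i j * w c $ i * v c $ j)"
    unfolding hess_eq[OF \<Psi> c w v] by (rule sum.swap)
  also have "\<dots> = hess \<Psi> p v w"
    unfolding hess_eq[OF \<Psi> c v w]
    by (intro sum.cong refl, subst hessian_sym[OF \<Psi> flat_coordsD(1)[OF c(1)] c(2)]) simp
  finally show ?thesis by simp
qed

lemma hess_riemannian:
  assumes \<Psi>: "smooth_map_on A UNIV \<Psi>" and convex: "strictly_convex A nabla \<Psi>"
  shows "riemannian_metric A (hess \<Psi>)"
  unfolding riemannian_metric_def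
proof (intro conjI allI ballI impI; (elim conjE)?)
  fix p X assume X: "X \<in> tangent_space A p"
  show "linear_on_subspace (tangent_space A p) (hess \<Psi> p X)" by (rule hess_bilinear[OF \<Psi> X])
  show "hess \<Psi> p X Y = hess \<Psi> p Y X" if "Y \<in> tangent_space A p" for Y by (rule hess_sym[OF \<Psi> X that])
  assume "X \<noteq> 0"
  obtain c where c: "flat_coords A nabla c" "p \<in> fst c" using flat_coords_ex by blast
  have "X c \<noteq> 0"
    using tangent_eqI[OF X tangent_zero charts_atI[OF flat_coordsD(1)[OF c(1)] c(2)]] \<open>X \<noteq> 0\<close> by auto
  then show "hess \<Psi> p X X > 0"
    using convex c unfolding strictly_convex_def hess_eq[OF \<Psi> c X X] by blast
next
  fix U X Y assume X: "vector_field A U X" and Y: "vector_field A U Y"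
  show "smooth_map_on A U (\<lambda>p. hess \<Psi> p (X p) (Y p))"
  proof (rule smooth_map_on_local)
    fix p assume p: "p \<in> U"
    obtain c where c: "flat_coords A nabla c" "p \<in> fst c" using flat_coords_ex by blast
    note cA = flat_coordsD(1)[OF c(1)]
    let ?W = "U \<inter> fst c"
    have W: "open ?W" using vector_fieldD(1)[OF X] chart_dom_open[OF cA] by blast
    have "smooth_map_on A ?W (\<lambda>q. \<Sum>i\<in>UNIV. \<Sum>j\<in>UNIV. hessian c \<Psi> q i j * X q c $ i * Y q c $ j)"
      by (intro smooth_map_on_sum smooth_map_on_mult W smooth_map_on_subset[OF hessian_smooth[OF \<Psi> cA]]
          vector_field_component[OF vector_field_subset[OF X W] cA] vector_field_component[OF vector_field_subset[OF Y W] cA]) auto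
    then have "smooth_map_on A ?W (\<lambda>q. hess \<Psi> q (X q) (Y q))"
      by (rule smooth_map_on_transform[OF _ W])
        (use hess_eq[OF \<Psi> c(1) _ vector_fieldD(2)[OF X] vector_fieldD(2)[OF Y]] in auto)
    then show "\<exists>V. open V \<and> p \<in> V \<and> smooth_map_on A V (\<lambda>q. hess \<Psi> q (X q) (Y q))" using W p c by blast
  qed
qed

text \<open>The potential condition compares \<open>g\<close> with the Hessian on coordinate fields
  of flat charts; bilinearity extends the agreement to all tangent vectors.\<close>

lemma metric_eq_hess:
  assumes \<Psi>: "smooth_map_on A UNIV \<Psi>" and g: "riemannian_metric A g"
    and gc: "\<And>c p i j. flat_coords A nabla c \<Longrightarrow> p \<in> fst c \<Longrightarrow>
      g p (coord_field A c i p) (coord_field A c j p) = hessian c \<Psi> p i j"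
    and X: "X \<in> tangent_space A p" and Y: "Y \<in> tangent_space A p"
  shows "g p X Y = hess \<Psi> p X Y"
proof -
  obtain c where c: "flat_coords A nabla c" "p \<in> fst c" using flat_coords_ex by blast
  note cA = flat_coordsD(1)[OF c(1)]
  note e = coord_field_in[OF cA c(2)]
  have "g p X Y = g p (\<Sum>i\<in>UNIV. (X c $ i) *\<^sub>R coord_field A c i p) Y"
    using tangent_expand[OF X cA c(2)] by simp
  also have "\<dots> = (\<Sum>i\<in>UNIV. (X c $ i) *\<^sub>R g p (coord_field A c i p) Y)"
    by (rule los_lincomb[OF metric_los_left[OF g Y] subspace_tangent e])
  also have "\<dots> = (\<Sum>i\<in>UNIV. (X c $ i) *\<^sub>R (\<Sum>j\<in>UNIV. (Y c $ j) *\<^sub>R hessian c \<Psi> p i j))"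
  proof (intro sum.cong refl arg_cong[where f="scaleR _"])
    fix i
    have "g p (coord_field A c i p) Y = g p (coord_field A c i p) (\<Sum>j\<in>UNIV. (Y c $ j) *\<^sub>R coord_field A c j p)"
      using tangent_expand[OF Y cA c(2)] by simp
    also have "\<dots> = (\<Sum>j\<in>UNIV. (Y c $ j) *\<^sub>R hessian c \<Psi> p i j)"
      using los_lincomb[OF metricD(1)[OF g e] subspace_tangent e] by (simp add: gc[OF c])
    finally show "g p (coord_field A c i p) Y = (\<Sum>j\<in>UNIV. (Y c $ j) *\<^sub>R hessian c \<Psi> p i j)" .
  qed
  also have "\<dots> = hess \<Psi> p X Y"
    unfolding hess_eq[OF \<Psi> c X Y] by (simp add: sum_distrib_left mult_ac)
  finally show ?thesis .
qed

text \<open>Gives a value to the definite description in \<open>hessian_map\<close>: the presence of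
  one flat chart at \<open>p\<close> yields uniqueness, and the independence of \<open>hess\<close>
  of the chart yields existence.\<close>

lemma hessian_map_eq:
  assumes \<Psi>: "smooth_map_on A UNIV \<Psi>" and v: "v \<in> tangent_space A p"
  shows "hessian_map A nabla \<Psi> p v = metric_flat A (hess \<Psi>) p v"
proof -
  have eq: "metric_flat A (hess \<Psi>) p v = (\<Sum>j\<in>UNIV. v c $ j *\<^sub>R (\<Sum>i\<in>UNIV. hessian c \<Psi> p i j *\<^sub>R coord_form A c i p))"
    if c: "flat_coords A nabla c" "p \<in> fst c" for c
  proof
    fix X
    show "metric_flat A (hess \<Psi>) p v X =
      (\<Sum>j\<in>UNIV. v c $ j *\<^sub>R (\<Sum>i\<in>UNIV. hessian c \<Psi> p i j *\<^sub>R coord_form A c i p)) X"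
    proof (cases "X \<in> tangent_space A p")
      case True
      have "hess \<Psi> p X v = (\<Sum>j\<in>UNIV. \<Sum>i\<in>UNIV. hessian c \<Psi> p i j * X c $ i * v c $ j)"
        unfolding hess_eq[OF \<Psi> c True v] by (rule sum.swap)
      then show ?thesis
        using True hess_sym[OF \<Psi> v True]
        by (simp add: metric_flat_def sum_fun_apply scaleR_fun_apply coord_form_def sum_distrib_left mult_ac)
    qed (simp add: metric_flat_def sum_fun_apply scaleR_fun_apply coord_form_def)
  qed
  obtain c where c: "flat_coords A nabla c" "p \<in> fst c" using flat_coords_ex by blast
  show ?thesis
    unfolding hessian_map_def
  proof (rule the_equality)
    fix \<alpha> assume "\<forall>c. flat_coords A nabla c \<and> p \<in> fst c \<longrightarrow>
      \<alpha> = (\<Sum>j\<in>UNIV. v c $ j *\<^sub>R (\<Sum>i\<in>UNIV. hessian c \<Psi> p i j *\<^sub>R coord_form A c i p))"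
    then show "\<alpha> = metric_flat A (hess \<Psi>) p v" unfolding eq[OF c] using c by blast
  qed (intro allI impI, elim conjE, rule eq)
qed


section \<open>The dual connection\<close>

text \<open>In flat coordinates the components of the dual connection, lowered by the Hessian metric, are
  the third derivatives of the potential; their symmetry gives torsion-freeness.\<close>

lemma dual_torsion_free:
  assumes \<Psi>: "smooth_map_on A UNIV \<Psi>" and convex: "strictly_convex A nabla \<Psi>"
    and D: "connection A (tangent_bundle A) D"
    and dual: "\<And>U X Y Z p. vector_field A U X \<Longrightarrow> vector_field A U Y \<Longrightarrow> vector_field A U Z \<Longrightarrow> p \<in> U \<Longrightarrow>
      tderiv A p (Z p) (\<lambda>q. hess \<Psi> q (X q) (Y q)) = hess \<Psi> p (nabla p (Z p) X) (Y p) + hess \<Psi> p (X p) (D p (Z p) Y)"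
  shows "torsion_free A D"
  unfolding torsion_free_def
proof (intro allI impI ballI; elim conjE)
  fix U X Y p assume X: "vector_field A U X" and Y: "vector_field A U Y" and p: "p \<in> U"
  interpret D: conn_vbundle A "tangent_bundle A" D by unfold_locales (rule D)
  note g = hess_riemannian[OF \<Psi> convex]
  obtain c where c: "flat_coords A nabla c" "p \<in> fst c" using flat_coords_ex by blast
  note cA = flat_coordsD(1)[OF c(1)]
  let ?W = "U \<inter> fst c"
  have W: "open ?W" "p \<in> ?W" using vector_fieldD(1)[OF Y] chart_dom_open[OF cA] p c by auto
  have eW: "vector_field A ?W (coord_field A c j)" for j
    by (rule vector_field_subset[OF coord_vector_field[OF cA] W(1)]) simp
  note e = coord_field_in[OF cA c(2)]
  let ?h = "\<lambda>i j q. cderiv c i (cderiv c j \<Psi>) q"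
  have \<Psi>W: "smooth_map_on A ?W \<Psi>" by (rule smooth_map_on_subset[OF \<Psi>]) simp
  have d1: "smooth_map_on A ?W (cderiv c j \<Psi>)" for j by (rule cderiv_smooth[OF \<Psi>W W(1) _ cA]) simp
  have d2: "smooth_map_on A ?W (?h i j)" for i j by (rule cderiv_smooth[OF d1 W(1) _ cA]) simp
  \<comment> \<open>Third coordinate derivatives of \<open>\<Psi>\<close>: \<open>T1\<close> and
    \<open>T2\<close> exchange neighbouring indices, and \<open>T\<close> combines them to exchange
    the outer two.\<close>
  let ?T = "\<lambda>i k j. cderiv c i (?h k j) p"
  have T1: "?T i k j = ?T k i j" for i k j
    by (rule cderiv_commute[OF d1 W(1) _ cA W(2)]) simp
  have T2: "?T i k j = ?T i j k" for i k j
    by (rule cderiv_cong[OF d2 W(1) cA W(2) c(2)]) (rule cderiv_commute[OF \<Psi>W W(1) _ cA], auto)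
  have T: "?T i k j = ?T j k i" for i k j
    using T1[of i k j] T2[of k i j] T1[of k j i] by simp
  have hexp: "hess \<Psi> q (coord_field A c k q) v = (\<Sum>j\<in>UNIV. v c $ j * ?h k j q)"
    if q: "q \<in> fst c" and v: "v \<in> tangent_space A q" for q v k
  proof -
    have "hess \<Psi> q (coord_field A c k q) v = hess \<Psi> q (coord_field A c k q) (\<Sum>j\<in>UNIV. (v c $ j) *\<^sub>R coord_field A c j q)"
      using tangent_expand[OF v cA q] by simp
    also have "\<dots> = (\<Sum>j\<in>UNIV. (v c $ j) *\<^sub>R hess \<Psi> q (coord_field A c k q) (coord_field A c j q))"
      by (rule los_lincomb[OF hess_bilinear[OF \<Psi> coord_field_in[OF cA q]] subspace_tangent coord_field_in[OF cA q]])
    finally show ?thesis by (simp add: hess_coord[OF \<Psi> c(1) q] hessian_cderiv[OF \<Psi> cA q])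
  qed
  \<comment> \<open>Duality is tested against the flat coordinate field of index \<open>k\<close>.
    Its own covariant derivative is 0, so pairing it with the derivative of \<open>Z\<close> under
    \<open>D\<close> equals the derivative of its inner product with \<open>Z\<close>, which the
    product rule evaluates.\<close>
  have key: "hess \<Psi> p (coord_field A c k p) (D p (V p) Z) =
      (\<Sum>j\<in>UNIV. \<Sum>i\<in>UNIV. Z p c $ j * V p c $ i * ?T i k j) + (\<Sum>j\<in>UNIV. tderiv A p (V p) (\<lambda>q. Z q c $ j) * ?h k j p)"
    if V: "vector_field A U V" and Z: "vector_field A U Z" for V Z k
  proof -
    have VW: "vector_field A ?W V" and ZW: "vector_field A ?W Z"
      using vector_field_subset[OF V W(1)] vector_field_subset[OF Z W(1)] by auto
    have Vp: "V p \<in> tangent_space A p" by (rule vector_fieldD(2)[OF V p])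
    have Zp: "Z p \<in> tangent_space A p" by (rule vector_fieldD(2)[OF Z p])
    have Zc: "smooth_map_on A ?W (\<lambda>q. Z q c $ j)" for j by (rule vector_field_component[OF ZW cA]) simp
    have "hess \<Psi> p 0 (Z p) = 0" by (rule los_zero[OF metric_los_left[OF g Zp] subspace_tangent])
    then have "hess \<Psi> p (coord_field A c k p) (D p (V p) Z) =
        tderiv A p (V p) (\<lambda>q. hess \<Psi> q (coord_field A c k q) (Z q))"
      using dual[OF eW ZW VW W(2), of k] flat_coordsD(2)[OF c(1,2) Vp] by simp
    also have "\<dots> = tderiv A p (V p) (\<lambda>q. \<Sum>j\<in>UNIV. Z q c $ j * ?h k j q)"
      by (rule tderiv_cong[OF metricD(4)[OF g eW ZW] W Vp]) (use hexp vector_fieldD(2)[OF ZW] in auto)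
    also have "\<dots> = (\<Sum>j\<in>UNIV. tderiv A p (V p) (\<lambda>q. Z q c $ j * ?h k j q))"
      by (rule tderiv_sum[OF smooth_map_on_mult[OF W(1) Zc d2] W Vp])
    also have "\<dots> = (\<Sum>j\<in>UNIV. Z p c $ j * tderiv A p (V p) (?h k j) + tderiv A p (V p) (\<lambda>q. Z q c $ j) * ?h k j p)"
      by (intro sum.cong refl tderiv_mult[OF Zc d2 W Vp])
    finally show ?thesis
      by (simp add: sum.distrib tderiv_cderiv[OF d2 W Vp cA c(2)] sum_distrib_left mult_ac)
  qed
  have Xp: "X p \<in> tangent_space A p" and Yp: "Y p \<in> tangent_space A p"
    using vector_fieldD(2)[OF X p] vector_fieldD(2)[OF Y p] .
  let ?L = "lie_bracket A X Y p"
  have L: "?L \<in> tangent_space A p" by (rule bracket_in[OF X Y p])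
  have Lc: "?L c $ j = tderiv A p (X p) (\<lambda>q. Y q c $ j) - tderiv A p (Y p) (\<lambda>q. X q c $ j)" for j
  proof -
    have comp: "frechet_derivative (\<lambda>x. Z (chart_inv c x) c) (at (snd c p)) (v c) $ j = tderiv A p v (\<lambda>q. Z q c $ j)"
      if Z: "vector_field A U Z" and v: "v \<in> tangent_space A p" for Z v
    proof -
      have ZW: "vector_field A ?W Z" using vector_field_subset[OF Z W(1)] by auto
      have "smooth_map_on A ?W (\<lambda>q. Z q c)" by (rule smooth_map_on_subset[OF vector_fieldD(3)[OF Z cA]]) simp
      from smooth_map_has_derivative[OF this W(2) charts_atI[OF cA c(2)]]
      have "((\<lambda>x. Z (chart_inv c x) c $ j) has_derivative
          (\<lambda>w. frechet_derivative (\<lambda>x. Z (chart_inv c x) c) (at (snd c p)) w $ j)) (at (snd c p))"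
        by (intro bounded_linear.has_derivative[OF bounded_linear_vec_nth]) (simp add: o_def)
      from frechet_derivative_at[OF this] show ?thesis
        using tderiv_eq[OF vector_field_component[OF ZW cA] W v charts_atI[OF cA c(2)], of j]
        by (simp add: o_def fun_eq_iff)
    qed
    show ?thesis
      using charts_atI[OF cA c(2)] by (simp add: lie_bracket_def comp[OF Y Xp] comp[OF X Yp])
  qed
  have DX: "D p (X p) Y \<in> tangent_space A p" and DY: "D p (Y p) X \<in> tangent_space A p"
    using D.conn_in[OF Y p Xp] D.conn_in[OF X p Yp] by simp_all
  \<comment> \<open>The torsion of \<open>D\<close> at \<open>p\<close>. In its inner product with
    each coordinate field the third derivatives cancel by \<open>T\<close>, and the remaining
    first-order terms cancel against the bracket.\<close>
  define v where "v = D p (X p) Y - D p (Y p) X - ?L"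
  have v: "v \<in> tangent_space A p" unfolding v_def by (intro tangent_diff DX DY L)
  have zero: "hess \<Psi> p (coord_field A c k p) v = 0" for k
  proof -
    have hv: "hess \<Psi> p (coord_field A c k p) v = hess \<Psi> p (coord_field A c k p) (D p (X p) Y)
        - hess \<Psi> p (coord_field A c k p) (D p (Y p) X) - hess \<Psi> p (coord_field A c k p) ?L"
      by (simp add: v_def los_diff[OF hess_bilinear[OF \<Psi> e]] tangent_diff DX DY L)
    have "(\<Sum>j\<in>UNIV. \<Sum>i\<in>UNIV. Y p c $ j * X p c $ i * ?T i k j) = (\<Sum>i\<in>UNIV. \<Sum>j\<in>UNIV. Y p c $ j * X p c $ i * ?T i k j)"
      by (rule sum.swap)
    also have "\<dots> = (\<Sum>i\<in>UNIV. \<Sum>j\<in>UNIV. X p c $ i * Y p c $ j * ?T j k i)"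
      by (intro sum.cong refl) (simp add: T[of _ k] mult_ac)
    finally have "(\<Sum>j\<in>UNIV. \<Sum>i\<in>UNIV. Y p c $ j * X p c $ i * ?T i k j) =
        (\<Sum>j\<in>UNIV. \<Sum>i\<in>UNIV. X p c $ j * Y p c $ i * ?T i k j)" .
    with hv show ?thesis
      by (simp add: key[OF X Y] key[OF Y X] hexp[OF c(2) L] Lc left_diff_distrib sum_subtractf)
  qed
  have "hess \<Psi> p v v = hess \<Psi> p (\<Sum>k\<in>UNIV. (v c $ k) *\<^sub>R coord_field A c k p) v"
    using tangent_expand[OF v cA c(2)] by simp
  also have "\<dots> = (\<Sum>k\<in>UNIV. (v c $ k) *\<^sub>R hess \<Psi> p (coord_field A c k p) v)"
    by (rule los_lincomb[OF metric_los_left[OF g v] subspace_tangent e])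
  finally have "hess \<Psi> p v v = 0" by (simp add: zero)
  then have "v = 0" by (rule metric_zero_iff[OF g v])
  then show "D p (X p) Y - D p (Y p) X = ?L" by (simp add: v_def)
qed

text \<open>The dual potential is the Legendre transform \<open>\<eta> \<mapsto> \<theta> \<bullet> \<eta> - \<psi> \<theta>\<close> on a chart so small that
  \<open>\<eta> = gradient \<psi> \<theta>\<close> can be solved smoothly for \<open>\<theta>\<close>.\<close>

lemma local_potentials_ex:
  assumes \<Psi>: "smooth_map_on A UNIV \<Psi>" and convex: "strictly_convex A nabla \<Psi>"
    and gc: "\<And>c p i j. flat_coords A nabla c \<Longrightarrow> p \<in> fst c \<Longrightarrow>
      g p (coord_field A c i p) (coord_field A c j p) = hessian c \<Psi> p i j"
  shows "\<exists>c \<psi> \<psi>s. p \<in> fst c \<and> flat_coords A nabla c \<and> local_potentials A g c \<psi> \<psi>s"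
proof -
  obtain c where c: "flat_coords A nabla c" "p \<in> fst c" using flat_coords_ex by blast
  note cA = flat_coordsD(1)[OF c(1)]
  let ?O = "snd c ` fst c"
  note O = chart_ran_open[OF cA]
  define \<psi> where "\<psi> = \<Psi> \<circ> chart_inv c"
  have \<psi>: "smooth_on ?O \<psi>" using smooth_map_onD[OF \<Psi> cA] by (simp add: \<psi>_def)
  have dsm: "smooth_on ?O (partial i \<psi>)" for i
    unfolding partial_def[abs_def] by (rule smooth_on_frechet_derivative[OF \<psi>])
  have grad: "smooth_on ?O (gradient \<psi>)"
    unfolding gradient_def[abs_def] by (subst smooth_on_vec_iff[OF O]) (simp add: dsm)
  define x0 where "x0 = snd c p"
  have x0: "x0 \<in> ?O" using c by (simp add: x0_def)
  note gD = smooth_on_has_derivative[OF grad x0]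
  \<comment> \<open>The derivative of the gradient map is given by the Hessian matrix, so positive
    definiteness supplies the injectivity required by the inverse function theorem.\<close>
  have comp: "frechet_derivative (gradient \<psi>) (at x0) w $ i = (\<Sum>j\<in>UNIV. w $ j * hessian c \<Psi> p j i)" for w i
  proof -
    note d = smooth_on_has_derivative[OF dsm[of i] x0]
    have "(partial i \<psi> has_derivative (\<lambda>w. frechet_derivative (gradient \<psi>) (at x0) w $ i)) (at x0)"
      using bounded_linear.has_derivative[OF bounded_linear_vec_nth gD, of i] by (simp add: gradient_def)
    from frechet_derivative_at[OF this]
    have "frechet_derivative (gradient \<psi>) (at x0) w $ i = frechet_derivative (partial i \<psi>) (at x0) w" by metis
    also have "\<dots> = frechet_derivative (partial i \<psi>) (at x0) (\<Sum>j\<in>UNIV. (w $ j) *\<^sub>R axis j 1)"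
      using vec_expand[of w] by simp
    also have "\<dots> = (\<Sum>j\<in>UNIV. w $ j * partial j (partial i \<psi>) x0)"
      by (simp add: linear_sum[OF has_derivative_linear[OF d]] linear_cmul[OF has_derivative_linear[OF d]] partial_def[of _ "partial i \<psi>"])
    finally show ?thesis by (simp add: hessian_def \<psi>_def x0_def)
  qed
  have inj: "inj (frechet_derivative (gradient \<psi>) (at x0))"
    unfolding linear_injective_0[OF has_derivative_linear[OF gD]]
  proof (intro allI impI)
    fix w assume "frechet_derivative (gradient \<psi>) (at x0) w = 0"
    then have z: "(\<Sum>j\<in>UNIV. w $ j * hessian c \<Psi> p j i) = 0" for i using comp[of w i] by simp
    have "(\<Sum>j\<in>UNIV. \<Sum>i\<in>UNIV. hessian c \<Psi> p j i * w $ j * w $ i) = (\<Sum>i\<in>UNIV. \<Sum>j\<in>UNIV. hessian c \<Psi> p j i * w $ j * w $ i)"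
      by (rule sum.swap)
    also have "\<dots> = (\<Sum>i\<in>UNIV. w $ i * (\<Sum>j\<in>UNIV. w $ j * hessian c \<Psi> p j i))"
      by (simp add: sum_distrib_left mult_ac)
    finally have "(\<Sum>j\<in>UNIV. \<Sum>i\<in>UNIV. hessian c \<Psi> p j i * w $ j * w $ i) = 0" by (simp add: z)
    moreover have "(\<Sum>j\<in>UNIV. \<Sum>i\<in>UNIV. hessian c \<Psi> p j i * w $ j * w $ i) > 0" if "w \<noteq> 0"
      using convex c that unfolding strictly_convex_def by blast
    ultimately show "w = 0" by (metis less_irrefl)
  qed
  obtain V H where V: "open V" "V \<subseteq> ?O" "x0 \<in> V" "open (gradient \<psi> ` V)"
    "homeomorphism V (gradient \<psi> ` V) (gradient \<psi>) H" "smooth_on (gradient \<psi> ` V) H"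
    using smooth_inverse_function[OF O grad x0 inj] by metis
  let ?W = "gradient \<psi> ` V"
  define c' where "c' = (chart_inv c ` V, snd c)"
  have V': "open (chart_inv c ` V)" "chart_inv c ` V \<subseteq> fst c"
    using chart_preimage_open[OF cA V(1,2)] chart_preimage_subset[OF cA V(2)] .
  have c': "flat_coords A nabla c'" unfolding c'_def by (rule flat_coords_restrict[OF c(1) V'])
  have img: "snd c' ` fst c' = V" unfolding c'_def using chart_image_preimage[OF cA V(2)] by simp
  have pc': "p \<in> fst c'" using V(3) cA c(2) by (force simp: c'_def x0_def)
  define \<psi>s where "\<psi>s \<eta> = H \<eta> \<bullet> \<eta> - \<psi> (H \<eta>)" for \<eta>
  have HV: "H ` ?W \<subseteq> V" using V(5) by (simp add: homeomorphism_def)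
  have \<psi>V: "smooth_on V \<psi>" by (rule smooth_on_subset[OF \<psi> V(2)])
  have "smooth_on ?W \<psi>s"
    unfolding \<psi>s_def by (intro smooth_on_diff smooth_on_inner V smooth_on_ident smooth_on_compose[OF V(4,1) HV V(6) \<psi>V])
  moreover have "\<psi> \<theta> + \<psi>s (gradient \<psi> \<theta>) = \<theta> \<bullet> gradient \<psi> \<theta>" if "\<theta> \<in> V" for \<theta>
    using V(5) that by (simp add: \<psi>s_def homeomorphism_def)
  moreover have "g q (coord_field A c' i q) (coord_field A c' j q) = partial i (partial j \<psi>) (snd c' q)"
    if q: "q \<in> fst c'" for q i j
  proof -
    have qV: "q \<in> chart_inv c ` V" and qc: "q \<in> fst c" using q V'(2) by (auto simp: c'_def)
    show ?thesis
      unfolding c'_def coord_field_restrict[OF cA V' qV] gc[OF c(1) qc] by (simp add: hessian_def \<psi>_def)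
  qed
  ultimately have "local_potentials A g c' \<psi> \<psi>s"
    unfolding local_potentials_def img using \<psi>V V(4) by blast
  then show ?thesis using pc' c' by blast
qed

end


section \<open>Whitney sums\<close>

context smooth_vbundle2
begin

lemma whitney_sum_trivsE:
  assumes "(W, \<rho>) \<in> trivs (whitney_sum E F)"
  obtains U \<tau> V \<sigma> where "W = U \<inter> V" "\<rho> = (\<lambda>p. map_prod (\<tau> p) (\<sigma> p))" "(U, \<tau>) \<in> trivs E" "(V, \<sigma>) \<in> trivs F"
  using assms by (auto simp: whitney_sum_def)

lemma whitney_sum_trivsI:
  "(U, \<tau>) \<in> trivs E \<Longrightarrow> (V, \<sigma>) \<in> trivs F \<Longrightarrow> (U \<inter> V, \<lambda>p. map_prod (\<tau> p) (\<sigma> p)) \<in> trivs (whitney_sum E F)"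
  by (auto simp: whitney_sum_def)

lemma whitney_sum_fibre [simp]: "fibre (whitney_sum E F) p = fibre E p \<times> fibre F p"
  by (simp add: whitney_sum_def)

lemma vector_bundle_whitney_sum: "vector_bundle A (whitney_sum E F)"
proof (rule vector_bundleI)
  show "subspace (fibre (whitney_sum E F) p)" for p
    using subspace_Times[OF fibre_subspace F.fibre_subspace] by simp
  show "\<exists>U \<tau>. (U, \<tau>) \<in> trivs (whitney_sum E F) \<and> p \<in> U" for p
    using triv_ex[of p] F.triv_ex[of p] whitney_sum_trivsI by blast
  fix W \<rho> assume "(W, \<rho>) \<in> trivs (whitney_sum E F)"
  then obtain U \<tau> V \<sigma> where W: "W = U \<inter> V" "\<rho> = (\<lambda>p. map_prod (\<tau> p) (\<sigma> p))"
    and t: "(U, \<tau>) \<in> trivs E" "(V, \<sigma>) \<in> trivs F" by (rule whitney_sum_trivsE)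
  show "open W" using W triv_open[OF t(1)] F.triv_open[OF t(2)] by blast
  show "linear_on_subspace (fibre (whitney_sum E F) p) (\<rho> p)" if "p \<in> W" for p
    using that by (auto simp: linear_on_subspace_def W los_comb[OF triv_linear[OF t(1)]] los_comb[OF F.triv_linear[OF t(2)]])
  show bij: "bij_betw (\<rho> p) (fibre (whitney_sum E F) p) UNIV" if p: "p \<in> W" for p
    using bij_betw_map_prod[OF triv_bij[OF t(1), of p] F.triv_bij[OF t(2), of p]] p
    by (simp add: W)
  have inv: "inv_into (fibre (whitney_sum E F) p) (\<rho> p) (a, b) =
      (inv_into (fibre E p) (\<tau> p) a, inv_into (fibre F p) (\<sigma> p) b)" if p: "p \<in> W" for p a b
    by (rule inv_into_f_eq[OF bij_betw_imp_inj_on[OF bij[OF p]]])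
      (use p frame_in[OF t(1)] frame_right[OF t(1)] F.frame_in[OF t(2)] F.frame_right[OF t(2)] in \<open>auto simp: W\<close>)
  fix W' \<rho>' and w :: "'f \<times> 'g" assume "(W', \<rho>') \<in> trivs (whitney_sum E F)"
  then obtain U' \<tau>' V' \<sigma>' where W': "W' = U' \<inter> V'" "\<rho>' = (\<lambda>p. map_prod (\<tau>' p) (\<sigma>' p))"
    and t': "(U', \<tau>') \<in> trivs E" "(V', \<sigma>') \<in> trivs F" by (rule whitney_sum_trivsE)
  have O: "open (W \<inter> W')"
    using W W' triv_open[OF t(1)] F.triv_open[OF t(2)] triv_open[OF t'(1)] F.triv_open[OF t'(2)] by blast
  obtain a b where w: "w = (a, b)" by (cases w)
  have "smooth_map_on A (W \<inter> W') (\<lambda>p. (\<tau>' p (inv_into (fibre E p) (\<tau> p) a), \<sigma>' p (inv_into (fibre F p) (\<sigma> p) b)))"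
    by (rule smooth_map_on_Pair[OF O smooth_map_on_subset[OF triv_transition[OF t(1) t'(1)]]
          smooth_map_on_subset[OF F.triv_transition[OF t(2) t'(2)]]]) (auto simp: W W')
  then show "smooth_map_on A (W \<inter> W') (\<lambda>p. \<rho>' p (inv_into (fibre (whitney_sum E F) p) (\<rho> p) w))"
    by (rule smooth_map_on_transform[OF _ O]) (simp add: inv w W'(2) del: whitney_sum_fibre)
qed

text \<open>The sum is trivialised over intersections of domains. Smoothness of one summand over the
  whole domain of its own trivialisation is recovered locally, with a trivialisation of the other
  bundle near each point.\<close>

lemma section_whitney_sum:
  assumes s: "smooth_section A (whitney_sum E F) U s"
  shows "smooth_section A E U (\<lambda>p. fst (s p))" "smooth_section A F U (\<lambda>p. snd (s p))"
proof -
  interpret H: smooth_vbundle A "whitney_sum E F" by unfold_locales (rule vector_bundle_whitney_sum)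
  have mem: "s p \<in> fibre E p \<times> fibre F p" if "p \<in> U" for p using H.section_in[OF s that] by simp
  note U = H.section_open[OF s]
  have sm: "smooth_map_on A (U \<inter> (V \<inter> W)) (\<lambda>p. \<tau> p (fst (s p))) \<and> smooth_map_on A (U \<inter> (V \<inter> W)) (\<lambda>p. \<sigma> p (snd (s p)))"
    if t: "(V, \<tau>) \<in> trivs E" "(W, \<sigma>) \<in> trivs F" for V \<tau> W \<sigma>
  proof -
    have O: "open (U \<inter> (V \<inter> W))" using U triv_open[OF t(1)] F.triv_open[OF t(2)] by blast
    note S = H.section_smooth[OF s whitney_sum_trivsI[OF t]]
    show ?thesis
      using smooth_map_on_bounded_linear[OF bounded_linear_fst O S] smooth_map_on_bounded_linear[OF bounded_linear_snd O S]
      by simp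
  qed
  show "smooth_section A E U (\<lambda>p. fst (s p))"
  proof (rule sectionI[OF U])
    show "fst (s p) \<in> fibre E p" if "p \<in> U" for p using mem[OF that] by auto
    fix V \<tau> assume t: "(V, \<tau>) \<in> trivs E"
    show "smooth_map_on A (U \<inter> V) (\<lambda>p. \<tau> p (fst (s p)))"
    proof (rule smooth_map_on_local)
      fix p assume p: "p \<in> U \<inter> V"
      obtain W \<sigma> where t': "(W, \<sigma>) \<in> trivs F" "p \<in> W" using F.triv_ex by blast
      show "\<exists>X. open X \<and> p \<in> X \<and> smooth_map_on A X (\<lambda>p. \<tau> p (fst (s p)))"
        using sm[OF t t'(1)] p t' U triv_open[OF t] F.triv_open[OF t'(1)]
        by (intro exI[of _ "U \<inter> (V \<inter> W)"]) auto
    qed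
  qed
  show "smooth_section A F U (\<lambda>p. snd (s p))"
  proof (rule F.sectionI[OF U])
    show "snd (s p) \<in> fibre F p" if "p \<in> U" for p using mem[OF that] by auto
    fix W \<sigma> assume t': "(W, \<sigma>) \<in> trivs F"
    show "smooth_map_on A (U \<inter> W) (\<lambda>p. \<sigma> p (snd (s p)))"
    proof (rule smooth_map_on_local)
      fix p assume p: "p \<in> U \<inter> W"
      obtain V \<tau> where t: "(V, \<tau>) \<in> trivs E" "p \<in> V" using triv_ex by blast
      show "\<exists>X. open X \<and> p \<in> X \<and> smooth_map_on A X (\<lambda>p. \<sigma> p (snd (s p)))"
        using sm[OF t(1) t'] p t U triv_open[OF t(1)] F.triv_open[OF t']
        by (intro exI[of _ "U \<inter> (V \<inter> W)"]) auto
    qed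
  qed
qed

end


section \<open>Structures depending on a connection only through its values\<close>

lemma conn_eq_refl: "conn_eq A E n n"
  by (simp add: conn_eq_def)

lemma conn_eq_trans: "conn_eq A E n n' \<Longrightarrow> conn_eq A E n' n'' \<Longrightarrow> conn_eq A E n n''"
  unfolding conn_eq_def by metis

lemma conn_eq_sym: "conn_eq A E n n' \<Longrightarrow> conn_eq A E n' n"
  unfolding conn_eq_def by metis

context smooth_mfd
begin

lemma conn_eq_torsion_free:
  assumes eq: "conn_eq A (tangent_bundle A) n n'" and tf: "torsion_free A n"
  shows "torsion_free A n'"
  unfolding torsion_free_def
proof (intro allI impI ballI; elim conjE)
  fix U X Y p assume X: "vector_field A U X" and Y: "vector_field A U Y" and p: "p \<in> U"
  have "n p (X p) Y - n p (Y p) X = lie_bracket A X Y p"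
    using tf X Y p unfolding torsion_free_def by blast
  then show "n' p (X p) Y - n' p (Y p) X = lie_bracket A X Y p"
    using conn_eqD[OF eq Y p vector_fieldD(2)[OF X p]] conn_eqD[OF eq X p vector_fieldD(2)[OF Y p]] by simp
qed

text \<open>Flat coordinates test a connection on coordinate fields, which are smooth sections.
  Consequently \<open>strictly_convex\<close> and \<open>hessian_map\<close> depend on a connection
  only up to \<open>conn_eq\<close>.\<close>

lemma conn_eq_flat_coords:
  assumes eq: "conn_eq A (tangent_bundle A) n n'"
  shows "flat_coords A n = flat_coords A n'"
proof
  fix c
  show "flat_coords A n c = flat_coords A n' c"
    unfolding flat_coords_def
    by (intro conj_cong refl ball_cong) (simp add: conn_eqD[OF eq coord_vector_field])
qed

lemma conn_eq_strictly_convex: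
  "conn_eq A (tangent_bundle A) n n' \<Longrightarrow> strictly_convex A n \<Psi> \<longleftrightarrow> strictly_convex A n' \<Psi>"
  unfolding strictly_convex_def using conn_eq_flat_coords by simp

lemma conn_eq_hessian_map:
  "conn_eq A (tangent_bundle A) n n' \<Longrightarrow> hessian_map A n \<Psi> = hessian_map A n' \<Psi>"
  unfolding hessian_map_def using conn_eq_flat_coords by simp

lemma metric_flat_inv_cong:
  assumes "\<And>p X Y. X \<in> tangent_space A p \<Longrightarrow> Y \<in> tangent_space A p \<Longrightarrow> g p X Y = h p X Y"
  shows "bundle_inv (tangent_bundle A) (metric_flat A g) = bundle_inv (tangent_bundle A) (metric_flat A h)"
  by (rule bundle_inv_cong) (auto simp: metric_flat_def fun_eq_iff assms)

lemma riemannian_metric_cong: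
  assumes g: "riemannian_metric A g"
    and eq: "\<And>p X Y. X \<in> tangent_space A p \<Longrightarrow> Y \<in> tangent_space A p \<Longrightarrow> g p X Y = h p X Y"
  shows "riemannian_metric A h"
  unfolding riemannian_metric_def
proof (intro conjI allI ballI impI; (elim conjE)?)
  fix p X assume X: "X \<in> tangent_space A p"
  show "linear_on_subspace (tangent_space A p) (h p X)"
    by (rule los_cong[OF metricD(1)[OF g X] subspace_tangent eq[OF X]])
  show "h p X Y = h p Y X" if Y: "Y \<in> tangent_space A p" for Y
    using metricD(2)[OF g X Y] eq[OF X Y] eq[OF Y X] by simp
  show "h p X X > 0" if "X \<noteq> 0" using metricD(3)[OF g X that] eq[OF X X] by simp
next
  fix U X Y assume X: "vector_field A U X" and Y: "vector_field A U Y"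
  show "smooth_map_on A U (\<lambda>p. h p (X p) (Y p))"
    by (rule smooth_map_on_transform[OF metricD(4)[OF g X Y] vector_fieldD(1)[OF X]])
      (rule eq[OF vector_fieldD(2)[OF X] vector_fieldD(2)[OF Y]])
qed


section \<open>From dually flat manifolds to Legendre bundles\<close>

lemma legendre_of_simps [simp]:
  "Hplus (legendre_of A D) = tangent_bundle A"
  "Hminus (legendre_of A D) = cotangent_bundle A"
  "ident_plus (legendre_of A D) = (\<lambda>p X. X)"
  "ident_minus (legendre_of A D) = (\<lambda>p \<alpha>. \<alpha>)"
  "conn_plus (legendre_of A D) = df_conn_plus D"
  "conn_minus (legendre_of A D) = transport_conn (tangent_bundle A) (metric_flat A (metric D)) (df_conn_minus D)"
  "potential (legendre_of A D) = df_potential D"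
  "pairing (legendre_of A D) p (X, \<alpha>) (Y, \<beta>) = \<alpha> Y + \<beta> X"
  by (simp_all add: legendre_of_def)

lemma dually_flatD:
  assumes "dually_flat A g np nm"
  shows "riemannian_metric A g"
    "connection A (tangent_bundle A) np" "flat A (tangent_bundle A) np" "torsion_free A np"
    "connection A (tangent_bundle A) nm" "flat A (tangent_bundle A) nm" "torsion_free A nm"
    "vector_field A U X \<Longrightarrow> vector_field A U Y \<Longrightarrow> vector_field A U Z \<Longrightarrow> p \<in> U \<Longrightarrow>
      tderiv A p (Z p) (\<lambda>q. g q (X q) (Y q)) = g p (np p (Z p) X) (Y p) + g p (X p) (nm p (Z p) Y)"
  using assms unfolding dually_flat_def by blast+

lemma dually_flat_with_potentialD:
  assumes "dually_flat_with_potential A D"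
  shows "dually_flat A (metric D) (df_conn_plus D) (df_conn_minus D)"
    "smooth_map_on A UNIV (df_potential D)" "strictly_convex A (df_conn_plus D) (df_potential D)"
    "flat_coords A (df_conn_plus D) c \<Longrightarrow> p \<in> fst c \<Longrightarrow>
        metric D p (coord_field A c i p) (coord_field A c j p) = hessian c (df_potential D) p i j"
  using assms unfolding dually_flat_with_potential_def by blast+

lemma base_conn_plus_legendre_of:
  "connection A (tangent_bundle A) (df_conn_plus D) \<Longrightarrow>
    conn_eq A (tangent_bundle A) (base_conn_plus (legendre_of A D)) (df_conn_plus D)"
  unfolding base_conn_plus_def legendre_of_simps by (rule TB.transport_conn_id)

lemma legendre_bundle_legendre_of:
  assumes D: "dually_flat_with_potential A D"
  shows "legendre_bundle A (legendre_of A D)"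
proof -
  note df = dually_flatD[OF dually_flat_with_potentialD(1)[OF D]]
  note g = df(1)
  interpret flat_mfd A "df_conn_plus D" by unfold_locales (rule df)+
  interpret TC: smooth_vbundle2 A "tangent_bundle A" "cotangent_bundle A" by (rule TB_CB)
  note iso = metric_flat_iso[OF g]
  note bij = bundle_isoD(2)[OF iso]
  let ?L = "legendre_of A D" and ?fl = "metric_flat A (metric D)"
  have fib: "fibre (total_bundle ?L) p = tangent_space A p \<times> cotangent_space A p" for p
    by (simp add: total_bundle_def)
  show ?thesis
    unfolding legendre_bundle_def fib unfolding legendre_of_simps(1-7)
  proof (intro conjI)
    show "vector_bundle A (tangent_bundle A)" "vector_bundle A (cotangent_bundle A)"
      by (rule vector_bundle_tangent vector_bundle_cotangent)+
    show "vector_bundle A (total_bundle ?L)"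
      unfolding total_bundle_def legendre_of_simps by (rule TC.vector_bundle_whitney_sum)
    show "bundle_iso A (tangent_bundle A) (tangent_bundle A) (\<lambda>p X. X)"
      "bundle_iso A (cotangent_bundle A) (cotangent_bundle A) (\<lambda>p \<alpha>. \<alpha>)"
      by (rule TB.bundle_iso_id CB.bundle_iso_id)+
    show "\<forall>p. \<forall>x\<in>tangent_space A p \<times> cotangent_space A p.
        linear_on_subspace (tangent_space A p \<times> cotangent_space A p) (pairing ?L p x)"
      by (auto simp: linear_on_subspace_def los_comb[OF cotangentD(1)] scaleR_fun_apply algebra_simps)
    show "\<forall>p. \<forall>x\<in>tangent_space A p \<times> cotangent_space A p. \<forall>y\<in>tangent_space A p \<times> cotangent_space A p.
        pairing ?L p x y = pairing ?L p y x"
      by auto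
    show "\<forall>p. \<forall>x\<in>tangent_space A p \<times> cotangent_space A p.
        (\<forall>y\<in>tangent_space A p \<times> cotangent_space A p. pairing ?L p x y = 0) \<longrightarrow> x = 0"
    proof (intro allI ballI impI)
      fix p x assume x: "x \<in> tangent_space A p \<times> cotangent_space A p"
        and z: "\<forall>y\<in>tangent_space A p \<times> cotangent_space A p. pairing ?L p x y = 0"
      obtain X \<alpha> where xX: "x = (X, \<alpha>)" by (cases x)
      with x have X: "X \<in> tangent_space A p" and \<alpha>: "\<alpha> \<in> cotangent_space A p" by auto
      \<comment> \<open>Non-degeneracy: pairing with \<open>(Y, 0)\<close> shows that the covector
        part is 0, and pairing with the metric dual of \<open>X\<close> shows by positivity that the
        vector part is 0.\<close>
      have "\<alpha> Y = 0" for Y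
        using z[rule_format, of "(Y, 0)"] cotangentD(2)[OF \<alpha>, of Y] subspace_0[OF subspace_cotangent]
        by (cases "Y \<in> tangent_space A p") (auto simp: xX)
      moreover have "?fl p X X = 0"
        using z[rule_format, of "(0, ?fl p X)"] metric_flat_in[OF g X] los_zero[OF cotangentD(1)[OF \<alpha>] subspace_tangent]
        by (simp add: xX)
      then have "X = 0" using metric_zero_iff[OF g X] X by (simp add: metric_flat_def)
      ultimately show "x = 0" by (simp add: xX zero_prod_def fun_eq_iff)
    qed
    show "\<forall>U s t. smooth_section A (total_bundle ?L) U s \<and> smooth_section A (total_bundle ?L) U t \<longrightarrow>
        smooth_map_on A U (\<lambda>p. pairing ?L p (s p) (t p))"
    proof (intro allI impI; elim conjE)
      fix U s t assume s: "smooth_section A (total_bundle ?L) U s" and t: "smooth_section A (total_bundle ?L) U t"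
      note s' = TC.section_whitney_sum[OF s[unfolded total_bundle_def legendre_of_simps]]
      note t' = TC.section_whitney_sum[OF t[unfolded total_bundle_def legendre_of_simps]]
      have "smooth_map_on A U (\<lambda>p. snd (s p) (fst (t p)) + snd (t p) (fst (s p)))"
        by (intro smooth_map_on_add covector_field_eval_smooth s' t' TB.section_open[OF s'(1)])
      moreover have "pairing ?L p (s p) (t p) = snd (s p) (fst (t p)) + snd (t p) (fst (s p))" for p
        by (cases "s p"; cases "t p") simp
      ultimately show "smooth_map_on A U (\<lambda>p. pairing ?L p (s p) (t p))" by simp
    qed
    show "\<forall>p. \<forall>x\<in>fibre (tangent_bundle A) p. \<forall>y\<in>fibre (tangent_bundle A) p. pairing ?L p (x, 0) (y, 0) = 0"
      by simp
    show "\<forall>p. \<forall>\<alpha>\<in>fibre (cotangent_bundle A) p. \<forall>\<beta>\<in>fibre (cotangent_bundle A) p. pairing ?L p (0, \<alpha>) (0, \<beta>) = 0"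
    proof (intro allI ballI)
      fix p \<alpha> \<beta> assume "\<alpha> \<in> fibre (cotangent_bundle A) p" "\<beta> \<in> fibre (cotangent_bundle A) p"
      then show "pairing ?L p (0, \<alpha>) (0, \<beta>) = 0"
        using los_zero[OF cotangentD(1) subspace_tangent, of \<alpha> p] los_zero[OF cotangentD(1) subspace_tangent, of \<beta> p] by simp
    qed
    show "\<forall>p. \<forall>x\<in>fibre (tangent_bundle A) p. \<forall>\<alpha>\<in>fibre (cotangent_bundle A) p. pairing ?L p (x, 0) (0, \<alpha>) = \<alpha> x"
      by simp
    show "connection A (tangent_bundle A) (df_conn_plus D)" "flat A (tangent_bundle A) (df_conn_plus D)"
      by (rule df)+
    show "connection A (cotangent_bundle A) (transport_conn (tangent_bundle A) ?fl (df_conn_minus D))"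
      by (rule TC.transport_connection[OF iso df(5)])
    show "flat A (cotangent_bundle A) (transport_conn (tangent_bundle A) ?fl (df_conn_minus D))"
      by (rule TC.transport_flat[OF iso df(5,6) bracket_in])
    show "\<forall>U X \<alpha> Z. smooth_section A (tangent_bundle A) U X \<and> smooth_section A (cotangent_bundle A) U \<alpha> \<and>
        vector_field A U Z \<longrightarrow> (\<forall>p\<in>U. tderiv A p (Z p) (\<lambda>q. pairing ?L q (X q, 0) (0, \<alpha> q)) =
           pairing ?L p (df_conn_plus D p (Z p) X, 0) (0, \<alpha> p) +
           pairing ?L p (X p, 0) (0, transport_conn (tangent_bundle A) ?fl (df_conn_minus D) p (Z p) \<alpha>))"
    proof (intro allI impI ballI; elim conjE)
      fix U X \<alpha> Z p assume X: "vector_field A U X" and \<alpha>: "smooth_section A (cotangent_bundle A) U \<alpha>"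
        and Z: "vector_field A U Z" and p: "p \<in> U"
      \<comment> \<open>The field whose metric dual is \<open>\<alpha>\<close>. It turns
        compatibility with the pairing into duality of the two connections with respect to the
        metric.\<close>
      define Y where "Y q = bundle_inv (tangent_bundle A) ?fl q (\<alpha> q)" for q
      have Y: "vector_field A U Y" unfolding Y_def by (rule TC.transport_section[OF iso \<alpha>])
      interpret M: conn_vbundle A "tangent_bundle A" "df_conn_minus D" by unfold_locales (rule df(5))
      note Xp = vector_fieldD(2)[OF X] and Yp = vector_fieldD(2)[OF Y] and Zp = vector_fieldD(2)[OF Z p]
      have \<alpha>Y: "\<alpha> q v = metric D q v (Y q)" if q: "q \<in> U" and v: "v \<in> tangent_space A q" for q v
        using bundle_inv_right[OF bij CB.section_in[OF \<alpha> q]] metric_flat_apply[OF v, of "metric D" "Y q"]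
          metricD(2)[OF g v Yp[OF q]] by (simp add: Y_def)
      have mp: "df_conn_minus D p (Z p) Y \<in> tangent_space A p" using M.conn_in[OF Y p Zp] by simp
      have "tderiv A p (Z p) (\<lambda>q. \<alpha> q (X q)) = tderiv A p (Z p) (\<lambda>q. metric D q (X q) (Y q))"
        by (rule tderiv_cong[OF covector_field_eval_smooth[OF \<alpha> X] vector_fieldD(1)[OF X] p Zp \<alpha>Y[OF _ Xp]])
      also have "\<dots> = metric D p (df_conn_plus D p (Z p) X) (Y p) + metric D p (X p) (df_conn_minus D p (Z p) Y)"
        by (rule df(8)[OF X Y Z p])
      also have "\<dots> = \<alpha> p (df_conn_plus D p (Z p) X) + ?fl p (df_conn_minus D p (Z p) Y) (X p)"
        using \<alpha>Y[OF p nabla_in[OF X p Zp]] metricD(2)[OF g Xp[OF p] mp] metric_flat_apply[OF Xp[OF p]] by simp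
      also have "?fl p (df_conn_minus D p (Z p) Y) = transport_conn (tangent_bundle A) ?fl (df_conn_minus D) p (Z p) \<alpha>"
        by (simp add: transport_conn_def Y_def[abs_def])
      finally show "tderiv A p (Z p) (\<lambda>q. pairing ?L q (X q, 0) (0, \<alpha> q)) =
           pairing ?L p (df_conn_plus D p (Z p) X, 0) (0, \<alpha> p) +
           pairing ?L p (X p, 0) (0, transport_conn (tangent_bundle A) ?fl (df_conn_minus D) p (Z p) \<alpha>)"
        by simp
    qed
    note eq = conn_eq_sym[OF base_conn_plus_legendre_of[OF df(2)]]
    show "torsion_free A (base_conn_plus ?L)" by (rule conn_eq_torsion_free[OF eq df(4)])
    show "smooth_map_on A UNIV (df_potential D)" by (rule dually_flat_with_potentialD(2)[OF D])
    show "strictly_convex A (base_conn_plus ?L) (df_potential D)"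
      using conn_eq_strictly_convex[OF eq] dually_flat_with_potentialD(3)[OF D] by blast
  qed
qed

text \<open>The metric returns because it is the Hessian of its potential. For the minus connection,
  lowering in \<open>legendre_of\<close> meets raising in \<open>dually_flat_of\<close>; the two
  cancel once the rebuilt metric is known to be the original one.\<close>

lemma dually_flat_of_legendre_of:
  assumes D: "dually_flat_with_potential A D"
  shows "dually_flat_eq A (dually_flat_of A (legendre_of A D)) D"
proof -
  note dp = dually_flat_with_potentialD[OF D]
  note df = dually_flatD[OF dp(1)]
  note g = df(1)
  interpret flat_mfd A "df_conn_plus D" by unfold_locales (rule df)+
  interpret TC: smooth_vbundle2 A "tangent_bundle A" "cotangent_bundle A" by (rule TB_CB)
  interpret CT: smooth_vbundle2 A "cotangent_bundle A" "tangent_bundle A" by (rule TC.swap)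
  note iso = metric_flat_iso[OF g]
  let ?L = "legendre_of A D" and ?fl = "metric_flat A (metric D)"
  note eq = base_conn_plus_legendre_of[OF df(2)]
  have met: "legendre_metric A ?L p X Y = metric D p X Y"
    if X: "X \<in> tangent_space A p" and Y: "Y \<in> tangent_space A p" for p X Y
  proof -
    have h: "hess (df_potential D) p Y X = metric D p X Y"
      using metric_eq_hess[OF dp(2) g dp(4) Y X] metricD(2)[OF g X Y] by simp
    have "hessian_map A (base_conn_plus ?L) (df_potential D) p Y = metric_flat A (hess (df_potential D)) p Y"
      by (simp add: conn_eq_hessian_map[OF eq] hessian_map_eq[OF dp(2) Y])
    moreover have "metric_flat A (hess (df_potential D)) p Y \<in> cotangent_space A p"
      by (rule metric_flat_in[OF hess_riemannian[OF dp(2,3)] Y])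
    ultimately show ?thesis
      using X Y h
      by (simp add: legendre_metric_def legendre_morphism_def TB.bundle_inv_id CB.bundle_inv_id metric_flat_def)
  qed
  let ?i = "bundle_inv (tangent_bundle A) ?fl"
  have "conn_eq A (tangent_bundle A)
      (transport_conn (cotangent_bundle A) ?i (base_conn_minus ?L)) (df_conn_minus D)"
  proof (rule conn_eq_trans[OF _ TC.transport_conn_back[OF iso df(5)]])
    have "conn_eq A (cotangent_bundle A) (base_conn_minus ?L) (transport_conn (tangent_bundle A) ?fl (df_conn_minus D))"
      unfolding base_conn_minus_def legendre_of_simps
      by (rule CB.transport_conn_id[OF TC.transport_connection[OF iso df(5)]])
    then show "conn_eq A (tangent_bundle A) (transport_conn (cotangent_bundle A) ?i (base_conn_minus ?L))
        (transport_conn (cotangent_bundle A) ?i (transport_conn (tangent_bundle A) ?fl (df_conn_minus D)))"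
      by (rule CT.transport_conn_cong[OF TC.bundle_iso_sym[OF iso]])
  qed
  then show ?thesis
    unfolding dually_flat_eq_def dually_flat_of_def
    using met eq metric_flat_inv_cong[of "legendre_metric A ?L" "metric D"] by simp
qed


section \<open>From Legendre bundles to dually flat manifolds\<close>

lemma dually_flat_of_simps [simp]:
  "metric (dually_flat_of A L) = legendre_metric A L"
  "df_conn_plus (dually_flat_of A L) = base_conn_plus L"
  "df_conn_minus (dually_flat_of A L) = transport_conn (cotangent_bundle A)
       (bundle_inv (tangent_bundle A) (metric_flat A (legendre_metric A L))) (base_conn_minus L)"
  "df_potential (dually_flat_of A L) = potential L"
  by (simp_all add: dually_flat_of_def)

end

locale legendre = smooth_mfd A
  for A :: "('b::{t2_space, second_countable_topology}, 'n::finite) chart set" +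
  fixes L :: "('b, 'n, 'h::real_vector, 'k::real_vector) legendre_data"
  assumes legendre: "legendre_bundle A L"
begin

lemma legendreD:
  "vector_bundle A (Hplus L)" "vector_bundle A (Hminus L)"
  "bundle_iso A (Hplus L) (tangent_bundle A) (ident_plus L)"
  "bundle_iso A (Hminus L) (cotangent_bundle A) (ident_minus L)"
  "connection A (Hplus L) (conn_plus L)" "flat A (Hplus L) (conn_plus L)"
  "connection A (Hminus L) (conn_minus L)" "flat A (Hminus L) (conn_minus L)"
  "torsion_free A (base_conn_plus L)"
  "smooth_map_on A UNIV (potential L)"
  "strictly_convex A (base_conn_plus L) (potential L)"
  using legendre unfolding legendre_bundle_def by - (elim conjE, assumption)+

lemma pairing_rules:
  "\<forall>p. \<forall>x\<in>fibre (total_bundle L) p.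
        linear_on_subspace (fibre (total_bundle L) p) (\<lambda>y. pairing L p x y)"
  "\<forall>p. \<forall>x\<in>fibre (total_bundle L) p. \<forall>y\<in>fibre (total_bundle L) p.
        pairing L p x y = pairing L p y x"
  "\<forall>p. \<forall>x\<in>fibre (Hplus L) p. \<forall>y\<in>fibre (Hplus L) p. pairing L p (x, 0) (y, 0) = 0"
  "\<forall>p. \<forall>\<alpha>\<in>fibre (Hminus L) p. \<forall>\<beta>\<in>fibre (Hminus L) p. pairing L p (0, \<alpha>) (0, \<beta>) = 0"
  "\<forall>p. \<forall>x\<in>fibre (Hplus L) p. \<forall>\<alpha>\<in>fibre (Hminus L) p.
        pairing L p (x, 0) (0, \<alpha>) = ident_minus L p \<alpha> (ident_plus L p x)"
  "\<forall>U X \<alpha> Z. smooth_section A (Hplus L) U X \<and> smooth_section A (Hminus L) U \<alpha> \<and>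
        vector_field A U Z \<longrightarrow>
        (\<forall>p\<in>U. tderiv A p (Z p) (\<lambda>q. pairing L q (X q, 0) (0, \<alpha> q)) =
           pairing L p (conn_plus L p (Z p) X, 0) (0, \<alpha> p) +
           pairing L p (X p, 0) (0, conn_minus L p (Z p) \<alpha>))"
  using legendre unfolding legendre_bundle_def by - (elim conjE, assumption)+

lemmas pairing_mixed = pairing_rules(5)[rule_format]

sublocale P: conn_vbundle A "Hplus L" "conn_plus L"
  by unfold_locales (rule legendreD)+

sublocale M: conn_vbundle A "Hminus L" "conn_minus L"
  by unfold_locales (rule legendreD)+

lemma PT: "smooth_vbundle2 A (Hplus L) (tangent_bundle A)"
  by unfold_locales

lemma MC: "smooth_vbundle2 A (Hminus L) (cotangent_bundle A)"
  by unfold_locales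

lemma ident_plus_bij: "bij_betw (ident_plus L p) (fibre (Hplus L) p) (fibre (tangent_bundle A) p)"
  by (rule bundle_isoD(2)[OF legendreD(3)])

lemma ident_minus_bij: "bij_betw (ident_minus L p) (fibre (Hminus L) p) (fibre (cotangent_bundle A) p)"
  by (rule bundle_isoD(2)[OF legendreD(4)])

lemma base_plus_connection: "connection A (tangent_bundle A) (base_conn_plus L)"
  unfolding base_conn_plus_def by (rule smooth_vbundle2.transport_connection[OF PT legendreD(3,5)])

text \<open>Torsion-freeness is assumed of the base connection, flatness of the one on
  \<open>Hplus L\<close>. Transporting flatness needs tangent brackets, and these come from the base
  connection being torsion-free.\<close>

sublocale flat_mfd A "base_conn_plus L"
proof unfold_locales
  show "connection A (tangent_bundle A) (base_conn_plus L)" by (rule base_plus_connection)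
  show "torsion_free A (base_conn_plus L)" by (rule legendreD)
  show "flat A (tangent_bundle A) (base_conn_plus L)"
    unfolding base_conn_plus_def
    by (rule smooth_vbundle2.transport_flat[OF PT legendreD(3,5,6) torsion_free_bracket_in[OF base_plus_connection legendreD(9)]])
qed

lemma base_minus_connection: "connection A (cotangent_bundle A) (base_conn_minus L)"
  unfolding base_conn_minus_def by (rule smooth_vbundle2.transport_connection[OF MC legendreD(4,7)])

lemma base_minus_flat: "flat A (cotangent_bundle A) (base_conn_minus L)"
  unfolding base_conn_minus_def by (rule smooth_vbundle2.transport_flat[OF MC legendreD(4,7,8) bracket_in])

abbreviation "h \<equiv> hess (potential L)"

lemma h_riemannian: "riemannian_metric A h"
  by (rule hess_riemannian[OF legendreD(10,11)])

text \<open>Both identifications cancel against their inverses, and the mixed values of the pairing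
  leave the Hessian of the potential on the base.\<close>

lemma legendre_metric_eq:
  assumes X: "X \<in> tangent_space A p" and Y: "Y \<in> tangent_space A p"
  shows "legendre_metric A L p X Y = h p X Y"
proof -
  have m: "metric_flat A h p Y \<in> cotangent_space A p" by (rule metric_flat_in[OF h_riemannian Y])
  have Y': "ident_plus L p (bundle_inv (Hplus L) (ident_plus L) p Y) = Y"
    and X': "ident_plus L p (bundle_inv (Hplus L) (ident_plus L) p X) = X"
    using bundle_inv_right[OF ident_plus_bij] X Y by simp_all
  have "legendre_morphism A L p (bundle_inv (Hplus L) (ident_plus L) p Y) =
      bundle_inv (Hminus L) (ident_minus L) p (metric_flat A h p Y)"
    by (simp add: legendre_morphism_def Y' hessian_map_eq[OF legendreD(10) Y])
  then have "legendre_metric A L p X Y = metric_flat A h p Y X"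
    unfolding legendre_metric_def
    using pairing_mixed[OF bundle_inv_in[OF ident_plus_bij] bundle_inv_in[OF ident_minus_bij]] X m
      bundle_inv_right[OF ident_minus_bij] by (simp add: X')
  then show ?thesis using hess_sym[OF legendreD(10) X Y] by (simp add: metric_flat_apply[OF X])
qed

lemma legendre_metric_riemannian: "riemannian_metric A (legendre_metric A L)"
  by (rule riemannian_metric_cong[OF h_riemannian]) (simp add: legendre_metric_eq)

lemma flat_iso: "bundle_iso A (tangent_bundle A) (cotangent_bundle A) (metric_flat A h)"
  by (rule metric_flat_iso[OF h_riemannian])

abbreviation "nabla_minus \<equiv> df_conn_minus (dually_flat_of A L)"

text \<open>The metric enters through its values on tangent vectors, so
  \<open>legendre_metric\<close> may be replaced by the tensor \<open>h\<close>, for which the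
  theory of Hessian metrics is available.\<close>

lemma nabla_minus_eq:
  "nabla_minus = transport_conn (cotangent_bundle A) (bundle_inv (tangent_bundle A) (metric_flat A h)) (base_conn_minus L)"
  using metric_flat_inv_cong[of "legendre_metric A L" h] legendre_metric_eq by simp

lemma CB_TB: "smooth_vbundle2 A (cotangent_bundle A) (tangent_bundle A)"
  by unfold_locales

lemma flat_iso_sym: "bundle_iso A (cotangent_bundle A) (tangent_bundle A) (bundle_inv (tangent_bundle A) (metric_flat A h))"
  by (rule smooth_vbundle2.bundle_iso_sym[OF TB_CB flat_iso])

lemma nabla_minus_connection: "connection A (tangent_bundle A) nabla_minus"
  unfolding nabla_minus_eq
  by (rule smooth_vbundle2.transport_connection[OF CB_TB flat_iso_sym base_minus_connection])

lemma nabla_minus_flat: "flat A (tangent_bundle A) nabla_minus"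
  unfolding nabla_minus_eq
  by (rule smooth_vbundle2.transport_flat[OF CB_TB flat_iso_sym base_minus_connection base_minus_flat bracket_in])

text \<open>The fields are moved to the bundle: \<open>X\<close> becomes a section of
  \<open>Hplus L\<close>, and \<open>Y\<close>, lowered by the metric, becomes a section of
  \<open>Hminus L\<close>. Compatibility of the connections with the pairing, read back on the base,
  is the claim.\<close>

lemma duality:
  assumes X: "vector_field A U X" and Y: "vector_field A U Y" and Z: "vector_field A U Z" and p: "p \<in> U"
  shows "tderiv A p (Z p) (\<lambda>q. h q (X q) (Y q)) =
    h p (base_conn_plus L p (Z p) X) (Y p) + h p (X p) (nabla_minus p (Z p) Y)"
proof -
  let ?fl = "metric_flat A h" and ?\<iota> = "bundle_inv (Hplus L) (ident_plus L)" and ?\<mu> = "bundle_inv (Hminus L) (ident_minus L)"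
  note g = h_riemannian
  interpret MC: smooth_vbundle2 A "Hminus L" "cotangent_bundle A" by (rule MC)
  interpret PT: smooth_vbundle2 A "Hplus L" "tangent_bundle A" by (rule PT)
  interpret TC: smooth_vbundle2 A "tangent_bundle A" "cotangent_bundle A" by (rule TB_CB)
  interpret bm: conn_vbundle A "cotangent_bundle A" "base_conn_minus L" by unfold_locales (rule base_minus_connection)
  note fbij = bundle_isoD(2)[OF flat_iso]
  have fY: "smooth_section A (cotangent_bundle A) U (\<lambda>q. ?fl q (Y q))"
    by (rule TC.section_bundle_map[OF bundle_isoD(1)[OF flat_iso] Y])
  define X' where "X' q = ?\<iota> q (X q)" for q
  define \<alpha> where "\<alpha> q = ?\<mu> q (?fl q (Y q))" for q
  have X': "smooth_section A (Hplus L) U X'" unfolding X'_def by (rule PT.transport_section[OF legendreD(3) X])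
  have \<alpha>: "smooth_section A (Hminus L) U \<alpha>" unfolding \<alpha>_def by (rule MC.transport_section[OF legendreD(4) fY])
  have \<iota>X: "ident_plus L q (X' q) = X q" if "q \<in> U" for q
    unfolding X'_def using bundle_inv_right[OF ident_plus_bij] vector_fieldD(2)[OF X that] by simp
  have \<mu>\<alpha>: "ident_minus L q (\<alpha> q) = ?fl q (Y q)" if "q \<in> U" for q
    unfolding \<alpha>_def using bundle_inv_right[OF ident_minus_bij] CB.section_in[OF fY that] by simp
  note Xp = vector_fieldD(2)[OF X] and Yp = vector_fieldD(2)[OF Y] and Zp = vector_fieldD(2)[OF Z p]
  have pair: "pairing L q (X' q, 0) (0, \<alpha> q) = h q (X q) (Y q)" if q: "q \<in> U" for q
    using pairing_mixed[OF P.section_in[OF X' q] M.section_in[OF \<alpha> q]] hess_sym[OF legendreD(10) Xp[OF q] Yp[OF q]]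
    by (simp add: \<iota>X[OF q] \<mu>\<alpha>[OF q] metric_flat_apply[OF Xp[OF q]])
  have np: "base_conn_plus L p (Z p) X = ident_plus L p (conn_plus L p (Z p) X')"
    by (simp add: base_conn_plus_def transport_conn_def X'_def[abs_def])
  have "pairing L p (conn_plus L p (Z p) X', 0) (0, \<alpha> p) = ?fl p (Y p) (base_conn_plus L p (Z p) X)"
    using pairing_mixed[OF P.conn_in[OF X' p Zp] M.section_in[OF \<alpha> p]] by (simp add: np \<mu>\<alpha>[OF p])
  then have 1: "pairing L p (conn_plus L p (Z p) X', 0) (0, \<alpha> p) = h p (base_conn_plus L p (Z p) X) (Y p)"
    using hess_sym[OF legendreD(10) nabla_in[OF X p Zp] Yp[OF p]] by (simp add: metric_flat_apply[OF nabla_in[OF X p Zp]])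
  have "base_conn_minus L p (Z p) (\<lambda>q. bundle_inv (cotangent_bundle A) (bundle_inv (tangent_bundle A) ?fl) q (Y q)) =
      base_conn_minus L p (Z p) (\<lambda>q. ?fl q (Y q))"
    by (rule bm.conn_cong'[symmetric, OF fY _ p Zp]) (simp add: TC.bundle_inv_bundle_inv[OF flat_iso] Yp)
  also have "\<dots> = ident_minus L p (conn_minus L p (Z p) \<alpha>)"
    by (simp add: base_conn_minus_def transport_conn_def \<alpha>_def[abs_def])
  finally have "nabla_minus p (Z p) Y = bundle_inv (tangent_bundle A) ?fl p (ident_minus L p (conn_minus L p (Z p) \<alpha>))"
    unfolding nabla_minus_eq by (simp add: transport_conn_def)
  moreover have m: "ident_minus L p (conn_minus L p (Z p) \<alpha>) \<in> fibre (cotangent_bundle A) p"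
    by (rule bundle_mapD(1)[OF bundle_isoD(1)[OF legendreD(4)] M.conn_in[OF \<alpha> p Zp]])
  ultimately have nm: "?fl p (nabla_minus p (Z p) Y) = ident_minus L p (conn_minus L p (Z p) \<alpha>)"
    and nmT: "nabla_minus p (Z p) Y \<in> tangent_space A p"
    using bundle_inv_right[OF fbij m] bundle_inv_in[OF fbij m] by simp_all
  have "pairing L p (X' p, 0) (0, conn_minus L p (Z p) \<alpha>) = ?fl p (nabla_minus p (Z p) Y) (X p)"
    using pairing_mixed[OF P.section_in[OF X' p] M.conn_in[OF \<alpha> p Zp]] unfolding nm \<iota>X[OF p] .
  then have 2: "pairing L p (X' p, 0) (0, conn_minus L p (Z p) \<alpha>) = h p (X p) (nabla_minus p (Z p) Y)"
    using hess_sym[OF legendreD(10) Xp[OF p] nmT] by (simp add: metric_flat_apply[OF Xp[OF p]])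
  have "tderiv A p (Z p) (\<lambda>q. h q (X q) (Y q)) = tderiv A p (Z p) (\<lambda>q. pairing L q (X' q, 0) (0, \<alpha> q))"
    by (rule tderiv_cong[OF metricD(4)[OF g X Y] vector_fieldD(1)[OF X] p Zp pair[symmetric]])
  also have "\<dots> = pairing L p (conn_plus L p (Z p) X', 0) (0, \<alpha> p) + pairing L p (X' p, 0) (0, conn_minus L p (Z p) \<alpha>)"
    using pairing_rules(6) X' \<alpha> Z p by blast
  finally show ?thesis using 1 2 by simp
qed

lemma dually_flat_with_potential_of: "dually_flat_with_potential A (dually_flat_of A L)"
proof -
  note \<Psi> = legendreD(10) and convex = legendreD(11)
  interpret nm: conn_vbundle A "tangent_bundle A" nabla_minus by unfold_locales (rule nabla_minus_connection)
  have coord: "legendre_metric A L p (coord_field A c i p) (coord_field A c j p) = hessian c (potential L) p i j"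
    if c: "flat_coords A (base_conn_plus L) c" and p: "p \<in> fst c" for c p i j
    using legendre_metric_eq[OF coord_field_in coord_field_in] flat_coordsD(1)[OF c] p hess_coord[OF \<Psi> c p] by simp
  have dual: "tderiv A p (Z p) (\<lambda>q. legendre_metric A L q (X q) (Y q)) =
      legendre_metric A L p (base_conn_plus L p (Z p) X) (Y p) + legendre_metric A L p (X p) (nabla_minus p (Z p) Y)"
    if X: "vector_field A U X" and Y: "vector_field A U Y" and Z: "vector_field A U Z" and p: "p \<in> U" for U X Y Z p
  proof -
    note Zp = vector_fieldD(2)[OF Z p]
    have "tderiv A p (Z p) (\<lambda>q. legendre_metric A L q (X q) (Y q)) = tderiv A p (Z p) (\<lambda>q. h q (X q) (Y q))"
      by (rule tderiv_cong[OF metricD(4)[OF legendre_metric_riemannian X Y] vector_fieldD(1)[OF X] p Zp])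
        (rule legendre_metric_eq[OF vector_fieldD(2)[OF X] vector_fieldD(2)[OF Y]])
    then show ?thesis
      using duality[OF X Y Z p] legendre_metric_eq[OF nabla_in[OF X p Zp] vector_fieldD(2)[OF Y p]]
        legendre_metric_eq[OF vector_fieldD(2)[OF X p], of "nabla_minus p (Z p) Y"] nm.conn_in[OF Y p Zp] by simp
  qed
  have "torsion_free A nabla_minus"
    by (rule dual_torsion_free[OF \<Psi> convex nabla_minus_connection]) (rule duality)
  then have "dually_flat A (legendre_metric A L) (base_conn_plus L) nabla_minus"
    unfolding dually_flat_def
  proof (intro conjI)
    show "\<forall>U X Y Z. vector_field A U X \<and> vector_field A U Y \<and> vector_field A U Z \<longrightarrow>
        (\<forall>p\<in>U. tderiv A p (Z p) (\<lambda>q. legendre_metric A L q (X q) (Y q)) =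
           legendre_metric A L p (base_conn_plus L p (Z p) X) (Y p) + legendre_metric A L p (X p) (nabla_minus p (Z p) Y))"
      by (intro allI impI ballI, elim conjE) (rule dual)
    show "\<forall>p. \<exists>c \<psi> \<psi>s. p \<in> fst c \<and> flat_coords A (base_conn_plus L) c \<and>
        local_potentials A (legendre_metric A L) c \<psi> \<psi>s"
      by (rule allI, rule local_potentials_ex[OF \<Psi> convex coord])
  qed (rule legendre_metric_riemannian N.connection flat torsion_free nabla_minus_connection nabla_minus_flat)+
  then show ?thesis
    unfolding dually_flat_with_potential_def
    using \<Psi> convex coord by simp
qed

text \<open>The axioms leave no freedom in the pairing: it splits additively, the two pure parts
  vanish, and the mixed parts are evaluation. Linearity is assumed in the second argument, so the
  first one is reached by symmetry.\<close>

lemma pairing_eq: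
  assumes x: "x \<in> fibre (Hplus L) p" and \<alpha>: "\<alpha> \<in> fibre (Hminus L) p"
    and y: "y \<in> fibre (Hplus L) p" and \<beta>: "\<beta> \<in> fibre (Hminus L) p"
  shows "pairing L p (x, \<alpha>) (y, \<beta>) = ident_minus L p \<alpha> (ident_plus L p y) + ident_minus L p \<beta> (ident_plus L p x)"
proof -
  have fib: "fibre (total_bundle L) p = fibre (Hplus L) p \<times> fibre (Hminus L) p"
    by (simp add: total_bundle_def whitney_sum_def)
  have in1: "(u, \<gamma>) \<in> fibre (total_bundle L) p" if "u \<in> fibre (Hplus L) p" "\<gamma> \<in> fibre (Hminus L) p" for u \<gamma>
    using that fib by simp
  note z = subspace_0[OF P.fibre_subspace] subspace_0[OF M.fibre_subspace]
  have split: "pairing L p w (u, \<gamma>) = pairing L p w (u, 0) + pairing L p w (0, \<gamma>)"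
    if w: "w \<in> fibre (total_bundle L) p" and u: "u \<in> fibre (Hplus L) p" and \<gamma>: "\<gamma> \<in> fibre (Hminus L) p" for w u \<gamma>
    using los_add[OF pairing_rules(1)[rule_format, OF w] in1[OF u z(2)] in1[OF z(1) \<gamma>]] by simp
  note sym = pairing_rules(2)[rule_format]
  have "pairing L p (x, \<alpha>) (y, \<beta>) = pairing L p (y, 0) (x, \<alpha>) + pairing L p (0, \<beta>) (x, \<alpha>)"
    using split[OF in1[OF x \<alpha>] y \<beta>] sym[OF in1[OF x \<alpha>] in1[OF y z(2)]] sym[OF in1[OF x \<alpha>] in1[OF z(1) \<beta>]] by simp
  also have "\<dots> = pairing L p (y, 0) (0, \<alpha>) + pairing L p (x, 0) (0, \<beta>)"
    using split[OF in1[OF y z(2)] x \<alpha>] split[OF in1[OF z(1) \<beta>] x \<alpha>] pairing_rules(3)[rule_format, OF y x]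
      pairing_rules(4)[rule_format, OF \<beta> \<alpha>] sym[OF in1[OF z(1) \<beta>] in1[OF x z(2)]] by simp
  finally show ?thesis using pairing_mixed[OF y \<alpha>] pairing_mixed[OF x \<beta>] by simp
qed

text \<open>The identifications themselves form the isomorphism. The pairings match by
  \<open>pairing_eq\<close>, the minus connections because raising followed by lowering is trivial,
  and both Legendre morphisms become the metric dual with respect to \<open>h\<close>.\<close>

lemma legendre_iso_legendre_of:
  "legendre_iso A L (legendre_of A (dually_flat_of A L)) (ident_plus L) (ident_minus L)"
  unfolding legendre_iso_def legendre_of_simps dually_flat_of_simps
proof (intro conjI allI ballI refl)
  let ?L' = "legendre_of A (dually_flat_of A L)"
  show "bundle_iso A (Hplus L) (tangent_bundle A) (ident_plus L)"
    "bundle_iso A (Hminus L) (cotangent_bundle A) (ident_minus L)" by (rule legendreD)+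
  show "conn_eq A (tangent_bundle A) (transport_conn (Hplus L) (ident_plus L) (conn_plus L)) (base_conn_plus L)"
    unfolding base_conn_plus_def by (rule conn_eq_refl)
  show "conn_eq A (cotangent_bundle A) (transport_conn (Hminus L) (ident_minus L) (conn_minus L))
     (transport_conn (tangent_bundle A) (metric_flat A (legendre_metric A L)) (transport_conn (cotangent_bundle A)
       (bundle_inv (tangent_bundle A) (metric_flat A (legendre_metric A L))) (base_conn_minus L)))"
    using conn_eq_sym[OF smooth_vbundle2.transport_conn_forth[OF TB_CB metric_flat_iso[OF legendre_metric_riemannian] base_minus_connection]]
    unfolding base_conn_minus_def .
  fix p
  show "pairing ?L' p (map_prod (ident_plus L p) (ident_minus L p) x) (map_prod (ident_plus L p) (ident_minus L p) y) = pairing L p x y"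
    if "x \<in> fibre (total_bundle L) p" "y \<in> fibre (total_bundle L) p" for x y
    using that by (cases x; cases y) (simp add: total_bundle_def whitney_sum_def pairing_eq)
  fix x assume x: "x \<in> fibre (Hplus L) p"
  have X: "ident_plus L p x \<in> tangent_space A p"
    using bundle_mapD(1)[OF bundle_isoD(1)[OF legendreD(3)] x] by simp
  have m: "metric_flat A h p (ident_plus L p x) \<in> cotangent_space A p" by (rule metric_flat_in[OF h_riemannian X])
  \<comment> \<open>The two base connections have the same flat charts, so both Legendre morphisms
    come from the same Hessian map.\<close>
  have "conn_eq A (tangent_bundle A) (base_conn_plus ?L') (base_conn_plus L)"
    using base_conn_plus_legendre_of[of "dually_flat_of A L"] N.connection by simp
  from conn_eq_hessian_map[OF this]
  have "legendre_morphism A ?L' p (ident_plus L p x) = metric_flat A h p (ident_plus L p x)"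
    by (simp add: legendre_morphism_def hessian_map_eq[OF legendreD(10) X] CB.bundle_inv_id m)
  moreover have "ident_minus L p (legendre_morphism A L p x) = metric_flat A h p (ident_plus L p x)"
    using bundle_inv_right[OF ident_minus_bij] m
    by (simp add: legendre_morphism_def hessian_map_eq[OF legendreD(10) X])
  ultimately show "ident_minus L p (legendre_morphism A L p x) = legendre_morphism A ?L' p (ident_plus L p x)" by simp
qed

end

theorem proposition1:
  fixes A :: "('b::{t2_space, second_countable_topology}, 'n::finite) chart set"
  assumes "smooth_manifold A"
  shows "(\<forall>D. dually_flat_with_potential A D \<longrightarrow>
            legendre_bundle A (legendre_of A D) \<and>
            dually_flat_eq A (dually_flat_of A (legendre_of A D)) D) \<and>
         (\<forall>L :: ('b, 'n, 'h::real_vector, 'k::real_vector) legendre_data. legendre_bundle A L \<longrightarrow>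
            dually_flat_with_potential A (dually_flat_of A L) \<and>
            legendre_iso A L (legendre_of A (dually_flat_of A L)) (ident_plus L) (ident_minus L))"
proof (intro conjI allI impI)
  interpret smooth_mfd A by unfold_locales (rule assms)
  show "legendre_bundle A (legendre_of A D)" "dually_flat_eq A (dually_flat_of A (legendre_of A D)) D"
    if "dually_flat_with_potential A D" for D
    using that by (rule legendre_bundle_legendre_of dually_flat_of_legendre_of)+
  fix L :: "('b, 'n, 'h, 'k) legendre_data" assume "legendre_bundle A L"
  then interpret legendre A L by unfold_locales
  show "dually_flat_with_potential A (dually_flat_of A L)" by (rule dually_flat_with_potential_of)
  show "legendre_iso A L (legendre_of A (dually_flat_of A L)) (ident_plus L) (ident_minus L)"
    by (rule legendre_iso_legendre_of)
qed

end
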